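(* (Conditional stability of the iterated lowest order explicit scheme.) Let $0\le\tau\le1$. If $q\ge1$ is large enough to admit $$\|X_h\|_{M_0}\lesssim h_{\mathtt v}^{1/(q+1)},$$ then there is a $c_q>0$ independent of $h_{\mathtt v}$ such that for all $v_0\in V_h^{\mathtt v}$, $$\|R^{\rm exp}_{h1q}(\tau)v_0\|_{M(\tau)}\le(1+c_qh_{\mathtt v})\|v_0\|_{M_0}.$$
   Context: **Coefficients.** $\Omega\subset\mathbb R^N$ is open and bounded, with a conforming simplicial mesh $\Omega_h$ from a shape regular family. $\mathcal L^{(j)}$ ($1\le j\le N$) and $\mathcal G$ are bounded symmetric $\mathbb R^{L\times L}$-valued functions on $\Omega$, constant on each mesh element, $\mathcal G$ uniformly positive definite, and $\sum_j\partial_j\mathcal L^{(j)}=0$ in the sense of distributions. $\mathcal D^{(\nu)}=\sum_j\nu_j\mathcal L^{(j)}$, and $\mathcal D=\mathcal D^{(n)}$ with $n$ the outward unit normal on the boundary considered. $c$ is the largest $|\lambda|$ with $\mathcal D^{(\nu)}(x)e=\lambda\mathcal G(x)e$, $e\ne0$, over all $x$ and unit $\nu$; $\hat c>c$ is fixed. **Tent.** For a mesh vertex $\mathtt v$, $\Omega^{\mathtt v}$ is the vertex patch, $\Omega_h^{\mathtt v}$ its set of elements, $h_{\mathtt v}=\max_{K\in\Omega_h^{\mathtt v}}\operatorname{diam}K$. A tent is $T^{\mathtt v}=\{(x,t):x\in\Omega^{\mathtt v},\varphi_{\rm bot}(x)\le t\le\varphi_{\rm top}(x)\}$, with $\varphi_{\rm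 bot}\le\varphi_{\rm top}$ continuous on $\Omega^{\mathtt v}$, linear on each element, and equal at all vertices of the patch other than $\mathtt v$. It is causal: $\|\operatorname{grad}_x\varphi_{\rm bot}\|_2,\|\operatorname{grad}_x\varphi_{\rm top}\|_2\le1/\hat c$. $\delta=\varphi_{\rm top}-\varphi_{\rm bot}$ vanishes on $\partial\Omega^{\mathtt v}\setminus\partial\Omega$. **Spaces and operators.** $(\cdot,\cdot)_{\mathtt v}$ is the inner product of $L^2(\Omega^{\mathtt v})^L$; $V_h^{\mathtt v}=\{v:v|_K\in P_p(K)^L,\ K\in\Omega_h^{\mathtt v}\}$, $p\ge0$. $M_0w=\mathcal Gw-\sum_j(\partial_j\varphi_{\rm bot})\mathcal L^{(j)}w$, $M_1w=\sum_j(\partial_j\delta)\mathcal L^{(j)}w$, $M(\tau)=M_0-\tau M_1$ (these leave $V_h^{\mathtt v}$ invariant, and $M(\tau)$ is selfadjoint positive definite for $0\le\tau\le1$); $\|z\|_{M(\tau)}=(M(\tau)z,z)_{\mathtt v}^{1/2}$, $\|\cdot\|_{M_0}=\|\cdot\|_{M(0)}$; for an operator on $V_h^{\mathtt v}$, $\|\cdot\|_{M_0}$ is the induced operator norm. **DG form.** $a(w,v)=\sum_{K\in\Omega_h^{\mathtt v}}\big[\sum_j(\delta\mathcal L^{(j)}w,\partial_jv)_K-(\delta\hat F^n_w,v)_{\partial K}\big]$, with $\hat F_w^n=\mathcal D\{w\}+S[\![w]\!]$ on $\partial K\setminus\partial\Omega$ and $\hat F_w^n=\frac12(\mathcal D+B)w$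 on $\partial K\cap\partial\Omega$, where $\{w\}=\frac12(w+w_o)$, $[\![w]\!]=w-w_o$, $w_o$ being the value from the neighboring element (facets in $\partial\Omega^{\mathtt v}\setminus\partial\Omega$ contribute nothing since $\delta=0$ there). $S$ (bounded, single-valued on interior facets) and $B$ (bounded, on $\partial\Omega$) are $\mathbb R^{L\times L}$-valued with $S+S^t\ge0$, $B+B^t\ge0$. $A_h:V_h^{\mathtt v}\to V_h^{\mathtt v}$ is defined by $(A_hw,v)_{\mathtt v}=a(w,v)$. **Explicit flow.** $X_h=M_0^{-1}(A_h+M_1)$ on $V_h^{\mathtt v}$. For $v_0\in V_h^{\mathtt v}$ put $v_\ell=v_0+\tau X_hv_{\ell-1}$, $\ell=1,\dots,q$; $R^{\rm exp}_{h1q}(\tau)v_0=v_q$. **Convention.** $a\lesssim b$ means $a\le Cb$ with $C>0$ independent of the mesh within the shape regular family and of the tent ($c_q$ may depend on the constant implied in the hypothesis). *)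

theory Defs
  imports "HOL-Analysis.Analysis"
begin

section \<open>Calculus\<close>

definition partial :: "'n::finite \<Rightarrow> (real^'n \<Rightarrow> 'b::real_normed_vector) \<Rightarrow> real^'n \<Rightarrow> 'b" where
  "partial j f x = frechet_derivative f (at x) (axis j 1)"

definition grad :: "(real^'n::finite \<Rightarrow> real) \<Rightarrow> real^'n \<Rightarrow> real^'n" where
  "grad f x = (\<chi> j. partial j f x)"

text \<open>The test functions are the infinitely differentiable functions with compact support in the
  open set; smoothness says that all iterated partial derivatives are (Frechet) differentiable.\<close>

definition test_function :: "(real^'n::finite) set \<Rightarrow> (real^'n \<Rightarrow> real) \<Rightarrow> bool" where
  "test_function \<Omega> \<psi> \<longleftrightarrow>
     (\<forall>js. foldr partial js \<psi> differentiable_on UNIV) \<and>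
     compact (closure {x. \<psi> x \<noteq> 0}) \<and> closure {x. \<psi> x \<noteq> 0} \<subseteq> \<Omega>"

definition distributional_div_zero ::
  "(real^'n::finite) set \<Rightarrow> ('n \<Rightarrow> real^'n \<Rightarrow> real^'l^'l::finite) \<Rightarrow> bool" where
  "distributional_div_zero \<Omega> L \<longleftrightarrow>
     (\<forall>\<psi>. test_function \<Omega> \<psi> \<longrightarrow>
        (\<Sum>j\<in>UNIV. LINT x:\<Omega>|lebesgue. partial j \<psi> x *\<^sub>R L j x) = 0)"

section \<open>Coefficients\<close>

definition symmetric_matrix :: "real^'l^'l::finite \<Rightarrow> bool" where
  "symmetric_matrix A \<longleftrightarrow> transpose A = A"

definition positive_semidefinite :: "real^'l^'l::finite \<Rightarrow> bool" where
  "positive_semidefinite A \<longleftrightarrow> (\<forall>e. 0 \<le> e \<bullet> (A *v e))"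

definition flux_matrix ::
  "('n::finite \<Rightarrow> real^'n \<Rightarrow> real^'l^'l::finite) \<Rightarrow> real^'n \<Rightarrow> real^'n \<Rightarrow> real^'l^'l" where
  "flux_matrix L \<nu> x = (\<Sum>j\<in>UNIV. (\<nu> $ j) *\<^sub>R L j x)"

definition max_speed ::
  "(real^'n::finite) set \<Rightarrow> ('n \<Rightarrow> real^'n \<Rightarrow> real^'l^'l::finite) \<Rightarrow> (real^'n \<Rightarrow> real^'l^'l) \<Rightarrow> real" where
  "max_speed \<Omega> L G = Sup {\<bar>lam\<bar> | lam.
     \<exists>x\<in>\<Omega>. \<exists>\<nu> e. norm \<nu> = 1 \<and> e \<noteq> 0 \<and> flux_matrix L \<nu> x *v e = lam *\<^sub>R (G x *v e)}"

section \<open>Meshes and tents\<close>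

text \<open>Mesh elements are closed simplices.  Requiring their interiors to lie in \<open>\<Omega>\<close>, and not only in
  the interior of its closure, keeps the boundary of \<open>\<Omega>\<close> off the element interiors.\<close>

definition conforming_mesh :: "(real^'n::finite) set \<Rightarrow> (real^'n) set set \<Rightarrow> bool" where
  "conforming_mesh \<Omega> \<H> \<longleftrightarrow>
     triangulation \<H> \<and> (\<forall>K\<in>\<H>. int CARD('n) simplex K) \<and>
     \<Union>\<H> = closure \<Omega> \<and> (\<forall>K\<in>\<H>. interior K \<subseteq> \<Omega>)"

definition shape_regular :: "real \<Rightarrow> (real^'n::finite) set set \<Rightarrow> bool" where
  "shape_regular \<sigma> \<H> \<longleftrightarrow> (\<forall>K\<in>\<H>. \<exists>x r. r > 0 \<and> cball x r \<subseteq> K \<and> diameter K \<le> \<sigma> * r)"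

definition mesh_vertices :: "(real^'n::finite) set set \<Rightarrow> (real^'n) set" where
  "mesh_vertices \<H> = {x. \<exists>K\<in>\<H>. x extreme_point_of K}"

text \<open>The part of the mesh skeleton that lies inside \<open>\<Omega>\<close>, i.e. the union of the interior facets.\<close>

definition interior_skeleton :: "(real^'n::finite) set \<Rightarrow> (real^'n) set set \<Rightarrow> (real^'n) set" where
  "interior_skeleton \<Omega> \<H> = (\<Union>K\<in>\<H>. frontier K) - frontier \<Omega>"

definition vertex_patch :: "(real^'n::finite) set set \<Rightarrow> real^'n \<Rightarrow> (real^'n) set set" where
  "vertex_patch \<H> v = {K\<in>\<H>. v extreme_point_of K}"

definition patch_diameter :: "(real^'n::finite) set set \<Rightarrow> real" where
  "patch_diameter P = Max (diameter ` P)"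

definition affine_function_on :: "(real^'n::finite) set \<Rightarrow> (real^'n \<Rightarrow> real) \<Rightarrow> bool" where
  "affine_function_on K f \<longleftrightarrow> (\<exists>a b. \<forall>x\<in>K. f x = a \<bullet> x + b)"

text \<open>A causal tent is given by its bottom and top over the patch of the vertex \<open>v\<close>.\<close>

definition causal_tent ::
  "real \<Rightarrow> (real^'n::finite) set set \<Rightarrow> real^'n \<Rightarrow> (real^'n \<Rightarrow> real) \<Rightarrow> (real^'n \<Rightarrow> real) \<Rightarrow> bool" where
  "causal_tent chat \<H> v \<phi>bot \<phi>top \<longleftrightarrow>
     (let P = vertex_patch \<H> v in
       v \<in> mesh_vertices \<H> \<and>
       (\<forall>\<phi>\<in>{\<phi>bot, \<phi>top}. continuous_on (\<Union>P) \<phi> \<and>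
          (\<forall>K\<in>P. affine_function_on K \<phi> \<and> (\<forall>x\<in>interior K. norm (grad \<phi> x) \<le> 1 / chat))) \<and>
       (\<forall>x\<in>\<Union>P. \<phi>bot x \<le> \<phi>top x) \<and>
       (\<forall>x\<in>mesh_vertices P - {v}. \<phi>bot x = \<phi>top x))"

section \<open>Broken polynomials\<close>

definition polynomial_degree_le :: "nat \<Rightarrow> (real^'n::finite \<Rightarrow> real^'l::finite) \<Rightarrow> bool" where
  "polynomial_degree_le p f \<longleftrightarrow>
     (\<exists>c :: ('n \<Rightarrow> nat) \<Rightarrow> real^'l.
        \<forall>x. f x = (\<Sum>\<alpha> | (\<Sum>i\<in>UNIV. \<alpha> i) \<le> p. (\<Prod>i\<in>UNIV. (x $ i) ^ \<alpha> i) *\<^sub>R c \<alpha>))"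

text \<open>The members of \<open>V\<^sub>h\<close> are classes of functions that agree almost everywhere.  The representative
  used here vanishes off the (open) element interiors, which makes it unique.\<close>

definition Vh :: "nat \<Rightarrow> (real^'n::finite) set set \<Rightarrow> (real^'n \<Rightarrow> real^'l::finite) set" where
  "Vh p P = {w. (\<forall>K\<in>P. \<exists>f. polynomial_degree_le p f \<and> (\<forall>x\<in>interior K. w x = f x)) \<and>
                (\<forall>x. x \<notin> (\<Union>K\<in>P. interior K) \<longrightarrow> w x = 0)}"

definition patch_inner ::
  "(real^'n::finite) set set \<Rightarrow> (real^'n \<Rightarrow> real^'l::finite) \<Rightarrow> (real^'n \<Rightarrow> real^'l) \<Rightarrow> real" where
  "patch_inner P w z = (LINT x:\<Union>P|lebesgue. w x \<bullet> z x)"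

definition facet_trace :: "(real^'n::finite) set \<Rightarrow> (real^'n \<Rightarrow> 'b::t2_space) \<Rightarrow> real^'n \<Rightarrow> 'b" where
  "facet_trace K w x = Lim (at x within interior K) w"

section \<open>The DG form\<close>

definition outward_normal :: "(real^'n::finite) set \<Rightarrow> (real^'n) set \<Rightarrow> real^'n" where
  "outward_normal K F = (THE n. norm n = 1 \<and> (\<forall>x\<in>F. \<forall>y\<in>K. n \<bullet> (y - x) \<le> 0))"

text \<open>The surface integral over a flat facet \<open>F\<close> with unit normal \<open>n\<close>: by Fubini it is the volume
  integral, over the prism of height one erected on \<open>F\<close>, of the extension of \<open>f\<close> that is constant
  in the direction \<open>n\<close>; here \<open>closest_point (affine hull F)\<close> is the projection along \<open>n\<close>.  In one
  dimension, where \<open>F\<close> is a point, this is the value of \<open>f\<close> there.\<close>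

definition facet_integral ::
  "real^'n::finite \<Rightarrow> (real^'n) set \<Rightarrow> (real^'n \<Rightarrow> real) \<Rightarrow> real" where
  "facet_integral n F f =
     (LINT z:{x + s *\<^sub>R n | x s. x \<in> F \<and> 0 \<le> s \<and> s \<le> 1}|lebesgue. f (closest_point (affine hull F) z))"

text \<open>There is no neighbor in the patch across a facet in the boundary of the patch; the value is
  then unspecified, but outside of the boundary of \<open>\<Omega>\<close> it is multiplied by \<open>\<delta> = 0\<close>.\<close>

definition neighbor :: "(real^'n::finite) set set \<Rightarrow> (real^'n) set \<Rightarrow> (real^'n) set \<Rightarrow> (real^'n) set" where
  "neighbor P K F = (THE K'. K' \<in> P \<and> K' \<noteq> K \<and> F facet_of K')"

definition numerical_flux ::
  "(real^'n::finite) set \<Rightarrow> ('n \<Rightarrow> real^'n \<Rightarrow> real^'l^'l::finite) \<Rightarrow> (real^'n \<Rightarrow> real^'l^'l) \<Rightarrow>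
   (real^'n \<Rightarrow> real^'l^'l) \<Rightarrow> (real^'n) set set \<Rightarrow> (real^'n \<Rightarrow> real^'l) \<Rightarrow>
   (real^'n) set \<Rightarrow> (real^'n) set \<Rightarrow> real^'n \<Rightarrow> real^'l" where
  "numerical_flux \<Omega> L S B P w K F x =
     (let D = facet_trace K (flux_matrix L (outward_normal K F)) x;
          wi = facet_trace K w x;
          wo = facet_trace (neighbor P K F) w x
      in if x \<in> frontier \<Omega> then (1/2) *\<^sub>R ((D + B x) *v wi)
         else D *v ((1/2) *\<^sub>R (wi + wo)) + S x *v (wi - wo))"

definition dg_form ::
  "(real^'n::finite) set \<Rightarrow> ('n \<Rightarrow> real^'n \<Rightarrow> real^'l^'l::finite) \<Rightarrow> (real^'n \<Rightarrow> real^'l^'l) \<Rightarrow>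
   (real^'n \<Rightarrow> real^'l^'l) \<Rightarrow> (real^'n) set set \<Rightarrow> (real^'n \<Rightarrow> real) \<Rightarrow>
   (real^'n \<Rightarrow> real^'l) \<Rightarrow> (real^'n \<Rightarrow> real^'l) \<Rightarrow> real" where
  "dg_form \<Omega> L S B P \<delta> w v =
     (\<Sum>K\<in>P. (\<Sum>j\<in>UNIV. LINT x:K|lebesgue. (\<delta> x *\<^sub>R (L j x *v w x)) \<bullet> partial j v x)
        - (\<Sum>F | F facet_of K. facet_integral (outward_normal K F) F
             (\<lambda>x. (\<delta> x *\<^sub>R numerical_flux \<Omega> L S B P w K F x) \<bullet> facet_trace K v x)))"

section \<open>Operators\<close>

text \<open>\<open>Mop L G \<phi>bot \<delta> \<tau>\<close> is \<open>M(\<tau>) = M\<^sub>0 - \<tau> M\<^sub>1\<close>.\<close>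

definition M0op ::
  "('n::finite \<Rightarrow> real^'n \<Rightarrow> real^'l^'l::finite) \<Rightarrow> (real^'n \<Rightarrow> real^'l^'l) \<Rightarrow> (real^'n \<Rightarrow> real) \<Rightarrow>
   (real^'n \<Rightarrow> real^'l) \<Rightarrow> real^'n \<Rightarrow> real^'l" where
  "M0op L G \<phi>bot w x = G x *v w x - (\<Sum>j\<in>UNIV. partial j \<phi>bot x *\<^sub>R (L j x *v w x))"

definition M1op ::
  "('n::finite \<Rightarrow> real^'n \<Rightarrow> real^'l^'l::finite) \<Rightarrow> (real^'n \<Rightarrow> real) \<Rightarrow>
   (real^'n \<Rightarrow> real^'l) \<Rightarrow> real^'n \<Rightarrow> real^'l" where
  "M1op L \<delta> w x = (\<Sum>j\<in>UNIV. partial j \<delta> x *\<^sub>R (L j x *v w x))"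

definition Mop ::
  "('n::finite \<Rightarrow> real^'n \<Rightarrow> real^'l^'l::finite) \<Rightarrow> (real^'n \<Rightarrow> real^'l^'l) \<Rightarrow> (real^'n \<Rightarrow> real) \<Rightarrow>
   (real^'n \<Rightarrow> real) \<Rightarrow> real \<Rightarrow> (real^'n \<Rightarrow> real^'l) \<Rightarrow> real^'n \<Rightarrow> real^'l" where
  "Mop L G \<phi>bot \<delta> \<tau> w x = M0op L G \<phi>bot w x - \<tau> *\<^sub>R M1op L \<delta> w x"

definition Mnorm ::
  "('n::finite \<Rightarrow> real^'n \<Rightarrow> real^'l^'l::finite) \<Rightarrow> (real^'n \<Rightarrow> real^'l^'l) \<Rightarrow> (real^'n) set set \<Rightarrow>
   (real^'n \<Rightarrow> real) \<Rightarrow> (real^'n \<Rightarrow> real) \<Rightarrow> real \<Rightarrow> (real^'n \<Rightarrow> real^'l) \<Rightarrow> real" where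
  "Mnorm L G P \<phi>bot \<delta> \<tau> z = sqrt (patch_inner P (Mop L G \<phi>bot \<delta> \<tau> z) z)"

text \<open>The operator norm on a space \<open>V\<close> of functions induced by a norm \<open>nrm\<close>; as in \<open>onorm\<close>, the zero
  vector contributes \<open>0 / 0 = 0\<close>.\<close>

definition induced_norm :: "'v set \<Rightarrow> ('v \<Rightarrow> real) \<Rightarrow> ('v \<Rightarrow> 'v) \<Rightarrow> real" where
  "induced_norm V nrm X = (SUP w\<in>V. nrm (X w) / nrm w)"

definition Ah ::
  "nat \<Rightarrow> (real^'n::finite) set \<Rightarrow> ('n \<Rightarrow> real^'n \<Rightarrow> real^'l^'l::finite) \<Rightarrow> (real^'n \<Rightarrow> real^'l^'l) \<Rightarrow>
   (real^'n \<Rightarrow> real^'l^'l) \<Rightarrow> (real^'n) set set \<Rightarrow> (real^'n \<Rightarrow> real) \<Rightarrow>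
   (real^'n \<Rightarrow> real^'l) \<Rightarrow> real^'n \<Rightarrow> real^'l" where
  "Ah p \<Omega> L S B P \<delta> w =
     (THE u. u \<in> Vh p P \<and> (\<forall>v\<in>Vh p P. patch_inner P u v = dg_form \<Omega> L S B P \<delta> w v))"

definition Xh ::
  "nat \<Rightarrow> (real^'n::finite) set \<Rightarrow> ('n \<Rightarrow> real^'n \<Rightarrow> real^'l^'l::finite) \<Rightarrow> (real^'n \<Rightarrow> real^'l^'l) \<Rightarrow>
   (real^'n \<Rightarrow> real^'l^'l) \<Rightarrow> (real^'n \<Rightarrow> real^'l^'l) \<Rightarrow> (real^'n) set set \<Rightarrow>
   (real^'n \<Rightarrow> real) \<Rightarrow> (real^'n \<Rightarrow> real) \<Rightarrow> (real^'n \<Rightarrow> real^'l) \<Rightarrow> real^'n \<Rightarrow> real^'l" where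
  "Xh p \<Omega> L G S B P \<phi>bot \<delta> w =
     inv_into (Vh p P) (M0op L G \<phi>bot) (\<lambda>x. Ah p \<Omega> L S B P \<delta> w x + M1op L \<delta> w x)"

primrec explicit_flow ::
  "((real^'n::finite \<Rightarrow> real^'l::finite) \<Rightarrow> real^'n \<Rightarrow> real^'l) \<Rightarrow> nat \<Rightarrow> real \<Rightarrow>
   (real^'n \<Rightarrow> real^'l) \<Rightarrow> real^'n \<Rightarrow> real^'l" where
  "explicit_flow X 0 \<tau> v0 = v0"
| "explicit_flow X (Suc l) \<tau> v0 = (\<lambda>x. v0 x + \<tau> *\<^sub>R X (explicit_flow X l \<tau> v0) x)"

end

theory Submission
  imports Defs
begin

text \<open>Integrating by parts element by element, and using that the normal flux \<open>\<D>\<close> is single-valued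
  across interior facets (this is what \<open>\<Sum>\<^sub>j \<partial>\<^sub>j\<L>\<^sup>(\<^sup>j\<^sup>) = 0\<close> says for piecewise constant coefficients), gives
  the dissipation inequality \<open>2 (A\<^sub>h w, w) + (M\<^sub>1 w, w) \<le> 0\<close>, that is
  \<open>2 (M\<^sub>0 X\<^sub>h w, w) \<le> (M\<^sub>1 w, w)\<close>.
  Inserting \<open>v\<^sub>0 = v\<^sub>q - \<tau> X\<^sub>h v\<^sub>q\<^sub>-\<^sub>1\<close> into \<open>(M\<^sub>0 v\<^sub>0, v\<^sub>0)\<close> and replacing \<open>v\<^sub>q\<^sub>-\<^sub>1\<close> by \<open>v\<^sub>q\<close> costs only
  the term \<open>2 \<tau> (M\<^sub>0 X\<^sub>h (v\<^sub>q - v\<^sub>q\<^sub>-\<^sub>1), v\<^sub>q)\<close>. Since \<open>v\<^sub>q - v\<^sub>q\<^sub>-\<^sub>1 = \<tau>\<^sup>q X\<^sub>h\<^sup>q v\<^sub>0\<close>, that term is at most a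
  multiple of \<open>\<parallel>X\<^sub>h\<parallel>\<^sup>q\<^sup>+\<^sup>1 \<parallel>v\<^sub>0\<parallel>\<^sup>2\<close>, which is of order \<open>h\<close>.\<close>

section \<open>The divergence theorem on polytopes\<close>

text \<open>Facet integrals are volume integrals over prisms, so the divergence theorem is proved by
  Fubini: on almost every line in a fixed direction it is the fundamental theorem of calculus, and
  oblique prisms collect the end points. With a bump at a point of an interior facet,
  \<open>distributional_div_zero\<close> then says that the normal flux does not jump there. Three
  definitions are implicit and need a justification: \<open>Ah\<close> (a \<open>THE\<close>) by
  Riesz in finite dimension, \<open>Xh\<close> (an \<open>inv_into\<close>) by the invertibility of
  \<open>M0op\<close>, where causality and \<open>max_speed\<close> enter, and
  \<open>induced_norm\<close> (a supremum) by boundedness. Functions of \<open>Vh\<close> and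
  coefficients are controlled only inside elements; so each function is replaced on each element by
  a polynomial \<open>rep\<close>, and frontiers are null sets. In the time stepping the squared
  norm of \<open>X\<close> at the previous stage enters with a favorable sign. The error carries
  \<open>\<beta> ^ (q + 1)\<close>, which is \<open>C ^ (q + 1) * h\<close>, times a geometric sum
  that is bounded since \<open>h\<close> is at most the diameter of \<open>closure \<Omega>\<close>.
  Finally \<open>1 + 2 * c \<le> (1 + c)^2\<close> turns squares into norms.\<close>

lemma integrable_bounded_support:
  fixes f :: "'a::euclidean_space \<Rightarrow> real"
  assumes "f \<in> borel_measurable borel" "\<And>x. \<bar>f x\<bar> \<le> B" "bounded {x. f x \<noteq> 0}"
  shows "integrable lborel f"
proof -
  obtain R where R: "{x. f x \<noteq> 0} \<subseteq> cball 0 R"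
    using assms(3) unfolding bounded_iff by (auto simp: subset_iff)
  have "integrable lborel (\<lambda>x. indicator (cball 0 R) x *\<^sub>R f x)"
    by (rule integrableI_bounded_set_indicator[where B=B])
       (use assms emeasure_bounded_finite[OF bounded_cball, of 0 R] in auto)
  moreover have "(\<lambda>x. indicator (cball 0 R) x *\<^sub>R f x) = f"
    using R by (auto simp: indicator_def fun_eq_iff)
  ultimately show ?thesis by simp
qed

text \<open>A class closed under linear combinations and under the pullback to a prism, whose
  members are integrable; it settles the integrability conditions of Fubini and of
  additivity.\<close>

definition bounded_borel_support :: "('a::euclidean_space \<Rightarrow> real) \<Rightarrow> bool" where
  "bounded_borel_support f \<longleftrightarrow>
     f \<in> borel_measurable borel \<and> bounded (range f) \<and> bounded {x. f x \<noteq> 0}"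

lemma bounded_borel_supportI:
  "f \<in> borel_measurable borel \<Longrightarrow> (\<And>x. \<bar>f x\<bar> \<le> B) \<Longrightarrow> (\<And>x. f x \<noteq> 0 \<Longrightarrow> norm x \<le> R) \<Longrightarrow>
    bounded_borel_support f"
  by (auto simp: bounded_borel_support_def bounded_iff)

lemma bounded_borel_supportE:
  assumes "bounded_borel_support f"
  obtains B R where "f \<in> borel_measurable borel" "0 \<le> B" "\<And>x. \<bar>f x\<bar> \<le> B"
    "0 \<le> R" "\<And>x. f x \<noteq> 0 \<Longrightarrow> norm x \<le> R"
proof -
  obtain B R where B: "\<And>x. \<bar>f x\<bar> \<le> B" and R: "\<And>x. f x \<noteq> 0 \<Longrightarrow> norm x \<le> R"
    using assms by (auto simp: bounded_borel_support_def bounded_iff)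
  have "0 \<le> B" using B[of 0] by linarith
  moreover have "norm x \<le> \<bar>R\<bar>" if "f x \<noteq> 0" for x using R[OF that] by linarith
  ultimately show ?thesis
    using that[of B "\<bar>R\<bar>"] B assms by (auto simp: bounded_borel_support_def)
qed

lemma integrable_bounded_borel_support:
  assumes "bounded_borel_support f" shows "integrable lborel f"
proof -
  obtain B R where "f \<in> borel_measurable borel" "\<And>x. \<bar>f x\<bar> \<le> B" "\<And>x. f x \<noteq> 0 \<Longrightarrow> norm x \<le> R"
    using bounded_borel_supportE[OF assms] by metis
  then show ?thesis by (intro integrable_bounded_support[where B=B]) (auto simp: bounded_iff)
qed

lemma bounded_borel_support_cmult:
  assumes "bounded_borel_support f" shows "bounded_borel_support (\<lambda>x. c * f x)"
proof -
  obtain B R where f: "f \<in> borel_measurable borel" "0 \<le> B" "\<And>x. \<bar>f x\<bar> \<le> B"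
    "\<And>x. f x \<noteq> 0 \<Longrightarrow> norm x \<le> R"
    using bounded_borel_supportE[OF assms] by metis
  then show ?thesis
    by (intro bounded_borel_supportI[where B="\<bar>c\<bar> * B" and R=R]) (auto simp: abs_mult intro!: mult_left_mono)
qed

lemma bounded_borel_support_add:
  assumes "bounded_borel_support f" "bounded_borel_support g"
  shows "bounded_borel_support (\<lambda>x. f x + g x)"
proof -
  obtain B R where f: "f \<in> borel_measurable borel" "0 \<le> B" "\<And>x. \<bar>f x\<bar> \<le> B"
    "0 \<le> R" "\<And>x. f x \<noteq> 0 \<Longrightarrow> norm x \<le> R"
    using bounded_borel_supportE[OF assms(1)] by metis
  obtain B' R' where g: "g \<in> borel_measurable borel" "0 \<le> B'" "\<And>x. \<bar>g x\<bar> \<le> B'"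
    "0 \<le> R'" "\<And>x. g x \<noteq> 0 \<Longrightarrow> norm x \<le> R'"
    using bounded_borel_supportE[OF assms(2)] by metis
  show ?thesis
  proof (rule bounded_borel_supportI[where B="B + B'" and R="R + R'"])
    show "\<bar>f x + g x\<bar> \<le> B + B'" for x using f(3)[of x] g(3)[of x] by linarith
    show "norm x \<le> R + R'" if "f x + g x \<noteq> 0" for x
      using that f(4) f(5)[of x] g(4) g(5)[of x] by (cases "f x = 0") force+
  qed (use f g in measurable)
qed

lemma bounded_borel_support_diff:
  "bounded_borel_support f \<Longrightarrow> bounded_borel_support g \<Longrightarrow> bounded_borel_support (\<lambda>x. f x - g x)"
  using bounded_borel_support_add[of f "\<lambda>x. (-1) * g x"] bounded_borel_support_cmult[of g "-1"] by simp

lemma bounded_borel_support_sum: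
  assumes "\<And>i. i \<in> I \<Longrightarrow> bounded_borel_support (f i)"
  shows "bounded_borel_support (\<lambda>x. \<Sum>i\<in>I. f i x)"
proof -
  have 0: "bounded_borel_support (\<lambda>x. 0)"
    by (rule bounded_borel_supportI[where B=0 and R=0]) auto
  show ?thesis
  proof (cases "finite I")
    case True
    then show ?thesis using assms
      by (induction I) (auto simp: 0 intro: bounded_borel_support_add)
  qed (simp add: 0)
qed

lemma bounded_borel_support_compact:
  assumes "compact K" "continuous_on UNIV f"
  shows "bounded_borel_support (\<lambda>x. indicator K x * f x)"
proof -
  obtain B where B: "\<And>x. x \<in> K \<Longrightarrow> \<bar>f x\<bar> \<le> B"
    using compact_imp_bounded[OF compact_continuous_image[OF continuous_on_subset[OF assms(2)] assms(1)]]
    by (auto simp: bounded_iff)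
  obtain R where R: "\<And>x. x \<in> K \<Longrightarrow> norm x \<le> R"
    using compact_imp_bounded[OF assms(1)] by (auto simp: bounded_iff)
  have [measurable]: "f \<in> borel_measurable borel"
    using assms(2) by (rule borel_measurable_continuous_onI)
  have [measurable]: "K \<in> sets borel"
    using assms(1) by (simp add: compact_imp_closed)
  show ?thesis
  proof (rule bounded_borel_supportI[where B="\<bar>B\<bar>" and R=R])
    show "\<bar>indicator K x * f x\<bar> \<le> \<bar>B\<bar>" for x using B[of x] by (auto simp: indicator_def)
  qed (use R in \<open>auto simp: indicator_def split: if_splits\<close>)
qed

text \<open>The indicator bounds the relative height by 1, so the shift along \<open>e\<close> is at
  most \<open>norm e\<close> and the support grows by no more than that. For \<open>a = 0\<close>
  division yields 0 and the function is \<open>k\<close> itself.\<close>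

lemma bounded_borel_support_prism:
  assumes "bounded_borel_support k"
  shows "bounded_borel_support (\<lambda>z. indicator {0..1} ((n \<bullet> z - c) / a) * k (z - ((n \<bullet> z - c) / a) *\<^sub>R e))"
    (is "bounded_borel_support ?g")
proof -
  obtain B R where k: "k \<in> borel_measurable borel" "0 \<le> B" "\<And>x. \<bar>k x\<bar> \<le> B"
    "0 \<le> R" "\<And>x. k x \<noteq> 0 \<Longrightarrow> norm x \<le> R"
    using bounded_borel_supportE[OF assms] by metis
  show ?thesis
  proof (rule bounded_borel_supportI[where B=B and R="R + norm e"])
    show "?g \<in> borel_measurable borel" using k(1) by measurable
    show "\<bar>?g x\<bar> \<le> B" for x
      using k(2) k(3)[of "x - ((n \<bullet> x - c) / a) *\<^sub>R e"] by (auto simp: indicator_def)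
    show "norm x \<le> R + norm e" if "?g x \<noteq> 0" for x
    proof -
      let ?t = "(n \<bullet> x - c) / a"
      have "\<bar>?t\<bar> \<le> 1" "k (x - ?t *\<^sub>R e) \<noteq> 0"
        using that by (auto simp: indicator_def split: if_splits)
      then have "norm x \<le> R + \<bar>?t\<bar> * norm e"
        using k(5)[of "x - ?t *\<^sub>R e"] norm_triangle_ineq[of "x - ?t *\<^sub>R e" "?t *\<^sub>R e"] by simp
      also have "\<dots> \<le> R + norm e"
        using \<open>\<bar>?t\<bar> \<le> 1\<close> mult_right_mono[of "\<bar>?t\<bar>" 1 "norm e"] by simp
      finally show ?thesis .
    qed
  qed
qed

section \<open>Fubini's theorem along lines and prisms\<close>

lemma Fubini_bounded_support:
  fixes f :: "'a::euclidean_space \<Rightarrow> real \<Rightarrow> real"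
  assumes meas: "case_prod f \<in> borel_measurable borel" and B: "\<And>x s. \<bar>f x s\<bar> \<le> B"
    and bd: "bounded {(x, s). f x s \<noteq> 0}"
  shows "(LINT x|lborel. LINT s|lborel. f x s) = (LINT s|lborel. LINT x|lborel. f x s)"
proof -
  have "integrable lborel (case_prod f)"
    by (rule integrable_bounded_support[where B=B]) (use assms in \<open>auto simp: case_prod_beta'\<close>)
  then have "integrable (lborel \<Otimes>\<^sub>M lborel) (case_prod f)"
    by (simp add: lborel_prod)
  then show ?thesis
    using lborel_pair.Fubini_integral[of f] by simp
qed

text \<open>No measurability is assumed: translates of a nonmeasurable function are nonmeasurable,
  and then both integrals are 0.\<close>

lemma integral_lborel_translation:
  fixes f :: "'a::euclidean_space \<Rightarrow> real"
  shows "(LINT x|lborel. f (x + a)) = (LINT x|lborel. f x)"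
proof (cases "f \<in> borel_measurable borel")
  case True
  then show ?thesis
    using integral_distr[of "(+) a" lborel borel f] by (simp add: lborel_distr_plus add.commute)
next
  case False
  have "\<not> (\<lambda>x. f (x + a)) \<in> borel_measurable borel"
  proof
    assume "(\<lambda>x. f (x + a)) \<in> borel_measurable borel"
    then have "(\<lambda>x. f ((x - a) + a)) \<in> borel_measurable borel"
      by (rule measurable_compose_rev) simp
    with False show False by simp
  qed
  with False have "\<not> integrable lborel f" "\<not> integrable lborel (\<lambda>x. f (x + a))"
    by (auto dest: borel_measurable_integrable)
  then show ?thesis by (simp add: not_integrable_integral_eq)
qed

text \<open>The slab indicator has integral one along every line in the direction \<open>e\<close>.\<close>

lemma integral_as_line_integrals:
  fixes g :: "'a::euclidean_space \<Rightarrow> real"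
  assumes g': "bounded_borel_support g" and ne: "n \<bullet> e = 1"
  shows "(LINT z|lborel. g z) =
    (LINT z|lborel. indicator {0..1} (n \<bullet> z - c) * (LINT s|lborel. g (z + s *\<^sub>R e)))"
proof -
  obtain B R where g: "g \<in> borel_measurable borel" "\<And>x. \<bar>g x\<bar> \<le> B" and B: "0 \<le> B"
    and R: "\<And>x. g x \<noteq> 0 \<Longrightarrow> norm x \<le> R"
    using bounded_borel_supportE[OF g'] by metis
  \<comment> \<open>Where \<open>g x\<close> is nonzero, \<open>n \<bullet> x\<close> is at most
    \<open>norm n * \<bar>R\<bar>\<close> in absolute value; the slab condition then confines
    \<open>s\<close> to the interval from \<open>- S\<close> to \<open>S\<close>.\<close>
  define S where "S = norm n * \<bar>R\<bar> + \<bar>c\<bar> + 1"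
  have nb: "\<bar>n \<bullet> x\<bar> \<le> norm n * \<bar>R\<bar>" if "g x \<noteq> 0" for x
    using Cauchy_Schwarz_ineq2[of n x] mult_left_mono[of "norm x" "\<bar>R\<bar>" "norm n"] R[OF that] norm_ge_zero[of n] by linarith
  have ind_int: "(LINT s|lborel. indicator {0..1} (a - s - c) :: real) = 1" for a :: real
  proof -
    have "(LINT s|lborel. indicator {0..1} (a - s - c) :: real) = (LINT s|lborel. indicator {a-c-1..a-c} s)"
      by (rule arg_cong[where f="integral\<^sup>L lborel"]) (auto simp: fun_eq_iff indicator_def)
    then show ?thesis by simp
  qed
  \<comment> \<open>Insert the factor 1 of \<open>ind_int\<close>, swap, translate \<open>z\<close>
    by \<open>s *\<^sub>R e\<close>, where \<open>n \<bullet> e = 1\<close> brings the moving slab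
    back to the fixed one, and swap again.\<close>
  have "(LINT z|lborel. g z) = (LINT z|lborel. LINT s|lborel. indicator {0..1} (n \<bullet> z - s - c) * g z)"
    by (simp add: ind_int)
  also have "\<dots> = (LINT s|lborel. LINT z|lborel. indicator {0..1} (n \<bullet> z - s - c) * g z)"
  proof (rule Fubini_bounded_support[where B=B])
    show "(\<lambda>(z, s). indicator {0..1} (n \<bullet> z - s - c) * g z) \<in> borel_measurable borel"
      unfolding borel_prod[symmetric] using g(1) by measurable
    show "\<bar>indicator {0..1} (n \<bullet> x - s - c) * g x\<bar> \<le> B" for x s
      using g(2)[of x] B by (auto simp: indicator_def)
    have "{(x, s). indicator {0..1} (n \<bullet> x - s - c) * g x \<noteq> 0} \<subseteq> cball 0 \<bar>R\<bar> \<times> {-S..S}"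
      using R nb by (force simp: indicator_def S_def)
    then show "bounded {(x, s). indicator {0..1} (n \<bullet> x - s - c) * g x \<noteq> 0}"
      by (rule bounded_subset[rotated]) (auto intro: bounded_Times)
  qed
  also have "\<dots> = (LINT s|lborel. LINT z|lborel. indicator {0..1} (n \<bullet> z - c) * g (z + s *\<^sub>R e))"
  proof (rule Bochner_Integration.integral_cong[OF refl])
    fix s :: real
    show "(LINT z|lborel. indicator {0..1} (n \<bullet> z - s - c) * g z) = (LINT z|lborel. indicator {0..1} (n \<bullet> z - c) * g (z + s *\<^sub>R e))"
      using integral_lborel_translation[of "\<lambda>z. indicator {0..1} (n \<bullet> z - s - c) * g z" "s *\<^sub>R e"] ne
      by (simp add: inner_add_right)
  qed
  also have "\<dots> = (LINT z|lborel. LINT s|lborel. indicator {0..1} (n \<bullet> z - c) * g (z + s *\<^sub>R e))"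
  proof (rule Fubini_bounded_support[where B=B, symmetric])
    show "(\<lambda>(z, s). indicator {0..1} (n \<bullet> z - c) * g (z + s *\<^sub>R e)) \<in> borel_measurable borel"
      unfolding borel_prod[symmetric] using g(1) by measurable
    show "\<bar>indicator {0..1} (n \<bullet> x - c) * g (x + s *\<^sub>R e)\<bar> \<le> B" for x s
      using g(2)[of "x + s *\<^sub>R e"] B by (auto simp: indicator_def)
    have "norm x \<le> \<bar>R\<bar> + S * norm e \<and> \<bar>s\<bar> \<le> S" 
      if "indicator {0..1} (n \<bullet> x - c) * g (x + s *\<^sub>R e) \<noteq> 0" for x s
    proof
      from that have gx: "g (x + s *\<^sub>R e) \<noteq> 0" and "0 \<le> n \<bullet> x - c" "n \<bullet> x - c \<le> 1"
        by (auto simp: indicator_def split: if_splits)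
      with nb[OF gx] ne show s: "\<bar>s\<bar> \<le> S" by (simp add: inner_add_right S_def)
      have "norm x \<le> norm (x + s *\<^sub>R e) + norm (s *\<^sub>R e)"
        by (metis add_diff_cancel norm_triangle_ineq4)
      also have "\<dots> \<le> \<bar>R\<bar> + S * norm e"
        using R[OF gx] s by (auto intro!: add_mono mult_right_mono)
      finally show "norm x \<le> \<bar>R\<bar> + S * norm e" .
    qed
    then have "{(x, s). indicator {0..1} (n \<bullet> x - c) * g (x + s *\<^sub>R e) \<noteq> 0} \<subseteq> cball 0 (\<bar>R\<bar> + S * norm e) \<times> {-S..S}"
      by (force simp: abs_le_iff)
    then show "bounded {(x, s). indicator {0..1} (n \<bullet> x - c) * g (x + s *\<^sub>R e) \<noteq> 0}"
      by (rule bounded_subset[rotated]) (auto intro: bounded_Times)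
  qed
  finally show ?thesis by simp
qed

text \<open>For a unit vector \<open>n\<close> this is the integral of \<open>k\<close> over the
  hyperplane \<open>n \<bullet> x = c\<close>, written as a volume integral over the slab of height
  one of the extension that is constant along \<open>n\<close>.\<close>

definition prism_integral :: "'a::euclidean_space \<Rightarrow> real \<Rightarrow> ('a \<Rightarrow> real) \<Rightarrow> real" where
  "prism_integral n c k =
     (LINT z|lborel. indicator {0..1} (n \<bullet> z - c) * k (z - (n \<bullet> z - c) *\<^sub>R n))"

text \<open>The slices of the two prisms at the same relative height over the hyperplane are translates
  of each other.\<close>

lemma integral_oblique_prism:
  fixes k :: "'a::euclidean_space \<Rightarrow> real"
  assumes k': "bounded_borel_support k" and n: "norm n = 1" and ne: "n \<bullet> e \<noteq> 0"
  shows "(LINT z|lborel. indicator {0..1} ((n \<bullet> z - c) / (n \<bullet> e)) * k (z - ((n \<bullet> z - c) / (n \<bullet> e)) *\<^sub>R e)) =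
    \<bar>n \<bullet> e\<bar> * prism_integral n c k"
proof -
  let ?\<chi> = "\<lambda>z. indicator {0..1} (n \<bullet> z - c) :: real" and ?q = "\<lambda>z. z - (n \<bullet> z - c) *\<^sub>R n"
  have nn: "n \<bullet> n = 1" using n by (simp add: dot_square_norm)
  obtain B R where k: "k \<in> borel_measurable borel" "\<And>x. \<bar>k x\<bar> \<le> B" and B: "0 \<le> B"
    and R: "\<And>x. k x \<noteq> 0 \<Longrightarrow> norm x \<le> R"
    using bounded_borel_supportE[OF k'] by metis
  define \<alpha> where "\<alpha> = n \<bullet> e"
  have \<alpha>: "\<alpha> \<noteq> 0" using ne by (simp add: \<alpha>_def)
  \<comment> \<open>\<open>u\<close> is tangential: for a point at height \<open>t\<close>, the
    oblique and the orthogonal projection to the hyperplane differ by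
    \<open>t *\<^sub>R u\<close>.\<close>
  define u where "u = (1/\<alpha>) *\<^sub>R e - n"
  have nu: "n \<bullet> u = 0" using ne by (simp add: u_def inner_diff_right nn \<alpha>_def)
  let ?g = "\<lambda>z. indicator {0..1} ((n \<bullet> z - c) / \<alpha>) * k (z - ((n \<bullet> z - c) / \<alpha>) *\<^sub>R e)"
  let ?h = "\<lambda>z t. ?\<chi> z * (indicator {0..1} (t / \<alpha>) * k (?q z - t *\<^sub>R u))"
  have bnd: "norm x \<le> \<bar>R\<bar> + norm (y - x)" if "k y \<noteq> 0" for x y
    using R[OF that] norm_triangle_ineq[of y "x - y"] by (simp add: norm_minus_commute)
  have "(LINT z|lborel. ?g z) =
    (LINT z|lborel. ?\<chi> z * (LINT s|lborel. ?g (z + s *\<^sub>R n)))"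
    by (rule integral_as_line_integrals) (use bounded_borel_support_prism[OF k'] nn in auto)
  also have "\<dots> = (LINT z|lborel. LINT t|lborel. ?h z t)"
  proof (rule Bochner_Integration.integral_cong[OF refl])
    fix z
    \<comment> \<open>The new variable \<open>t\<close> is the height of the point over the
      hyperplane.\<close>
    have "(LINT s|lborel. ?g (z + s *\<^sub>R n)) =
          (LINT t|lborel. ?g (z + (t - (n \<bullet> z - c)) *\<^sub>R n))"
      using integral_lborel_translation[of "\<lambda>s. ?g (z + s *\<^sub>R n)" "- (n \<bullet> z - c)", symmetric] by (simp only: diff_conv_add_uminus)
    also have "\<dots> = (LINT t|lborel. (indicator {0..1} (t / \<alpha>) * k (?q z - t *\<^sub>R u)))"
    proof (rule Bochner_Integration.integral_cong[OF refl])
      fix t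
      have 1: "n \<bullet> (z + (t - (n \<bullet> z - c)) *\<^sub>R n) - c = t" by (simp add: inner_add_right nn)
      have 2: "z + (t - (n \<bullet> z - c)) *\<^sub>R n - (t / \<alpha>) *\<^sub>R e = ?q z - t *\<^sub>R u"
        by (simp add: u_def algebra_simps)
      show "?g (z + (t - (n \<bullet> z - c)) *\<^sub>R n) = indicator {0..1} (t / \<alpha>) * k (?q z - t *\<^sub>R u)"
        unfolding 1 2 ..
    qed
    finally show "?\<chi> z * (LINT s|lborel. ?g (z + s *\<^sub>R n)) =
      (LINT t|lborel. ?h z t)"
      by simp
  qed
  also have "\<dots> = (LINT t|lborel. LINT z|lborel. ?h z t)"
  proof (rule Fubini_bounded_support[where B=B])
    show "case_prod ?h \<in> borel_measurable borel"
      unfolding borel_prod[symmetric] using k(1) by measurable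
    show "\<bar>?h x s\<bar> \<le> B" for x s
      using k(2)[of "x - (n \<bullet> x - c) *\<^sub>R n - s *\<^sub>R u"] B by (auto simp: indicator_def)
    have "norm z \<le> \<bar>R\<bar> + (1 + \<bar>\<alpha>\<bar> * norm u) \<and> \<bar>t\<bar> \<le> \<bar>\<alpha>\<bar>" if "?h z t \<noteq> 0" for z t
    proof
      let ?t = "n \<bullet> z - c"
      have *: "\<bar>?t\<bar> \<le> 1" "\<bar>t / \<alpha>\<bar> \<le> 1" "k (z - ?t *\<^sub>R n - t *\<^sub>R u) \<noteq> 0"
        using that by (auto simp: indicator_def split: if_splits)
      show t: "\<bar>t\<bar> \<le> \<bar>\<alpha>\<bar>" using *(2) \<alpha> by (simp add: abs_divide divide_le_eq_1_pos)
      have "norm z \<le> \<bar>R\<bar> + norm (- (?t *\<^sub>R n) - t *\<^sub>R u)"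
        using bnd[OF *(3), of z] by (simp add: algebra_simps)
      also have "\<dots> \<le> \<bar>R\<bar> + (\<bar>?t\<bar> * norm n + \<bar>t\<bar> * norm u)"
        using norm_triangle_ineq4[of "- (?t *\<^sub>R n)" "t *\<^sub>R u"] by simp
      also have "\<dots> \<le> \<bar>R\<bar> + (1 + \<bar>\<alpha>\<bar> * norm u)"
        using *(1) t n by (auto intro!: add_mono mult_right_mono)
      finally show "norm z \<le> \<bar>R\<bar> + (1 + \<bar>\<alpha>\<bar> * norm u)" .
    qed
    then have "{(z, t). ?h z t \<noteq> 0} \<subseteq> cball 0 (\<bar>R\<bar> + (1 + \<bar>\<alpha>\<bar> * norm u)) \<times> {-\<bar>\<alpha>\<bar>..\<bar>\<alpha>\<bar>}"
      by (force simp: abs_le_iff)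
    then show "bounded {(z, t). ?h z t \<noteq> 0}"
      by (rule bounded_subset[rotated]) (auto intro: bounded_Times)
  qed
  also have "\<dots> = (LINT t|lborel. indicator {0..1} (t / \<alpha>) * prism_integral n c k)"
  proof (rule Bochner_Integration.integral_cong[OF refl])
    fix t
    have "(LINT z|lborel. ?h z t)
      = indicator {0..1} (t / \<alpha>) * (LINT z|lborel. ?\<chi> z * k (?q z - t *\<^sub>R u))"
      by (subst Bochner_Integration.integral_mult_right_zero[symmetric]) (simp add: mult.left_commute)
    \<comment> \<open>At a fixed height a translation undoes the offset; it leaves the slab
      invariant because \<open>n \<bullet> u = 0\<close>.\<close>
    also have "(LINT z|lborel. ?\<chi> z * k (?q z - t *\<^sub>R u)) =
       prism_integral n c k"
      using integral_lborel_translation[of "\<lambda>z. ?\<chi> z * k (?q z)" "- (t *\<^sub>R u)"] nu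
      by (simp add: prism_integral_def inner_diff_right algebra_simps)
    finally show "(LINT z|lborel. ?h z t)
      = indicator {0..1} (t / \<alpha>) * prism_integral n c k" .
  qed
  also have "\<dots> = (LINT t|lborel. indicator {0..1} (t / \<alpha>)) * prism_integral n c k"
    by simp
  \<comment> \<open>Relative heights in the unit interval are heights between 0 and
    \<open>\<alpha>\<close>; their length is the factor in the claim.\<close>
  also have "(LINT t|lborel. indicator {0..1} (t / \<alpha>) :: real) = \<bar>\<alpha>\<bar>"
  proof -
    have "(LINT t|lborel. indicator {0..1} (t / \<alpha>) :: real) = (LINT t|lborel. indicator {min 0 \<alpha>..max 0 \<alpha>} t)"
    proof (rule Bochner_Integration.integral_cong[OF refl])
      fix t
      have "0 \<le> t / \<alpha> \<and> t / \<alpha> \<le> 1 \<longleftrightarrow> min 0 \<alpha> \<le> t \<and> t \<le> max 0 \<alpha>"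
        using \<alpha> by (cases "\<alpha> > 0") (auto simp: zero_le_divide_iff divide_le_eq_1 min_def max_def)
      then show "indicator {0..1} (t / \<alpha>) = (indicator {min 0 \<alpha>..max 0 \<alpha>} t :: real)"
        by (simp add: indicator_def)
    qed
    then show ?thesis by (auto simp: min_def max_def)
  qed
  finally show ?thesis by (simp add: \<alpha>_def)
qed

text \<open>If no constraint of positive slope were active at \<open>b\<close>, the finitely many
  positive slacks would leave room beyond \<open>b\<close>, against \<open>out\<close>.\<close>

lemma finite_halflines_upper_end:
  fixes \<alpha> \<beta> :: "'i \<Rightarrow> real"
  assumes "finite I" "\<And>i. i \<in> I \<Longrightarrow> b * \<alpha> i \<le> \<beta> i"
    and out: "\<And>s. s > b \<Longrightarrow> \<exists>i\<in>I. s * \<alpha> i > \<beta> i"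
  shows "\<exists>p\<in>I. \<alpha> p > 0 \<and> b * \<alpha> p = \<beta> p"
proof (rule ccontr)
  assume *: "\<not> ?thesis"
  \<comment> \<open>The element 1 keeps \<open>E\<close> nonempty if no slope is positive.\<close>
  define E where "E = insert 1 ((\<lambda>i. \<beta> i / \<alpha> i - b) ` {i\<in>I. \<alpha> i > 0})"
  have fE: "finite E" "E \<noteq> {}" using assms(1) by (auto simp: E_def)
  have pos: "x > 0" if "x \<in> E" for x
  proof -
    have "b < \<beta> i / \<alpha> i" if "i \<in> I" "\<alpha> i > 0" for i
      using * assms(2)[of i] that by (force simp: pos_less_divide_eq)
    then show ?thesis using that by (auto simp: E_def)
  qed
  define \<epsilon> where "\<epsilon> = Min E"
  have \<epsilon>: "\<epsilon> > 0" using pos fE by (simp add: \<epsilon>_def)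
  have "(b + \<epsilon>) * \<alpha> i \<le> \<beta> i" if "i \<in> I" for i
  proof (cases "\<alpha> i > 0")
    case True
    then have "\<epsilon> \<le> \<beta> i / \<alpha> i - b" using fE that by (auto simp: \<epsilon>_def E_def intro!: Min_le)
    then have "b + \<epsilon> \<le> \<beta> i / \<alpha> i" by simp
    then show ?thesis using True by (simp add: pos_le_divide_eq)
  next
    case False
    then have "\<epsilon> * \<alpha> i \<le> 0" using \<epsilon> by (simp add: mult_nonneg_nonpos)
    then show ?thesis using assms(2)[OF that] by (simp add: distrib_right)
  qed
  then show False using out[of "b + \<epsilon>"] \<epsilon> by fastforce
qed

text \<open>The fundamental theorem of calculus for an interval that is given by its constraints. By
  \<open>inj\<close> exactly one constraint of nonzero slope is active at each end, and
  \<open>sgn (\<alpha> i)\<close> tells the upper end from the lower; slope 0 contributes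
  nothing.\<close>

lemma integral_derivative_on_line:
  fixes \<alpha> \<beta> :: "'i \<Rightarrow> real" and \<phi> \<phi>' :: "real \<Rightarrow> real"
  assumes fin: "finite I" and J: "J = {s. \<forall>i\<in>I. s * \<alpha> i \<le> \<beta> i}" and bJ: "bounded J"
    and inj: "\<And>i k. i \<in> I \<Longrightarrow> k \<in> I \<Longrightarrow> \<alpha> i \<noteq> 0 \<Longrightarrow> \<alpha> k \<noteq> 0 \<Longrightarrow> \<beta> i / \<alpha> i = \<beta> k / \<alpha> k \<Longrightarrow> i = k"
    and der: "\<And>s. (\<phi> has_real_derivative \<phi>' s) (at s)" and cont: "continuous_on UNIV \<phi>'"
  shows "(LINT s|lborel. indicator J s * \<phi>' s) =
    (\<Sum>i\<in>I. sgn (\<alpha> i) * (indicator J (\<beta> i / \<alpha> i) * \<phi> (\<beta> i / \<alpha> i)))"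
proof (cases "J = {}")
  case True
  then show ?thesis by simp
next
  case False
  have Jint: "J = (\<Inter>i\<in>I. {s. s * \<alpha> i \<le> \<beta> i})" unfolding J by auto
  have "closed J" unfolding Jint by (intro closed_INT ballI closed_Collect_le continuous_intros)
  moreover have "connected J"
  proof (rule convex_connected, unfold Jint, rule convex_INT)
    show "convex {s. s * \<alpha> i \<le> \<beta> i}" for i
      using convex_halfspace_le[of "\<alpha> i" "\<beta> i"] by (simp add: mult.commute)
  qed
  ultimately obtain a b where ab: "J = {a..b}"
    using connected_compact_interval_1[of J] bJ by (auto simp: compact_eq_bounded_closed)
  with False have le: "a \<le> b" by simp
  have bJ': "b \<in> J" and aJ: "a \<in> J" using ab le by auto
  have "\<exists>p\<in>I. \<alpha> p > 0 \<and> b * \<alpha> p = \<beta> p"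
  proof (rule finite_halflines_upper_end[OF fin])
    show "b * \<alpha> i \<le> \<beta> i" if "i \<in> I" for i using bJ' that by (auto simp: J)
    show "\<exists>i\<in>I. s * \<alpha> i > \<beta> i" if "s > b" for s
    proof -
      have "s \<notin> J" using that ab by auto
      then show ?thesis by (auto simp: J not_le)
    qed
  qed
  then obtain p where p: "p \<in> I" "\<alpha> p > 0" "b * \<alpha> p = \<beta> p" by blast
  \<comment> \<open>The lower end is the upper end of the interval reflected at 0.\<close>
  have "\<exists>m\<in>I. - \<alpha> m > 0 \<and> - a * - \<alpha> m = \<beta> m"
  proof (rule finite_halflines_upper_end[OF fin])
    show "- a * - \<alpha> i \<le> \<beta> i" if "i \<in> I" for i using aJ that by (auto simp: J)
    show "\<exists>i\<in>I. s * - \<alpha> i > \<beta> i" if "s > - a" for s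
    proof -
      have "- s \<notin> J" using that ab by auto
      then show ?thesis by (auto simp: J not_le)
    qed
  qed
  then obtain m where m: "m \<in> I" "\<alpha> m < 0" "a * \<alpha> m = \<beta> m" by auto
  have "sgn (\<alpha> i) * (indicator J (\<beta> i / \<alpha> i) * \<phi> (\<beta> i / \<alpha> i)) =
        (if i = p then \<phi> b else 0) - (if i = m then \<phi> a else 0)" if i: "i \<in> I" for i
  proof -
    consider "\<alpha> i = 0" | "\<alpha> i > 0" | "\<alpha> i < 0" by linarith
    then show ?thesis
    proof cases
      case 1
      then show ?thesis using p m by auto
    next
      case 2
      have "b \<le> \<beta> i / \<alpha> i" using bJ' i 2 by (auto simp: J pos_le_divide_eq)
      then have "\<beta> i / \<alpha> i \<in> J \<longleftrightarrow> \<beta> i / \<alpha> i = b" using ab le by auto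
      also have "\<dots> \<longleftrightarrow> i = p"
      proof
        assume "\<beta> i / \<alpha> i = b"
        moreover have "\<beta> p / \<alpha> p = b" using p by (simp add: divide_eq_eq)
        ultimately show "i = p" using inj[OF i p(1)] 2 p by auto
      qed (use p in \<open>auto simp: divide_eq_eq\<close>)
      finally have "\<beta> i / \<alpha> i \<in> J \<longleftrightarrow> i = p" .
      moreover have "i = p \<Longrightarrow> \<beta> i / \<alpha> i = b" using p by (simp add: divide_eq_eq)
      moreover have "i \<noteq> m" using 2 m by auto
      ultimately show ?thesis using 2 by (auto simp: indicator_def)
    next
      case 3
      have "\<beta> i / \<alpha> i \<le> a" using aJ i 3 by (auto simp: J neg_divide_le_eq)
      then have "\<beta> i / \<alpha> i \<in> J \<longleftrightarrow> \<beta> i / \<alpha> i = a" using ab le by auto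
      also have "\<dots> \<longleftrightarrow> i = m"
      proof
        assume "\<beta> i / \<alpha> i = a"
        moreover have "\<beta> m / \<alpha> m = a" using m by (simp add: divide_eq_eq)
        ultimately show "i = m" using inj[OF i m(1)] 3 m by auto
      qed (use m in \<open>auto simp: divide_eq_eq\<close>)
      finally have "\<beta> i / \<alpha> i \<in> J \<longleftrightarrow> i = m" .
      moreover have "i = m \<Longrightarrow> \<beta> i / \<alpha> i = a" using m by (simp add: divide_eq_eq)
      moreover have "i \<noteq> p" using 3 p by auto
      ultimately show ?thesis using 3 by (auto simp: indicator_def)
    qed
  qed
  then have "(\<Sum>i\<in>I. sgn (\<alpha> i) * (indicator J (\<beta> i / \<alpha> i) * \<phi> (\<beta> i / \<alpha> i))) = \<phi> b - \<phi> a"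
    using fin p m by (simp add: sum_subtractf)
  moreover have "(LBINT s. \<phi>' s * indicator {a..b} s) = \<phi> b - \<phi> a"
    using le der cont by (intro integral_FTC_Icc_real) (auto simp: continuous_on_eq_continuous_at)
  ultimately show ?thesis by (simp add: ab mult.commute)
qed

text \<open>Almost every line in the direction \<open>e\<close> meets the facets' hyperplanes in distinct points; on
  such a line the identity is the fundamental theorem of calculus.\<close>

lemma divergence_polytope:
  fixes n :: "'i \<Rightarrow> 'a::euclidean_space" and f f' :: "'a \<Rightarrow> real"
  assumes fin: "finite I" and n: "\<And>i. i \<in> I \<Longrightarrow> norm (n i) = 1"
    and K: "K = {x. \<forall>i\<in>I. n i \<bullet> x \<le> c i}" and bK: "bounded K"
    and distinct: "\<And>i k. i \<in> I \<Longrightarrow> k \<in> I \<Longrightarrow> {x. n i \<bullet> x = c i} = {x. n k \<bullet> x = c k} \<Longrightarrow> i = k"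
    and cont: "continuous_on UNIV f" "continuous_on UNIV f'"
    and der: "\<And>x. ((\<lambda>s. f (x + s *\<^sub>R e)) has_real_derivative f' x) (at 0)"
    and e: "e \<noteq> 0"
  shows "(LINT x|lborel. indicator K x * f' x) =
    (\<Sum>i\<in>I. (n i \<bullet> e) * prism_integral (n i) (c i) (\<lambda>x. indicator K x * f x))"
proof -
  define k where "k = (\<lambda>x. indicator K x * f x)"
  define \<alpha> where "\<alpha> i = n i \<bullet> e" for i
  \<comment> \<open>\<open>pr i\<close> carries \<open>k\<close> along \<open>e\<close> over the
    hyperplane of facet \<open>i\<close>; \<open>integral_oblique_prism\<close> knows its
    integral.\<close>
  define pr where "pr i z = indicator {0..1} ((n i \<bullet> z - c i) / \<alpha> i) * k (z - ((n i \<bullet> z - c i) / \<alpha> i) *\<^sub>R e)" for i z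
  have "K = (\<Inter>i\<in>I. {x. n i \<bullet> x \<le> c i})" unfolding K by auto
  then have "closed K" by (auto intro: closed_halfspace_le)
  then have cK: "compact K" using bK by (simp add: compact_eq_bounded_closed)
  have k: "bounded_borel_support k" and k': "bounded_borel_support (\<lambda>x. indicator K x * f' x)"
    unfolding k_def using bounded_borel_support_compact cK cont by blast+
  have prb: "bounded_borel_support (pr i)" for i
    unfolding pr_def by (rule bounded_borel_support_prism[OF k])
  \<comment> \<open>The difference of the two sides, with oblique prisms in place of orthogonal
    ones, so that its integral along almost every line in the direction \<open>e\<close>
    vanishes.\<close>
  define g where "g z = indicator K z * f' z - (\<Sum>i\<in>I. sgn (\<alpha> i) * pr i z)" for z
  have gb: "bounded_borel_support g"
    unfolding g_def by (intro bounded_borel_support_diff k' bounded_borel_support_sum bounded_borel_support_cmult prb)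
  let ?H = "\<lambda>i j. {z. (n i /\<^sub>R \<alpha> i - n j /\<^sub>R \<alpha> j) \<bullet> z = c i / \<alpha> i - c j / \<alpha> j}"
  \<comment> \<open>Two facet hyperplanes are met at the same parameter only if \<open>z\<close>
    solves one linear equation. This equation is not trivial, since otherwise the two hyperplanes
    would coincide.\<close>
  have nul: "(?H i j) \<in> null_sets lborel"
    if "i \<in> I" "j \<in> I" "i \<noteq> j" "\<alpha> i \<noteq> 0" "\<alpha> j \<noteq> 0" for i j
  proof -
    have "n i /\<^sub>R \<alpha> i - n j /\<^sub>R \<alpha> j \<noteq> 0 \<or> c i / \<alpha> i - c j / \<alpha> j \<noteq> 0"
    proof (rule ccontr)
      assume "\<not> ?thesis"
      then have eq: "n i /\<^sub>R \<alpha> i = n j /\<^sub>R \<alpha> j" "c i / \<alpha> i = c j / \<alpha> j" by auto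
      have "n i \<bullet> x = c i \<longleftrightarrow> n j \<bullet> x = c j" for x
      proof -
        have "n i \<bullet> x = c i \<longleftrightarrow> (n i /\<^sub>R \<alpha> i) \<bullet> x = c i / \<alpha> i" using that by (simp add: field_simps)
        also have "\<dots> \<longleftrightarrow> (n j /\<^sub>R \<alpha> j) \<bullet> x = c j / \<alpha> j" unfolding eq ..
        also have "\<dots> \<longleftrightarrow> n j \<bullet> x = c j" using that by (simp add: field_simps)
        finally show ?thesis .
      qed
      then have "i = j" using distinct[of i j] that by auto
      with that show False by simp
    qed
    then have "negligible (?H i j)"
      by (rule negligible_hyperplane)
    moreover have "closed (?H i j)"
      by (rule closed_hyperplane)
    ultimately show ?thesis
      by (auto simp: negligible_iff_null_sets null_sets_def)
  qed
  let ?generic = "\<lambda>z. \<forall>i\<in>I. \<forall>j\<in>I. \<alpha> i \<noteq> 0 \<longrightarrow> \<alpha> j \<noteq> 0 \<longrightarrow>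
      (c i - n i \<bullet> z) / \<alpha> i = (c j - n j \<bullet> z) / \<alpha> j \<longrightarrow> i = j"
  have AE1: "AE z in lborel. (c i - n i \<bullet> z) / \<alpha> i = (c j - n j \<bullet> z) / \<alpha> j \<longrightarrow> i = j"
    if "i \<in> I" "j \<in> I" "\<alpha> i \<noteq> 0" "\<alpha> j \<noteq> 0" for i j
  proof (cases "i = j")
    case False
    show ?thesis
      by (rule AE_I'[OF nul[OF that(1,2) False that(3,4)]])
         (auto simp: inner_diff_left diff_divide_distrib inverse_eq_divide algebra_simps)
  qed simp
  have AEI: "AE z in lborel. ?generic z"
    using AE1 fin by (intro AE_finite_allI) auto
  have line: "(LINT s|lborel. g (z + s *\<^sub>R e)) = 0"
    if z: "?generic z" for z
  proof -
    define \<beta> where "\<beta> i = c i - n i \<bullet> z" for i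
    define J where "J = {s. \<forall>i\<in>I. s * \<alpha> i \<le> \<beta> i}"
    have KJ: "z + s *\<^sub>R e \<in> K \<longleftrightarrow> s \<in> J" for s
      by (auto simp: K J_def \<alpha>_def \<beta>_def inner_add_right algebra_simps)
    obtain R where R: "\<And>x. x \<in> K \<Longrightarrow> norm x \<le> R" using bK by (auto simp: bounded_iff)
    have bJ: "bounded J"
    proof -
      have "\<bar>s\<bar> \<le> (R + norm z) / norm e" if "s \<in> J" for s
      proof -
        have "norm (s *\<^sub>R e) \<le> norm (z + s *\<^sub>R e) + norm z"
          by (metis add_diff_cancel_left' norm_triangle_ineq4)
        then show ?thesis using R KJ that e by (force simp: pos_le_divide_eq)
      qed
      then show ?thesis unfolding bounded_iff by auto
    qed
    have 1: "(LINT s|lborel. indicator J s * f' (z + s *\<^sub>R e)) =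
      (\<Sum>i\<in>I. sgn (\<alpha> i) * (indicator J (\<beta> i / \<alpha> i) * f (z + (\<beta> i / \<alpha> i) *\<^sub>R e)))"
    proof (rule integral_derivative_on_line[OF fin J_def bJ])
      show "((\<lambda>s. f (z + s *\<^sub>R e)) has_real_derivative f' (z + s *\<^sub>R e)) (at s)" for s
        using der[of "z + s *\<^sub>R e"] DERIV_shift[of "\<lambda>s. f (z + s *\<^sub>R e)" "f' (z + s *\<^sub>R e)" 0 s]
        by (simp add: algebra_simps)
      show "continuous_on UNIV (\<lambda>s. f' (z + s *\<^sub>R e))"
        by (intro continuous_on_compose2[OF cont(2)] continuous_intros) auto
    qed (use z in \<open>auto simp: \<beta>_def\<close>)
    \<comment> \<open>On the line the prism is the indicator of a unit interval times the value of
      \<open>k\<close> at the point where the hyperplane is met; its integral is that value.\<close>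
    have pr: "pr i (z + s *\<^sub>R e) = indicator {\<beta> i / \<alpha> i..\<beta> i / \<alpha> i + 1} s * k (z + (\<beta> i / \<alpha> i) *\<^sub>R e)"
      if "\<alpha> i \<noteq> 0" for i s
    proof -
      have t: "(n i \<bullet> (z + s *\<^sub>R e) - c i) / \<alpha> i = s - \<beta> i / \<alpha> i"
        using that by (simp add: \<beta>_def \<alpha>_def inner_add_right field_simps)
      show ?thesis unfolding pr_def t by (auto simp: indicator_def algebra_simps)
    qed
    have pi: "integrable lborel (\<lambda>s. sgn (\<alpha> i) * pr i (z + s *\<^sub>R e))" for i
      by (cases "\<alpha> i = 0") (auto simp: pr)
    have fi: "integrable lborel (\<lambda>s. indicator J s * f' (z + s *\<^sub>R e))"
    proof (intro integrable_bounded_borel_support bounded_borel_support_compact)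
      have "J = (\<Inter>i\<in>I. {s. s * \<alpha> i \<le> \<beta> i})" by (auto simp: J_def)
      then have "closed J" by (auto intro!: closed_INT closed_Collect_le continuous_intros)
      then show "compact J" using bJ by (simp add: compact_eq_bounded_closed)
      show "continuous_on UNIV (\<lambda>s. f' (z + s *\<^sub>R e))"
        by (intro continuous_on_compose2[OF cont(2)] continuous_intros) auto
    qed
    have "(LINT s|lborel. g (z + s *\<^sub>R e)) = (LINT s|lborel. indicator J s * f' (z + s *\<^sub>R e)) -
      (\<Sum>i\<in>I. LINT s|lborel. sgn (\<alpha> i) * pr i (z + s *\<^sub>R e))"
      unfolding g_def using fi pi by (simp add: indicator_def KJ Bochner_Integration.integral_sum)
    also have "(\<Sum>i\<in>I. LINT s|lborel. sgn (\<alpha> i) * pr i (z + s *\<^sub>R e)) =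
      (\<Sum>i\<in>I. sgn (\<alpha> i) * (indicator J (\<beta> i / \<alpha> i) * f (z + (\<beta> i / \<alpha> i) *\<^sub>R e)))"
    proof (rule sum.cong[OF refl])
      fix i
      show "(LINT s|lborel. sgn (\<alpha> i) * pr i (z + s *\<^sub>R e)) = sgn (\<alpha> i) * (indicator J (\<beta> i / \<alpha> i) * f (z + (\<beta> i / \<alpha> i) *\<^sub>R e))"
        by (cases "\<alpha> i = 0") (simp, simp add: pr, simp add: k_def indicator_def KJ)
    qed
    finally show ?thesis using 1 by simp
  qed
  \<comment> \<open>The vector \<open>e /\<^sub>R (e \<bullet> e)\<close> has inner product 1 with
    \<open>e\<close>, so the integral of \<open>g\<close> is assembled from the vanishing line
    integrals.\<close>
  have "(LINT z|lborel. g z) = (LINT z|lborel. indicator {0..1} ((e /\<^sub>R (e \<bullet> e)) \<bullet> z - 0) * (LINT s|lborel. g (z + s *\<^sub>R e)))"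
    by (rule integral_as_line_integrals[OF gb]) (use e in simp)
  also have "\<dots> = 0"
    by (rule integral_eq_zero_AE, use AEI in eventually_elim) (simp add: line)
  finally have "0 = (LINT z|lborel. indicator K z * f' z) - (\<Sum>i\<in>I. sgn (\<alpha> i) * (LINT z|lborel. pr i z))"
    unfolding g_def using integrable_bounded_borel_support[OF k'] integrable_bounded_borel_support[OF prb]
    by (simp add: Bochner_Integration.integral_sum)
  \<comment> \<open>The sign and the factor \<open>\<bar>n i \<bullet> e\<bar>\<close> of the
    oblique prism combine to \<open>n i \<bullet> e\<close>.\<close>
  moreover have "sgn (\<alpha> i) * (LINT z|lborel. pr i z) = (n i \<bullet> e) * prism_integral (n i) (c i) k" if "i \<in> I" for i
  proof (cases "\<alpha> i = 0")
    case False
    then show ?thesis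
      using integral_oblique_prism[OF k n[OF that], of e "c i"]
      by (simp add: pr_def[abs_def] \<alpha>_def sgn_mult_abs mult.assoc[symmetric])
  qed (simp add: \<alpha>_def)
  ultimately show ?thesis unfolding k_def by simp
qed

section \<open>Facets of a simplex\<close>

text \<open>The sign of \<open>n\<close> stays open, because an interior facet is integrated over
  from both sides.\<close>

definition flat_facet :: "real^'n::finite \<Rightarrow> (real^'n) set \<Rightarrow> bool" where
  "flat_facet n F \<longleftrightarrow> norm n = 1 \<and> compact F \<and> (\<exists>c. affine hull F = {x. n \<bullet> x = c})"

lemma closest_point_hyperplane:
  fixes n :: "'a::euclidean_space"
  assumes "norm n = 1"
  shows "closest_point {x. n \<bullet> x = c} z = z - (n \<bullet> z - c) *\<^sub>R n"
proof (rule closest_point_unique[symmetric])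
  have nn: "n \<bullet> n = 1" using assms by (simp add: dot_square_norm)
  show "z - (n \<bullet> z - c) *\<^sub>R n \<in> {x. n \<bullet> x = c}" by (simp add: inner_diff_right nn)
  show "\<forall>y\<in>{x. n \<bullet> x = c}. dist z (z - (n \<bullet> z - c) *\<^sub>R n) \<le> dist z y"
  proof
    fix y assume "y \<in> {x. n \<bullet> x = c}"
    then have "n \<bullet> z - c = n \<bullet> (z - y)" by (simp add: inner_diff_right)
    then have "\<bar>n \<bullet> z - c\<bar> \<le> norm (z - y)"
      using Cauchy_Schwarz_ineq2[of n "z - y"] assms by simp
    then show "dist z (z - (n \<bullet> z - c) *\<^sub>R n) \<le> dist z y"
      by (simp add: dist_norm assms)
  qed
qed (auto simp: convex_hyperplane closed_hyperplane)

text \<open>The closest point of the hyperplane is the orthogonal projection, so membership in the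
  prism splits into a condition on the height and one on the foot point.\<close>

lemma facet_integral_prism:
  assumes n: "norm n = 1" and aff: "affine hull F = {x. n \<bullet> x = c}"
  shows "facet_integral n F f = (LINT z|lebesgue. indicator {0..1} (n \<bullet> z - c) *
    (indicator F (z - (n \<bullet> z - c) *\<^sub>R n) * f (z - (n \<bullet> z - c) *\<^sub>R n)))"
proof -
  have nn: "n \<bullet> n = 1" using n by (simp add: dot_square_norm)
  have F: "n \<bullet> x = c" if "x \<in> F" for x using hull_inc[OF that, of affine] aff by auto
  have *: "z \<in> {x + s *\<^sub>R n |x s. x \<in> F \<and> 0 \<le> s \<and> s \<le> 1} \<longleftrightarrow>
     n \<bullet> z - c \<in> {0..1} \<and> z - (n \<bullet> z - c) *\<^sub>R n \<in> F" for z
  proof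
    assume "n \<bullet> z - c \<in> {0..1} \<and> z - (n \<bullet> z - c) *\<^sub>R n \<in> F"
    then show "z \<in> {x + s *\<^sub>R n |x s. x \<in> F \<and> 0 \<le> s \<and> s \<le> 1}"
      by (intro CollectI exI[of _ "z - (n \<bullet> z - c) *\<^sub>R n"] exI[of _ "n \<bullet> z - c"]) auto
  qed (auto simp: F inner_add_right nn)
  show ?thesis
    unfolding facet_integral_def set_lebesgue_integral_def aff closest_point_hyperplane[OF n]
    by (rule Bochner_Integration.integral_cong[OF refl]) (auto simp: indicator_def * simp del: mem_Collect_eq)
qed

lemma bounded_borel_support_facet:
  assumes "bounded_borel_support (\<lambda>x. indicator F x * f x)"
  shows "bounded_borel_support (\<lambda>z. indicator {0..1} (n \<bullet> z - c) *
    (indicator F (z - (n \<bullet> z - c) *\<^sub>R n) * f (z - (n \<bullet> z - c) *\<^sub>R n)))"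
  using bounded_borel_support_prism[OF assms, of n c 1 n] by simp

text \<open>A Borel integrand has the same integral for Lebesgue measure and for its Borel
  restriction, where Fubini and translations are at hand.\<close>

lemma facet_integral_lborel:
  assumes "norm n = 1" "affine hull F = {x. n \<bullet> x = c}"
    and f: "bounded_borel_support (\<lambda>x. indicator F x * f x)"
  shows "facet_integral n F f = prism_integral n c (\<lambda>x. indicator F x * f x)"
  unfolding facet_integral_prism[OF assms(1,2)] prism_integral_def
  using bounded_borel_support_facet[OF f, of n c]
  by (intro integral_completion) (auto simp: bounded_borel_support_def)

lemma facet_integral_cong:
  assumes "flat_facet n F" "\<And>x. x \<in> F \<Longrightarrow> f x = g x"
  shows "facet_integral n F f = facet_integral n F g"
proof -
  obtain c where n: "norm n = 1" "affine hull F = {x. n \<bullet> x = c}"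
    using assms(1) by (auto simp: flat_facet_def)
  show ?thesis unfolding facet_integral_prism[OF n]
    by (rule Bochner_Integration.integral_cong[OF refl]) (auto simp: indicator_def assms(2))
qed

lemma facet_integral_add:
  assumes "flat_facet n F" and f: "bounded_borel_support (\<lambda>x. indicator F x * f x)"
    and g: "bounded_borel_support (\<lambda>x. indicator F x * g x)"
  shows "facet_integral n F (\<lambda>x. f x + g x) = facet_integral n F f + facet_integral n F g"
proof -
  obtain c where n: "norm n = 1" "affine hull F = {x. n \<bullet> x = c}"
    using assms(1) by (auto simp: flat_facet_def)
  have "bounded_borel_support (\<lambda>x. indicator F x * (f x + g x))"
    using bounded_borel_support_add[OF f g] by (simp add: distrib_left)
  from facet_integral_lborel[OF n this] show ?thesis
    unfolding facet_integral_lborel[OF n f] facet_integral_lborel[OF n g]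
    by (simp add: prism_integral_def distrib_left integrable_bounded_borel_support bounded_borel_support_facet f g)
qed

lemma facet_integral_cmult:
  assumes "flat_facet n F"
  shows "facet_integral n F (\<lambda>x. a * f x) = a * facet_integral n F f"
proof -
  obtain c where n: "norm n = 1" "affine hull F = {x. n \<bullet> x = c}"
    using assms(1) by (auto simp: flat_facet_def)
  show ?thesis unfolding facet_integral_prism[OF n]
    by (subst integral_mult_right_zero[symmetric]) (simp add: mult.left_commute)
qed

lemma facet_integral_nonpos:
  assumes "flat_facet n F" and "\<And>x. x \<in> F \<Longrightarrow> f x \<le> 0"
  shows "facet_integral n F f \<le> 0"
proof -
  obtain c where n: "norm n = 1" "affine hull F = {x. n \<bullet> x = c}"
    using assms(1) by (auto simp: flat_facet_def)
  have "0 \<le> (LINT z|lebesgue. - (indicator {0..1} (n \<bullet> z - c) *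
    (indicator F (z - (n \<bullet> z - c) *\<^sub>R n) * f (z - (n \<bullet> z - c) *\<^sub>R n))))"
    using assms(2) by (intro integral_nonneg_AE AE_I2) (auto simp: indicator_def)
  then show ?thesis unfolding facet_integral_prism[OF n] by simp
qed

text \<open>The prisms on the two sides of \<open>F\<close> are translates of each other by
  \<open>n\<close>. Two neighbors with opposite normals thus obtain the same integral over their
  common facet.\<close>

lemma facet_integral_uminus_normal:
  assumes "flat_facet n F" and f: "bounded_borel_support (\<lambda>x. indicator F x * f x)"
  shows "facet_integral (- n) F f = facet_integral n F f"
proof -
  obtain c where n: "norm n = 1" "affine hull F = {x. n \<bullet> x = c}"
    using assms(1) by (auto simp: flat_facet_def)
  have nn: "n \<bullet> n = 1" using n by (simp add: dot_square_norm)
  have n': "norm (- n) = 1" "affine hull F = {x. - n \<bullet> x = - c}" using n by auto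
  let ?h = "\<lambda>z. indicator {0..1} (- n \<bullet> z - - c) *
    (indicator F (z - (- n \<bullet> z - - c) *\<^sub>R - n) * f (z - (- n \<bullet> z - - c) *\<^sub>R - n))"
  have "facet_integral (- n) F f = (LINT z|lborel. ?h z)"
    using facet_integral_lborel[OF n' f] by (simp only: prism_integral_def)
  also have "\<dots> = (LINT z|lborel. ?h (z - n))"
    using integral_lborel_translation[of ?h "- n"] by simp
  also have "\<dots> = facet_integral n F f"
    unfolding facet_integral_lborel[OF n f] prism_integral_def
  proof (rule Bochner_Integration.integral_cong[OF refl])
    fix z
    have 1: "(- n \<bullet> (z - n) - - c) = 1 - (n \<bullet> z - c)" by (simp add: inner_diff_right nn)
    have 2: "(z - n) - (1 - (n \<bullet> z - c)) *\<^sub>R - n = z - (n \<bullet> z - c) *\<^sub>R n" by (simp add: algebra_simps)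
    show "?h (z - n) = indicator {0..1} (n \<bullet> z - c) *
       (indicator F (z - (n \<bullet> z - c) *\<^sub>R n) * f (z - (n \<bullet> z - c) *\<^sub>R n))"
      unfolding 1 2 by (auto simp: indicator_def)
  qed
  finally show ?thesis .
qed

text \<open>If the integral vanished, the ball would be a null set.\<close>

lemma integral_pos_ball:
  fixes h :: "'a::euclidean_space \<Rightarrow> real"
  assumes h: "bounded_borel_support h" "\<And>z. 0 \<le> h z" and r: "r > 0" "\<And>z. z \<in> ball x r \<Longrightarrow> 0 < h z"
  shows "0 < (LINT z|lborel. h z)"
proof -
  have "(LINT z|lborel. h z) \<noteq> 0"
  proof
    assume "(LINT z|lborel. h z) = 0"
    then have "AE z in lborel. h z = 0"
      using integral_nonneg_eq_0_iff_AE[OF integrable_bounded_borel_support[OF h(1)]] h(2) by simp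
    then have "AE z in lborel. z \<notin> ball x r"
      by eventually_elim (use r(2) in force)
    then have "ball x r \<in> null_sets lborel" using AE_iff_null_sets[of "ball x r" lborel] by simp
    then have "negligible (ball x r)" by (simp add: negligible_iff_null_sets null_sets_def)
    then show False using r(1) by (simp add: open_not_negligible)
  qed
  moreover have "0 \<le> (LINT z|lborel. h z)" using h(2) by simp
  ultimately show ?thesis by linarith
qed

text \<open>A small ball around the point at height 1/2 over \<open>x\<close> lies in the prism, and
  its foot points are so close to \<open>x\<close> that they belong to \<open>F\<close> and
  \<open>f\<close> is positive there.\<close>

lemma facet_integral_pos:
  assumes "flat_facet n F" and f: "continuous_on UNIV f" and nn: "\<And>x. x \<in> F \<Longrightarrow> 0 \<le> f x"
    and x: "x \<in> F" "0 < f x" "\<epsilon> > 0" "ball x \<epsilon> \<inter> affine hull F \<subseteq> F"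
  shows "facet_integral n F f > 0"
proof -
  obtain c where n: "norm n = 1" "affine hull F = {x. n \<bullet> x = c}" and cF: "compact F"
    using assms(1) by (auto simp: flat_facet_def)
  have n1: "n \<bullet> n = 1" using n by (simp add: dot_square_norm)
  have nx: "n \<bullet> x = c" using hull_inc[OF x(1), of affine] n by auto
  obtain d where d: "d > 0" "\<And>y. dist y x < d \<Longrightarrow> f y > 0"
  proof -
    have "isCont f x" using f by (simp add: continuous_on_eq_continuous_at)
    then have "\<exists>d>0. \<forall>y. dist y x < d \<longrightarrow> dist (f y) (f x) < f x" using x(2) by (auto simp: continuous_at_eps_delta)
    then show ?thesis using that by (force simp: dist_real_def)
  qed
  \<comment> \<open>Foot points of the ball of radius \<open>r\<close> are within
    \<open>2 * r\<close> of \<open>x\<close>, and \<open>r \<le> 1 / 2\<close> keeps the heights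
    between 0 and 1.\<close>
  define r where "r = min 1 (min d \<epsilon>) / 2"
  have r: "r > 0" "2 * r \<le> 1" "2 * r \<le> d" "2 * r \<le> \<epsilon>" using d(1) x(3) by (auto simp: r_def)
  let ?h = "\<lambda>z. indicator {0..1} (n \<bullet> z - c) * (indicator F (z - (n \<bullet> z - c) *\<^sub>R n) * f (z - (n \<bullet> z - c) *\<^sub>R n))"
  let ?x = "x + (1/2) *\<^sub>R n"
  have pos: "?h z > 0" if "z \<in> ball ?x r" for z
  proof -
    let ?y = "z - (n \<bullet> z - c) *\<^sub>R n"
    have zx: "norm (z - ?x) < r" using that by (simp add: dist_norm norm_minus_commute)
    have e: "n \<bullet> z - c - 1/2 = n \<bullet> (z - ?x)" by (simp add: inner_diff_right inner_add_right n1 nx)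
    have a: "\<bar>n \<bullet> z - c - 1/2\<bar> < r"
      unfolding e using Cauchy_Schwarz_ineq2[of n "z - ?x"] n(1) zx by simp
    have "?y - x = (z - ?x) - (n \<bullet> z - c - 1/2) *\<^sub>R n" by (simp add: algebra_simps)
    then have "norm (?y - x) \<le> norm (z - ?x) + norm ((n \<bullet> z - c - 1/2) *\<^sub>R n)"
      using norm_triangle_ineq4[of "z - ?x" "(n \<bullet> z - c - 1/2) *\<^sub>R n"] by (simp only:)
    also have "\<dots> < r + r" using zx a n(1) by (intro add_strict_mono) auto
    finally have yx: "dist ?y x < 2 * r" by (simp add: dist_norm)
    have "?y \<in> affine hull F" by (simp add: n inner_diff_right n1)
    moreover have "?y \<in> ball x \<epsilon>" using yx r by (simp add: dist_commute)
    ultimately have "?y \<in> F" using x(4) by blast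
    moreover have "f ?y > 0" using d(2)[of ?y] yx r by simp
    moreover have "n \<bullet> z - c \<in> {0..1}" using a r by (auto simp: abs_less_iff)
    ultimately show ?thesis by simp
  qed
  have fb: "bounded_borel_support (\<lambda>x. indicator F x * f x)"
    by (rule bounded_borel_support_compact[OF cF f])
  have hb: "bounded_borel_support ?h" by (rule bounded_borel_support_facet[OF fb])
  have nonneg: "?h z \<ge> 0" for z using nn by (auto simp: indicator_def)
  have "0 < (LINT z|lborel. ?h z)" by (rule integral_pos_ball[OF hb nonneg r(1) pos])
  then show ?thesis unfolding facet_integral_lborel[OF n fb] prism_integral_def .
qed

text \<open>\<open>g u \<bullet> x + b u\<close> is the barycentric coordinate of \<open>x\<close>
  at the vertex \<open>u\<close>, as an affine function on the whole space. Membership in the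
  simplex and in its facets becomes a matter of signs of these functions.\<close>

locale barycentric =
  fixes K C :: "(real^'n::finite) set" and g :: "real^'n \<Rightarrow> real^'n" and b :: "real^'n \<Rightarrow> real"
  assumes finC: "finite C" and cardC: "card C = CARD('n) + 1" and indC: "\<not> affine_dependent C"
    and Khull: "K = convex hull C"
    and vertex: "\<And>u w. u \<in> C \<Longrightarrow> w \<in> C \<Longrightarrow> g u \<bullet> w + b u = (if u = w then 1 else 0)"
    and sum1: "\<And>x. (\<Sum>u\<in>C. g u \<bullet> x + b u) = 1"
    and comb: "\<And>x. (\<Sum>u\<in>C. (g u \<bullet> x + b u) *\<^sub>R u) = x"

text \<open>The vertices other than \<open>u\<close> span a hyperplane that misses \<open>u\<close>;
  its equation, scaled to be 1 at \<open>u\<close>, is the coordinate. The last two properties hold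
  everywhere because the vertices affinely span the space.\<close>

lemma simplex_barycentric:
  fixes K :: "(real^'n::finite) set"
  assumes "int CARD('n) simplex K"
  obtains C g b where "barycentric K C g b"
proof -
  obtain C where C: "finite C" "\<not> affine_dependent C" "card C = CARD('n) + 1" "K = convex hull C"
    using assms by (auto simp: simplex)
  have "\<exists>g b. \<forall>w\<in>C. g \<bullet> w + b = (if u = w then 1 else 0)" if u: "u \<in> C" for u
  proof -
    have "\<not> affine_dependent (C - {u})" using C(2) by (simp add: affine_independent_Diff)
    then have "int (card (C - {u})) = aff_dim (C - {u}) + 1" by (simp add: aff_dim_affine_independent)
    then have "aff_dim (C - {u}) = DIM(real^'n) - 1" using C u by simp
    then obtain a c where a: "a \<noteq> 0" "affine hull (C - {u}) = {x. a \<bullet> x = c}"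
      using aff_dim_eq_hyperplane by blast
    have "u \<notin> affine hull (C - {u})" using C(2) u by (auto simp: affine_dependent_def)
    then have ne: "a \<bullet> u - c \<noteq> 0" using a by auto
    have "a \<bullet> w = c" if "w \<in> C" "w \<noteq> u" for w
      using hull_inc[of w "C - {u}" affine] that a by auto
    moreover have "(a /\<^sub>R (a \<bullet> u - c)) \<bullet> w + - c / (a \<bullet> u - c) = (a \<bullet> w - c) / (a \<bullet> u - c)" for w
      by (simp add: divide_inverse algebra_simps)
    ultimately show ?thesis using ne
      by (intro exI[of _ "a /\<^sub>R (a \<bullet> u - c)"] exI[of _ "- c / (a \<bullet> u - c)"]) auto
  qed
  then obtain g b where gb: "\<And>u w. u \<in> C \<Longrightarrow> w \<in> C \<Longrightarrow> g u \<bullet> w + b u = (if u = w then 1 else 0)" by metis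
  have "aff_dim C = DIM(real^'n)" using aff_dim_affine_independent[OF C(2)] C(3) by simp
  then have full: "affine hull C = UNIV" by (simp only: aff_dim_eq_full)
  have *: "(\<Sum>u\<in>C. g u \<bullet> x + b u) = 1 \<and> (\<Sum>u\<in>C. (g u \<bullet> x + b u) *\<^sub>R u) = x" for x
  proof -
    have "x \<in> affine hull C" by (simp add: full)
    then obtain h where h: "sum h C = 1" "(\<Sum>v\<in>C. h v *\<^sub>R v) = x"
      unfolding affine_hull_finite[OF C(1)] by auto
    have "g u \<bullet> x + b u = h u" if "u \<in> C" for u
    proof -
      have "g u \<bullet> x + b u = (\<Sum>v\<in>C. h v * (g u \<bullet> v)) + (\<Sum>v\<in>C. h v * b u)"
        unfolding h(2)[symmetric] by (simp add: inner_sum_right sum_distrib_right[symmetric] h(1))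
      also have "\<dots> = (\<Sum>v\<in>C. h v * (g u \<bullet> v + b u))"
        by (simp add: distrib_left sum.distrib)
      also have "\<dots> = (\<Sum>v\<in>C. if u = v then h v else 0)"
        using gb[OF that] by (intro sum.cong) auto
      finally show ?thesis using that C(1) by simp
    qed
    then show ?thesis using h by simp
  qed
  have "barycentric K C g b" using C gb * by unfold_locales auto
  then show ?thesis by (rule that)
qed

context barycentric begin

definition lam :: "real^'n \<Rightarrow> real^'n \<Rightarrow> real" where "lam u x = g u \<bullet> x + b u"
definition fct :: "real^'n \<Rightarrow> (real^'n) set" where "fct u = convex hull (C - {u})"
text \<open>The coordinate at \<open>u\<close> decreases from \<open>u\<close> to the opposite facet
  and beyond, so its negated gradient points outward there.\<close>

definition nu :: "real^'n \<Rightarrow> real^'n" where "nu u = - (g u /\<^sub>R norm (g u))"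

lemma lam_vertex: "u \<in> C \<Longrightarrow> w \<in> C \<Longrightarrow> lam u w = (if u = w then 1 else 0)"
  by (simp add: lam_def vertex)

lemma lam_sum: "(\<Sum>u\<in>C. lam u x) = 1" and lam_comb: "(\<Sum>u\<in>C. lam u x *\<^sub>R u) = x"
  by (simp_all add: lam_def sum1 comb)

lemma lam_line: "lam u (x + s *\<^sub>R (y - x)) = lam u x + s * (lam u y - lam u x)"
  by (simp add: lam_def inner_add_right inner_diff_right algebra_simps)

lemma lam_affine_comb:
  assumes "sum h S = 1" "finite S" shows "lam u (\<Sum>w\<in>S. h w *\<^sub>R w) = (\<Sum>w\<in>S. h w * lam u w)"
proof -
  have "b u = (\<Sum>w\<in>S. h w * b u)" by (simp add: sum_distrib_right[symmetric] assms)
  then show ?thesis by (simp add: lam_def inner_sum_right distrib_left sum.distrib)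
qed

lemma K_eq: "K = {x. \<forall>u\<in>C. 0 \<le> lam u x}"
proof (intro set_eqI iffI)
  fix x assume "x \<in> K"
  then obtain h where "\<forall>u\<in>C. 0 \<le> h u" "sum h C = 1" "(\<Sum>u\<in>C. h u *\<^sub>R u) = x"
    unfolding Khull convex_hull_finite[OF finC] by auto
  then show "x \<in> {x. \<forall>u\<in>C. 0 \<le> lam u x}"
    using finC by (auto simp: lam_affine_comb[symmetric] lam_vertex intro!: sum_nonneg
      dest!: sym[of "sum _ _" x] simp: lam_affine_comb)
next
  fix x assume "x \<in> {x. \<forall>u\<in>C. 0 \<le> lam u x}"
  then show "x \<in> K"
    unfolding Khull convex_hull_finite[OF finC] using lam_sum[of x] lam_comb[of x]
    by (intro CollectI exI[of _ "\<lambda>u. lam u x"]) auto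
qed

lemma fct_eq:
  assumes "u \<in> C" shows "fct u = {x\<in>K. lam u x = 0}"
proof (intro set_eqI iffI)
  fix x assume x: "x \<in> fct u"
  then obtain h where h: "sum h (C - {u}) = 1" "(\<Sum>w\<in>C - {u}. h w *\<^sub>R w) = x"
    unfolding fct_def convex_hull_finite[OF finite_Diff[OF finC]] by auto
  have "lam u x = (\<Sum>w\<in>C - {u}. h w * lam u w)"
    using lam_affine_comb[OF h(1)] finC h(2) by simp
  also have "\<dots> = 0" using lam_vertex assms by (intro sum.neutral) auto
  finally show "x \<in> {x\<in>K. lam u x = 0}"
    using x hull_mono[of "C - {u}" C convex] by (auto simp: fct_def Khull)
next
  fix x assume x: "x \<in> {x\<in>K. lam u x = 0}"
  then have "(\<Sum>w\<in>C - {u}. lam w x) = 1" "(\<Sum>w\<in>C - {u}. lam w x *\<^sub>R w) = x"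
    using lam_sum[of x] lam_comb[of x] assms finC by (auto simp: sum_diff1)
  then show "x \<in> fct u"
    unfolding fct_def convex_hull_finite[OF finite_Diff[OF finC]] using x
    by (intro CollectI exI[of _ "\<lambda>w. lam w x"]) (auto simp: K_eq)
qed

lemma ex_other_vertex: "\<exists>w\<in>C. w \<noteq> u"
proof (rule ccontr)
  assume "\<not> ?thesis"
  then have "C \<subseteq> {u}" by auto
  then have "card C \<le> 1" using card_mono[of "{u}" C] by simp
  then show False by (simp add: cardC)
qed

lemma g_nonzero: assumes "u \<in> C" shows "g u \<noteq> 0"
proof
  assume g0: "g u = 0"
  obtain w where "w \<in> C" "w \<noteq> u" using ex_other_vertex by blast
  then show False using vertex[OF assms assms] vertex[OF assms, of w] g0 by auto
qed

lemma norm_nu: "u \<in> C \<Longrightarrow> norm (nu u) = 1"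
  using g_nonzero by (simp add: nu_def)

lemma lam_nu: "u \<in> C \<Longrightarrow> lam u x = norm (g u) * (b u / norm (g u) - nu u \<bullet> x)"
  using g_nonzero by (simp add: lam_def nu_def field_simps)

lemma affine_hull_fct:
  assumes "u \<in> C" shows "affine hull (fct u) = {x. nu u \<bullet> x = b u / norm (g u)}"
proof -
  have "affine hull (fct u) = affine hull (C - {u})" by (simp add: fct_def)
  also have "\<dots> = {x. lam u x = 0}"
  proof (intro set_eqI iffI)
    fix x assume "x \<in> affine hull (C - {u})"
    then obtain h where h: "sum h (C - {u}) = 1" "(\<Sum>w\<in>C - {u}. h w *\<^sub>R w) = x"
      unfolding affine_hull_finite[OF finite_Diff[OF finC]] by auto
    have "lam u x = (\<Sum>w\<in>C - {u}. h w * lam u w)"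
      using lam_affine_comb[OF h(1)] finC h(2) by simp
    also have "\<dots> = 0" using lam_vertex assms by (intro sum.neutral) auto
    finally show "x \<in> {x. lam u x = 0}" by simp
  next
    fix x assume x: "x \<in> {x. lam u x = 0}"
    then have "(\<Sum>w\<in>C - {u}. lam w x) = 1" "(\<Sum>w\<in>C - {u}. lam w x *\<^sub>R w) = x"
      using lam_sum[of x] lam_comb[of x] assms finC by (auto simp: sum_diff1)
    then show "x \<in> affine hull (C - {u})"
      unfolding affine_hull_finite[OF finite_Diff[OF finC]] using x
      by (intro CollectI exI[of _ "\<lambda>w. lam w x"]) auto
  qed
  also have "\<dots> = {x. nu u \<bullet> x = b u / norm (g u)}"
    using g_nonzero[OF assms] by (auto simp: lam_nu[OF assms])
  finally show ?thesis .
qed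

lemma compact_K: "compact K" and convex_K: "convex K"
  by (simp_all add: Khull finite_imp_compact_convex_hull finC)

lemma compact_fct: "compact (fct u)"
  by (simp add: fct_def finite_imp_compact_convex_hull finC)

lemma flat_facet_fct: "u \<in> C \<Longrightarrow> flat_facet (nu u) (fct u)"
  unfolding flat_facet_def using norm_nu compact_fct affine_hull_fct by blast

text \<open>The witness is the barycenter of the facet, whose \<open>CARD('n)\<close> vertices have
  equal weights.\<close>

lemma fct_strict_point:
  assumes "u \<in> C" shows "\<exists>x\<in>fct u. \<forall>w\<in>C. w \<noteq> u \<longrightarrow> lam w x > 0"
proof -
  let ?N = "real CARD('n)"
  define x where "x = (\<Sum>w\<in>C - {u}. (1 / ?N) *\<^sub>R w)"
  have s: "sum (\<lambda>w. 1 / ?N) (C - {u}) = 1" using cardC finC assms by simp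
  have l: "lam v x = (\<Sum>w\<in>C - {u}. 1 / ?N * lam v w)" for v
    unfolding x_def by (rule lam_affine_comb[OF s]) (simp add: finC)
  have "lam v x = (if v = u then 0 else 1 / ?N)" if "v \<in> C" for v
  proof -
    have "lam v x = (\<Sum>w\<in>C - {u}. if v = w then 1 / ?N else 0)"
      unfolding l by (rule sum.cong) (auto simp: lam_vertex that)
    then show ?thesis using finC that by simp
  qed
  then show ?thesis using fct_eq[OF assms] assms by (intro bexI[of _ x]) (auto simp: K_eq)
qed

lemma ex_lam_pos: "\<exists>x. \<forall>u\<in>C. lam u x > 0"
proof -
  let ?N = "real (card C)"
  define x where "x = (\<Sum>w\<in>C. (1 / ?N) *\<^sub>R w)"
  have N: "?N > 0" by (simp add: cardC)
  have s: "sum (\<lambda>w. 1 / ?N) C = 1" using N by simp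
  have "lam v x = 1 / ?N" if "v \<in> C" for v
  proof -
    have "lam v x = (\<Sum>w\<in>C. 1 / ?N * lam v w)" unfolding x_def by (rule lam_affine_comb[OF s finC])
    also have "\<dots> = (\<Sum>w\<in>C. if v = w then 1 / ?N else 0)"
      by (rule sum.cong) (auto simp: lam_vertex that)
    finally show ?thesis using finC that by simp
  qed
  then show ?thesis using N by (intro exI[of _ x]) auto
qed

lemma open_lam_pos: "open {x. \<forall>u\<in>C. lam u x > 0}"
proof -
  have "{x. \<forall>u\<in>C. lam u x > 0} = (\<Inter>u\<in>C. {x. 0 < lam u x})" by auto
  then show ?thesis using finC
    by (auto simp: lam_def intro!: open_INT open_Collect_less continuous_intros)
qed

lemma lam_pos_interior: "{x. \<forall>u\<in>C. lam u x > 0} \<subseteq> interior K"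
  by (rule interior_maximal[OF _ open_lam_pos]) (auto simp: K_eq intro: less_imp_le)

lemma interior_nonempty: "interior K \<noteq> {}"
  using ex_lam_pos lam_pos_interior by blast

lemma facets: "F facet_of K \<longleftrightarrow> (\<exists>u\<in>C. F = fct u)"
proof -
  have "fct u \<noteq> {}" for u using ex_other_vertex[of u] by (auto simp: fct_def)
  then show ?thesis
    unfolding Khull facet_of_convex_hull_affine_independent[OF indC] fct_def by auto
qed

lemma inj_fct: "inj_on fct C"
proof (rule inj_onI, rule ccontr)
  fix u w assume *: "u \<in> C" "w \<in> C" "fct u = fct w" "u \<noteq> w"
  have "w \<in> C - {u}" using * by auto
  then have "w \<in> fct u" unfolding fct_def by (rule hull_inc)
  then show False using * fct_eq[of w] lam_vertex[of w w] by auto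
qed

lemma facets_image: "{F. F facet_of K} = fct ` C"
  using facets by auto

lemma vertices: "x extreme_point_of K \<longleftrightarrow> x \<in> C"
  unfolding Khull by (rule extreme_point_of_convex_hull_affine_independent[OF indC])

lemma vertex_in_K: "u \<in> C \<Longrightarrow> u \<in> K"
  unfolding Khull by (rule hull_inc)

text \<open>For uniqueness, a competitor \<open>n\<close> takes one value at all vertices of the
  facet, so \<open>n \<bullet> y\<close> is an affine function of \<open>lam u y\<close> alone and
  \<open>n\<close> is a multiple of \<open>g u\<close>; length and sign fix the factor.\<close>

lemma outward_normal_fct:
  assumes u: "u \<in> C" shows "outward_normal K (fct u) = nu u"
  unfolding outward_normal_def
proof (rule the_equality)
  have "nu u \<bullet> (y - x) \<le> 0" if "x \<in> fct u" "y \<in> K" for x y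
  proof -
    have "lam u x = 0" "0 \<le> lam u y" using that fct_eq[OF u] u by (auto simp: K_eq)
    then have "norm (g u) * (nu u \<bullet> (y - x)) \<le> 0"
      by (simp add: lam_nu[OF u] inner_diff_right right_diff_distrib)
    then show ?thesis using g_nonzero[OF u] by (simp add: mult_le_0_iff)
  qed
  then show "norm (nu u) = 1 \<and> (\<forall>x\<in>fct u. \<forall>y\<in>K. nu u \<bullet> (y - x) \<le> 0)" using norm_nu[OF u] by auto
next
  fix n assume n: "norm n = 1 \<and> (\<forall>x\<in>fct u. \<forall>y\<in>K. n \<bullet> (y - x) \<le> 0)"
  obtain x where x: "x \<in> C" "x \<noteq> u" using ex_other_vertex by blast
  have inF: "w \<in> fct u" if "w \<in> C" "w \<noteq> u" for w using that by (auto simp: fct_def intro: hull_inc)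
  \<comment> \<open>Both points lie in the facet and in \<open>K\<close>, so the inequality holds in
    both directions.\<close>
  have eq: "n \<bullet> w = n \<bullet> x" if "w \<in> C" "w \<noteq> u" for w
  proof -
    have "n \<bullet> (w - x) \<le> 0" "n \<bullet> (x - w) \<le> 0" using n inF that x vertex_in_K by blast+
    then show ?thesis by (simp add: inner_diff_right)
  qed
  define c where "c = n \<bullet> u - n \<bullet> x"
  have c0: "c \<le> 0" using n inF[OF x] vertex_in_K[OF u] by (auto simp: c_def inner_diff_right)
  have "n \<bullet> y = n \<bullet> x + c * lam u y" for y
  proof -
    have "n \<bullet> y = n \<bullet> (\<Sum>w\<in>C. lam w y *\<^sub>R w)" by (simp add: lam_comb)
    also have "\<dots> = (\<Sum>w\<in>C. lam w y * (n \<bullet> w))" by (simp add: inner_sum_right)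
    also have "\<dots> = (\<Sum>w\<in>C. lam w y * (n \<bullet> x) + (if w = u then c * lam u y else 0))"
      using eq by (intro sum.cong refl) (auto simp: c_def algebra_simps)
    also have "\<dots> = n \<bullet> x + c * lam u y"
      using u finC by (simp add: sum.distrib sum_distrib_right[symmetric] lam_sum)
    finally show ?thesis .
  qed
  note aff = this
  have "n \<bullet> y = (c *\<^sub>R g u) \<bullet> y" for y
    using aff[of y] aff[of 0] by (simp add: lam_def distrib_left)
  then have nc: "n = c *\<^sub>R g u" using vector_eq_rdot by blast
  then have "\<bar>c\<bar> * norm (g u) = 1" using n by simp
  then have "- c * norm (g u) = 1" using c0 by simp
  then have "c = - 1 / norm (g u)" using nonzero_eq_divide_eq[of "norm (g u)" c "-1"] g_nonzero[OF u] by simp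
  then show "n = nu u" unfolding nu_def nc by (simp add: divide_inverse)
qed

lemma divergence:
  assumes cont: "continuous_on UNIV f" "continuous_on UNIV f'"
    and der: "\<And>x. ((\<lambda>s. f (x + s *\<^sub>R e)) has_real_derivative f' x) (at 0)"
    and e: "e \<noteq> 0"
  shows "(LINT x:K|lebesgue. f' x) =
    (\<Sum>F | F facet_of K. (outward_normal K F \<bullet> e) * facet_integral (outward_normal K F) F f)"
proof -
  have Kn: "K = {x. \<forall>u\<in>C. nu u \<bullet> x \<le> b u / norm (g u)}"
  proof -
    have "0 \<le> lam u x \<longleftrightarrow> nu u \<bullet> x \<le> b u / norm (g u)" if "u \<in> C" for u x
      using g_nonzero[OF that] by (simp add: lam_nu[OF that] zero_le_mult_iff)
    then show ?thesis unfolding K_eq by auto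
  qed
  \<comment> \<open>On the hyperplane of a facet, membership in \<open>K\<close> and in the facet
    agree; the boundary term of the polytope is thus the facet integral.\<close>
  have ind: "prism_integral (nu u) (b u / norm (g u)) (\<lambda>x. indicator K x * f x) =
    facet_integral (nu u) (fct u) f" if u: "u \<in> C" for u
    unfolding facet_integral_lborel[OF norm_nu[OF u] affine_hull_fct[OF u]
      bounded_borel_support_compact[OF compact_fct cont(1)]] prism_integral_def
  proof (rule Bochner_Integration.integral_cong[OF refl])
    fix z
    let ?y = "z - (nu u \<bullet> z - b u / norm (g u)) *\<^sub>R nu u"
    have "nu u \<bullet> nu u = 1" using norm_nu[OF u] by (simp add: dot_square_norm)
    then have "nu u \<bullet> ?y = b u / norm (g u)" by (simp add: inner_diff_right)
    then have "?y \<in> fct u \<longleftrightarrow> ?y \<in> K" by (simp add: fct_eq[OF u] lam_nu[OF u])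
    then show "indicator {0..1} (nu u \<bullet> z - b u / norm (g u)) * (indicator K ?y * f ?y) =
      indicator {0..1} (nu u \<bullet> z - b u / norm (g u)) * (indicator (fct u) ?y * f ?y)"
      by (simp add: indicator_def)
  qed
  have "(LINT x:K|lebesgue. f' x) = (LINT x|lborel. indicator K x * f' x)"
    using bounded_borel_support_compact[OF compact_K cont(2)]
    by (simp add: set_lebesgue_integral_def integral_completion bounded_borel_support_def)
  also have "\<dots> = (\<Sum>u\<in>C. (nu u \<bullet> e) *
      prism_integral (nu u) (b u / norm (g u)) (\<lambda>x. indicator K x * f x))"
  proof (rule divergence_polytope[OF finC _ Kn _ _ cont der e])
    show "norm (nu u) = 1" if "u \<in> C" for u by (rule norm_nu[OF that])
    show "bounded K" using compact_K by (rule compact_imp_bounded)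
    show "i = k" if "i \<in> C" "k \<in> C" "{x. nu i \<bullet> x = b i / norm (g i)} = {x. nu k \<bullet> x = b k / norm (g k)}" for i k
    proof -
      have "lam i x = 0 \<longleftrightarrow> lam k x = 0" for x
      proof -
        have "lam u x = 0 \<longleftrightarrow> nu u \<bullet> x = b u / norm (g u)" if "u \<in> C" for u
          using g_nonzero[OF that] by (auto simp: lam_nu[OF that])
        then show ?thesis using that by blast
      qed
      from this[of k] show ?thesis using lam_vertex that by (metis zero_neq_one)
    qed
  qed
  also have "\<dots> = (\<Sum>u\<in>C. (nu u \<bullet> e) * facet_integral (nu u) (fct u) f)"
    by (simp add: ind)
  also have "\<dots> = (\<Sum>F | F facet_of K. (outward_normal K F \<bullet> e) * facet_integral (outward_normal K F) F f)"
    unfolding facets_image sum.reindex[OF inj_fct] by (simp add: outward_normal_fct)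
  finally show ?thesis .
qed

end

section \<open>Test functions\<close>

text \<open>The denominator makes the family closed under differentiation: the derivative of member
  \<open>k\<close> combines the members \<open>k + 1\<close> and \<open>k + 2\<close>.\<close>

definition exp_bump :: "nat \<Rightarrow> real \<Rightarrow> real" where
  "exp_bump k t = (if t > 0 then exp (- (1 / t)) / t ^ k else 0)"

lemma exp_bump_tendsto_0: "(exp_bump k \<longlongrightarrow> 0) (at_right 0)"
proof -
  have "((\<lambda>t. (inverse t) ^ k / exp (inverse t)) \<longlongrightarrow> 0) (at_right (0::real))"
    by (rule filterlim_compose[OF tendsto_power_div_exp_0 filterlim_inverse_at_top_right])
  moreover have "\<forall>\<^sub>F t in at_right (0::real). (inverse t) ^ k / exp (inverse t) = exp_bump k t"
    using eventually_at_right_less[of 0]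
    by eventually_elim (simp add: exp_bump_def exp_minus field_simps)
  ultimately show ?thesis by (rule Lim_transform_eventually)
qed

lemma exp_bump_has_derivative:
  "(exp_bump k has_real_derivative (exp_bump (k + 2) t - k * exp_bump (k + 1) t)) (at t)"
proof -
  consider "t > 0" | "t < 0" | "t = 0" by linarith
  then show ?thesis
  proof cases
    case 1
    have "((\<lambda>t. exp (- (1 / t)) / t ^ k) has_real_derivative
       (exp (- (1 / t)) * (1 / t\<^sup>2) * t ^ k - exp (- (1 / t)) * (k * t ^ (k - 1))) / (t ^ k * t ^ k)) (at t)"
      using 1 by (auto intro!: derivative_eq_intros simp: power2_eq_square)
    also have "(exp (- (1 / t)) * (1 / t\<^sup>2) * t ^ k - exp (- (1 / t)) * (k * t ^ (k - 1))) / (t ^ k * t ^ k) =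
      exp_bump (k + 2) t - k * exp_bump (k + 1) t"
      using 1 by (cases k) (auto simp: exp_bump_def field_simps power2_eq_square)
    finally show ?thesis
      by (rule has_field_derivative_transform_within[where d=t])
         (use 1 in \<open>auto simp: exp_bump_def dist_real_def\<close>)
  next
    case 2
    have "((\<lambda>t. 0) has_real_derivative 0) (at t)" by simp
    then have "(exp_bump k has_real_derivative 0) (at t)"
      by (rule has_field_derivative_transform_within[where d="- t"])
         (use 2 in \<open>auto simp: exp_bump_def dist_real_def\<close>)
    then show ?thesis using 2 by (simp add: exp_bump_def)
  next
    case 3
    \<comment> \<open>On the right of 0 the difference quotient is the next member of the family,
      which tends to 0; on the left it is 0.\<close>
    have "((\<lambda>s. exp_bump k s / s) \<longlongrightarrow> 0) (at_right 0)"
    proof (rule Lim_transform_eventually[OF exp_bump_tendsto_0[of "Suc k"]])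
      show "\<forall>\<^sub>F s in at_right 0. exp_bump (Suc k) s = exp_bump k s / s"
        by (auto simp: exp_bump_def)
    qed
    moreover have "((\<lambda>s. exp_bump k s / s) \<longlongrightarrow> 0) (at_left 0)"
    proof (rule Lim_transform_eventually[OF tendsto_const])
      show "\<forall>\<^sub>F s in at_left 0. 0 = exp_bump k s / s"
        using eventually_at_left_real[of "-1" "0::real", simplified] by eventually_elim (simp add: exp_bump_def)
    qed
    ultimately have "((\<lambda>s. exp_bump k s / s) \<longlongrightarrow> 0) (at 0)" by (simp add: filterlim_at_split)
    then show ?thesis using 3 by (simp add: has_field_derivative_iff exp_bump_def)
  qed
qed

lemma frechet_derivative_plus:
  assumes "f differentiable at x" "g differentiable at x"
  shows "frechet_derivative (\<lambda>x. f x + g x) (at x) =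
    (\<lambda>h. frechet_derivative f (at x) h + frechet_derivative g (at x) h)"
  by (rule frechet_derivative_at[symmetric], rule has_derivative_add)
     (use assms in \<open>simp_all add: frechet_derivative_works\<close>)

lemma real_polynomial_function_partial:
  assumes "real_polynomial_function (p :: 'a::real_normed_vector \<Rightarrow> real)"
  shows "\<exists>p'. real_polynomial_function p' \<and> (\<forall>x. p differentiable at x \<and> frechet_derivative p (at x) e = p' x)"
  using assms
proof (induction rule: real_polynomial_function.induct)
  case (linear f)
  then show ?case
    by (intro exI[of _ "\<lambda>_. f e"])
       (auto simp: frechet_derivative_at[OF bounded_linear_imp_has_derivative, symmetric]
         intro: real_polynomial_function.intros bounded_linear_imp_differentiable)
next
  case (const c)
  then show ?case
    by (intro exI[of _ "\<lambda>_. 0"]) (auto intro: real_polynomial_function.intros)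
next
  case (add f g)
  then obtain f' g' where "real_polynomial_function f'" "\<forall>x. f differentiable at x \<and> frechet_derivative f (at x) e = f' x"
    "real_polynomial_function g'" "\<forall>x. g differentiable at x \<and> frechet_derivative g (at x) e = g' x" by auto
  then show ?case
    by (intro exI[of _ "\<lambda>x. f' x + g' x"]) (auto intro: real_polynomial_function.intros(3) simp: frechet_derivative_plus)
next
  case (mult f g)
  then obtain f' g' where fg: "real_polynomial_function f'" "\<forall>x. f differentiable at x \<and> frechet_derivative f (at x) e = f' x"
    "real_polynomial_function g'" "\<forall>x. g differentiable at x \<and> frechet_derivative g (at x) e = g' x" by auto
  have "(\<lambda>x. f x * g x) differentiable at x \<and> frechet_derivative (\<lambda>x. f x * g x) (at x) e = f x * g' x + f' x * g x" for x
  proof -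
    have d: "((\<lambda>x. f x * g x) has_derivative (\<lambda>h. f x * frechet_derivative g (at x) h + frechet_derivative f (at x) h * g x)) (at x)"
      using fg by (intro has_derivative_mult) (auto simp: frechet_derivative_works)
    show ?thesis using fg differentiableI[OF d] by (simp add: frechet_derivative_at[OF d, symmetric])
  qed
  with fg mult.hyps show ?case
    by (intro exI[of _ "\<lambda>x. f x * g' x + f' x * g x"]) (auto intro: real_polynomial_function.intros(3,4))
qed

text \<open>These functions are closed under partial derivatives, which makes them smooth.\<close>

inductive bump_class :: "real^'n::finite \<Rightarrow> real \<Rightarrow> (real^'n \<Rightarrow> real) \<Rightarrow> bool" for a r where
  base: "real_polynomial_function p \<Longrightarrow> bump_class a r (\<lambda>x. p x * exp_bump k (r\<^sup>2 - (norm (x - a))\<^sup>2))"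
| add: "bump_class a r f \<Longrightarrow> bump_class a r f' \<Longrightarrow> bump_class a r (\<lambda>x. f x + f' x)"

text \<open>Differentiating the bump factor multiplies by the polynomial
  \<open>- 2 * ((x - a) $ j)\<close> and raises \<open>k\<close> by one or two; the product rule
  stays within sums of such terms.\<close>

lemma bump_class_partial:
  assumes "bump_class a r f"
  shows "(\<forall>x. f differentiable at x) \<and> bump_class a r (partial j f)"
  using assms
proof induction
  case (base p k)
  let ?e = "axis j 1 :: real^'a"
  let ?u = "\<lambda>x. r\<^sup>2 - (norm (x - a))\<^sup>2"
  obtain p' where p': "real_polynomial_function p'" "\<And>x. p differentiable at x" "\<And>x. frechet_derivative p (at x) ?e = p' x"
    using real_polynomial_function_partial[OF base] by metis
  have u: "(?u has_derivative (\<lambda>h. - 2 * ((x - a) \<bullet> h))) (at x)" for x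
    unfolding power2_norm_eq_inner by (auto intro!: derivative_eq_intros simp: inner_commute)
  have d: "((\<lambda>x. p x * exp_bump k (?u x)) has_derivative
     (\<lambda>h. p x * ((exp_bump (k + 2) (?u x) - k * exp_bump (k + 1) (?u x)) * (- 2 * ((x - a) \<bullet> h)))
        + frechet_derivative p (at x) h * exp_bump k (?u x))) (at x)" for x
  proof (rule has_derivative_mult)
    show "(p has_derivative frechet_derivative p (at x)) (at x)"
      using p'(2) by (simp add: frechet_derivative_works)
    show "((\<lambda>x. exp_bump k (?u x)) has_derivative
       (\<lambda>h. (exp_bump (k + 2) (?u x) - k * exp_bump (k + 1) (?u x)) * (- 2 * ((x - a) \<bullet> h)))) (at x)"
      using has_derivative_compose[OF u exp_bump_has_derivative[THEN has_field_derivative_imp_has_derivative]]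
      by simp
  qed
  let ?q = "\<lambda>x. - 2 * ((x - a) $ j)"
  have q: "real_polynomial_function ?q"
  proof -
    have "bounded_linear (\<lambda>x::real^'a. x $ j)" by (rule bounded_linear_vec_nth)
    then have "real_polynomial_function (\<lambda>x. - 2 * (x $ j + - (a $ j)))"
      by (intro real_polynomial_function.intros)
    then show ?thesis by (simp add: algebra_simps)
  qed
  have pq: "real_polynomial_function (\<lambda>x. p x * ?q x)" "real_polynomial_function (\<lambda>x. (- real k) * (p x * ?q x))"
    by (rule q base real_polynomial_function.intros(4) real_polynomial_function.intros(2))+
  have eq: "partial j (\<lambda>x. p x * exp_bump k (?u x)) =
    (\<lambda>x. ((p x * ?q x) * exp_bump (k + 2) (?u x) + ((- real k) * (p x * ?q x)) * exp_bump (k + 1) (?u x)) + p' x * exp_bump k (?u x))"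
  proof
    fix x
    have e: "(x - a) \<bullet> ?e = (x - a) $ j" by (simp add: inner_axis)
    show "partial j (\<lambda>x. p x * exp_bump k (?u x)) x =
      ((p x * ?q x) * exp_bump (k + 2) (?u x) + ((- real k) * (p x * ?q x)) * exp_bump (k + 1) (?u x)) + p' x * exp_bump k (?u x)"
      unfolding partial_def frechet_derivative_at[OF d, symmetric] p'(3) e
      by (simp add: algebra_simps)
  qed
  show ?case unfolding eq
    by (intro conjI allI bump_class.add bump_class.base pq p'(1)) (use d in \<open>auto intro: differentiableI\<close>)
next
  case (add f f')
  have "partial j (\<lambda>x. f x + f' x) = (\<lambda>x. partial j f x + partial j f' x)"
    using add.IH by (auto simp: partial_def fun_eq_iff frechet_derivative_plus)
  then show ?case using add.IH by (auto intro: bump_class.add)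
qed

text \<open>The witness is the radial bump
  \<open>exp (- (1 / (r\<^sup>2 - (norm (x - a))\<^sup>2)))\<close>, continued by 0 outside the
  ball.\<close>

lemma ex_test_function:
  fixes a :: "real^'n::finite"
  assumes "r > 0" "cball a r \<subseteq> \<Omega>"
  obtains \<psi> where "test_function \<Omega> \<psi>" "\<psi> a > 0" "\<And>x. 0 \<le> \<psi> x" "\<And>x. x \<notin> ball a r \<Longrightarrow> \<psi> x = 0"
    "\<And>x. \<psi> differentiable at x" "\<And>j x. x \<notin> ball a r \<Longrightarrow> partial j \<psi> x = 0" "\<And>j. continuous_on UNIV (partial j \<psi>)"
proof -
  define \<psi> where "\<psi> x = 1 * exp_bump 0 (r\<^sup>2 - (norm (x - a))\<^sup>2)" for x :: "real^'n"
  have b: "bump_class a r \<psi>"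
    unfolding \<psi>_def[abs_def] by (intro bump_class.base real_polynomial_function.intros)
  then have bl: "bump_class a r (foldr partial js \<psi>)" for js
    by (induction js) (auto dest: bump_class_partial)
  have z: "\<psi> x = 0" if "x \<notin> ball a r" for x
  proof -
    have "r\<^sup>2 \<le> (norm (x - a))\<^sup>2"
      using that assms(1) by (intro power_mono) (auto simp: dist_norm norm_minus_commute)
    then show ?thesis by (simp add: \<psi>_def exp_bump_def)
  qed
  then have "{x. \<psi> x \<noteq> 0} \<subseteq> cball a r" using ball_subset_cball by blast
  then have cl: "closure {x. \<psi> x \<noteq> 0} \<subseteq> cball a r" by (simp add: closure_minimal)
  then have "compact (closure {x. \<psi> x \<noteq> 0})"
    by (meson bounded_cball bounded_subset closed_closure compact_eq_bounded_closed)
  moreover have "foldr partial js \<psi> differentiable_on UNIV" for js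
    using bump_class_partial[OF bl] by (auto simp: differentiable_on_def)
  ultimately have "test_function \<Omega> \<psi>"
    using cl assms(2) unfolding test_function_def by blast
  moreover have "continuous_on UNIV (partial j \<psi>)" for j
  proof -
    have "bump_class a r (partial j \<psi>)" using bump_class_partial[OF b] by blast
    then have "\<forall>x. partial j \<psi> differentiable at x" using bump_class_partial by blast
    then show ?thesis
      by (simp add: continuous_at_imp_continuous_on differentiable_imp_continuous_within)
  qed
  moreover have pos: "\<psi> a > 0" "0 \<le> \<psi> x" for x using assms by (auto simp: \<psi>_def exp_bump_def)
  \<comment> \<open>Off the open ball \<open>\<psi>\<close> attains its minimum 0, so its derivative
    vanishes there, the sphere included.\<close>
  moreover have "partial j \<psi> x = 0" if "x \<notin> ball a r" for j x
  proof -
    have "(\<psi> has_derivative frechet_derivative \<psi> (at x)) (at x)"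
      using bump_class_partial[OF b] by (simp add: frechet_derivative_works)
    then have "frechet_derivative \<psi> (at x) = (\<lambda>v. 0)"
      by (rule differential_zero_maxmin[of x UNIV, rotated 2]) (use pos z[OF that] in auto)
    then show ?thesis by (simp add: partial_def)
  qed
  ultimately show ?thesis using that z bump_class_partial[OF b] by blast
qed

section \<open>Continuity of the normal flux across facets\<close>

context barycentric begin

text \<open>Finitely many continuous coordinates stay positive near \<open>x\<close>, where the sign
  of \<open>lam u\<close>, which is opposite to that of \<open>nu u \<bullet> (y - x)\<close>, alone
  decides.\<close>

lemma lam_pos_near:
  assumes u: "u \<in> C" and x: "lam u x = 0" "\<And>w. w \<in> C \<Longrightarrow> w \<noteq> u \<Longrightarrow> lam w x > 0"
  obtains \<epsilon> where "\<epsilon> > 0"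
    "\<And>y w. y \<in> ball x \<epsilon> \<Longrightarrow> w \<in> C \<Longrightarrow> w \<noteq> u \<Longrightarrow> lam w y > 0"
    "\<And>y. y \<in> ball x \<epsilon> \<Longrightarrow> nu u \<bullet> (y - x) < 0 \<Longrightarrow> y \<in> interior K"
    "\<And>y. y \<in> ball x \<epsilon> \<Longrightarrow> nu u \<bullet> (y - x) = 0 \<Longrightarrow> y \<in> fct u"
    "\<And>y. nu u \<bullet> (y - x) > 0 \<Longrightarrow> y \<notin> K"
proof -
  have "{y. \<forall>w\<in>C - {u}. lam w y > 0} = (\<Inter>w\<in>C - {u}. {y. 0 < lam w y})" by auto
  then have "open {y. \<forall>w\<in>C - {u}. lam w y > 0}" using finC
    by (auto simp: lam_def intro!: open_INT open_Collect_less continuous_intros)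
  moreover have "x \<in> {y. \<forall>w\<in>C - {u}. lam w y > 0}" using x by auto
  ultimately obtain \<epsilon> where e: "\<epsilon> > 0" "ball x \<epsilon> \<subseteq> {y. \<forall>w\<in>C - {u}. lam w y > 0}"
    by (meson open_contains_ball)
  have l: "lam u y = - norm (g u) * (nu u \<bullet> (y - x))" for y
    using x(1) by (simp add: lam_nu[OF u] inner_diff_right right_diff_distrib)
  have ng: "norm (g u) > 0" using g_nonzero[OF u] by simp
  show ?thesis
  proof (rule that[OF e(1)])
    show 1: "lam w y > 0" if "y \<in> ball x \<epsilon>" "w \<in> C" "w \<noteq> u" for y w using e that by auto
    show "y \<in> interior K" if "y \<in> ball x \<epsilon>" "nu u \<bullet> (y - x) < 0" for y
    proof -
      have "lam u y > 0" using that(2) ng by (simp add: l mult_less_0_iff)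
      then have "\<forall>w\<in>C. lam w y > 0" using 1[OF that(1)] by metis
      then show ?thesis using lam_pos_interior by blast
    qed
    show "y \<in> fct u" if "y \<in> ball x \<epsilon>" "nu u \<bullet> (y - x) = 0" for y
    proof -
      have "lam u y = 0" using that(2) by (simp add: l)
      then have "0 \<le> lam w y" if "w \<in> C" for w
        using 1[OF \<open>y \<in> ball x \<epsilon>\<close> that] by (cases "w = u") auto
      then show ?thesis using \<open>lam u y = 0\<close> by (auto simp: fct_eq[OF u] K_eq)
    qed
    show "y \<notin> K" if "nu u \<bullet> (y - x) > 0" for y
    proof -
      have "lam u y < 0" using that ng by (simp add: l)
      then show ?thesis using u by (force simp: K_eq)
    qed
  qed
qed

end

text \<open>A point of the facet \<open>F\<close> of \<open>K\<close> near which \<open>K\<close> is a half space.\<close>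

definition facet_core :: "(real^'n::finite) set \<Rightarrow> (real^'n) set \<Rightarrow> real^'n \<Rightarrow> bool" where
  "facet_core K F x \<longleftrightarrow> x \<in> F \<and> (\<exists>\<epsilon>>0.
     (\<forall>y\<in>ball x \<epsilon>. \<forall>F'. F' facet_of K \<longrightarrow> F' \<noteq> F \<longrightarrow> y \<notin> F') \<and>
     (\<forall>y\<in>ball x \<epsilon>. outward_normal K F \<bullet> (y - x) < 0 \<longrightarrow> y \<in> interior K) \<and>
     (\<forall>y\<in>ball x \<epsilon>. outward_normal K F \<bullet> (y - x) = 0 \<longrightarrow> y \<in> F) \<and>
     (\<forall>y. outward_normal K F \<bullet> (y - x) > 0 \<longrightarrow> y \<notin> K))"

text \<open>\<open>facet_core\<close> mentions no coordinates, so it can be used for both elements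
  at a facet; this translates it into signs of the coordinates of one of them.\<close>

lemma (in barycentric) facet_core_iff:
  assumes u: "u \<in> C"
  shows "facet_core K (fct u) x \<longleftrightarrow> lam u x = 0 \<and> (\<forall>w\<in>C. w \<noteq> u \<longrightarrow> lam w x > 0)"
proof
  assume *: "lam u x = 0 \<and> (\<forall>w\<in>C. w \<noteq> u \<longrightarrow> lam w x > 0)"
  obtain \<epsilon> where e: "\<epsilon> > 0"
    "\<And>y w. y \<in> ball x \<epsilon> \<Longrightarrow> w \<in> C \<Longrightarrow> w \<noteq> u \<Longrightarrow> lam w y > 0"
    "\<And>y. y \<in> ball x \<epsilon> \<Longrightarrow> nu u \<bullet> (y - x) < 0 \<Longrightarrow> y \<in> interior K"
    "\<And>y. y \<in> ball x \<epsilon> \<Longrightarrow> nu u \<bullet> (y - x) = 0 \<Longrightarrow> y \<in> fct u"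
    "\<And>y. nu u \<bullet> (y - x) > 0 \<Longrightarrow> y \<notin> K"
    by (rule lam_pos_near[OF u, of x]) (use * in blast)+
  have "y \<notin> F'" if F': "y \<in> ball x \<epsilon>" "F' facet_of K" "F' \<noteq> fct u" for y F'
  proof
    assume "y \<in> F'"
    obtain w where w: "w \<in> C" "F' = fct w" using facets F'(2) by blast
    then have "lam w y = 0" "w \<noteq> u" using \<open>y \<in> F'\<close> that(3) fct_eq by auto
    moreover have "w \<noteq> u \<Longrightarrow> lam w y > 0" using e(2) that(1) w(1) by blast
    ultimately show False by simp
  qed
  moreover have "x \<in> fct u" using e(4)[of x] e(1) by simp
  ultimately show "facet_core K (fct u) x"
    unfolding facet_core_def outward_normal_fct[OF u] using e by blast
next
  assume *: "facet_core K (fct u) x"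
  then obtain \<epsilon> where e: "\<epsilon> > 0" "\<forall>y\<in>ball x \<epsilon>. \<forall>F'. F' facet_of K \<longrightarrow> F' \<noteq> fct u \<longrightarrow> y \<notin> F'" and x: "x \<in> fct u"
    unfolding facet_core_def by blast
  then have e2: "\<And>F'. F' facet_of K \<Longrightarrow> F' \<noteq> fct u \<Longrightarrow> x \<notin> F'" by (metis centre_in_ball)
  have "lam w x > 0" if w: "w \<in> C" "w \<noteq> u" for w
  proof -
    have "x \<notin> fct w" using e2[of "fct w"] inj_fct w u facets by (auto simp: inj_on_def)
    moreover have "x \<in> K" using x fct_eq[OF u] by auto
    ultimately show ?thesis using w by (auto simp: fct_eq[OF w(1)] K_eq order_less_le)
  qed
  then show "lam u x = 0 \<and> (\<forall>w\<in>C. w \<noteq> u \<longrightarrow> lam w x > 0)" using x fct_eq[OF u] by auto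
qed

text \<open>The third claim moves a core point towards any point of the facet: the other coordinates
  stay positive, because the core point keeps the positive weight \<open>1 - t\<close>.\<close>

lemma simplex_facet:
  fixes K :: "(real^'n::finite) set"
  assumes "int CARD('n) simplex K" "F facet_of K"
  shows "flat_facet (outward_normal K F) F" "\<exists>x. facet_core K F x"
    and "facet_core K F x \<Longrightarrow> y \<in> F \<Longrightarrow> 0 \<le> t \<Longrightarrow> t < 1 \<Longrightarrow> facet_core K F (x + t *\<^sub>R (y - x))"
    and "F \<subseteq> K" "finite {F. F facet_of K}"
proof -
  obtain C g b where "barycentric K C g b" using simplex_barycentric[OF assms(1)] .
  then interpret barycentric K C g b .
  obtain u where u: "u \<in> C" "F = fct u" using facets assms(2) by blast
  show "flat_facet (outward_normal K F) F" using u flat_facet_fct outward_normal_fct by simp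
  show "\<exists>x. facet_core K F x"
    using fct_strict_point[OF u(1)] unfolding u(2) facet_core_iff[OF u(1)] by (auto simp: fct_eq[OF u(1)])
  show "F \<subseteq> K" using u fct_eq by auto
  show "finite {F. F facet_of K}" using facets_image finC by simp
  assume x: "facet_core K F x" and y: "y \<in> F" and t: "0 \<le> t" "t < 1"
  have l0: "lam u y = 0" "\<And>w. w \<in> C \<Longrightarrow> 0 \<le> lam w y" using y u fct_eq by (auto simp: K_eq)
  have "lam w (x + t *\<^sub>R (y - x)) > 0" if w: "w \<in> C" "w \<noteq> u" for w
  proof -
    have "lam w x > 0" using x w unfolding u(2) facet_core_iff[OF u(1)] by auto
    then have "(1 - t) * lam w x > 0" using t by simp
    moreover have "t * lam w y \<ge> 0" using t l0(2)[OF w(1)] by simp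
    ultimately show ?thesis unfolding lam_line by (simp add: algebra_simps)
  qed
  moreover have "lam u x = 0" using x unfolding u(2) facet_core_iff[OF u(1)] by auto
  ultimately show "facet_core K F (x + t *\<^sub>R (y - x))"
    unfolding u(2) facet_core_iff[OF u(1)] using l0 by (simp add: lam_line)
qed

lemma simplex_body:
  fixes K :: "(real^'n::finite) set"
  assumes "int CARD('n) simplex K"
  shows "compact K" "convex K" "interior K \<noteq> {}" "K \<noteq> {}" "closure (interior K) = K" "negligible (frontier K)"
proof -
  obtain C g b where "barycentric K C g b" using simplex_barycentric[OF assms(1)] .
  then interpret barycentric K C g b .
  show *: "compact K" "convex K" "interior K \<noteq> {}" using compact_K convex_K interior_nonempty by auto
  then show "K \<noteq> {}" by auto
  show "closure (interior K) = K" using convex_closure_interior[OF *(2,3)] *(1) by (simp add: compact_imp_closed)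
  show "negligible (frontier K)" using *(2) by (rule negligible_convex_frontier)
qed

section \<open>Neighbors in a conforming mesh\<close>

locale tent_mesh =
  fixes \<Omega> :: "(real^'n::finite) set" and \<H> :: "(real^'n) set set"
  assumes mesh: "conforming_mesh \<Omega> \<H>" and open_Omega: "open \<Omega>"
begin

lemma elem: "K \<in> \<H> \<Longrightarrow> int CARD('n) simplex K"
  and finite_mesh: "finite \<H>"
  and Union_mesh: "\<Union>\<H> = closure \<Omega>"
  and interior_elem: "K \<in> \<H> \<Longrightarrow> interior K \<subseteq> \<Omega>"
  and Int_face: "K \<in> \<H> \<Longrightarrow> K' \<in> \<H> \<Longrightarrow> (K \<inter> K') face_of K"
  using mesh by (auto simp: conforming_mesh_def triangulation_def)

lemma elem_subset_closure: "K \<in> \<H> \<Longrightarrow> K \<subseteq> closure \<Omega>"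
  using Union_mesh by blast

text \<open>If the interior of an element meets another element, their intersection is a face
  through a relative interior point, hence the whole element. The inclusion then also holds in the
  other direction.\<close>

lemma interior_disjoint:
  assumes K: "K \<in> \<H>" "K' \<in> \<H>" "K \<noteq> K'" shows "interior K \<inter> K' = {}"
proof (rule ccontr)
  have sub: "A \<subseteq> B" if "A \<in> \<H>" "B \<in> \<H>" "interior A \<inter> B \<noteq> {}" for A B
  proof -
    have "rel_interior A = interior A"
      using simplex_body[OF elem[OF that(1)]] interior_rel_interior_gen rel_interior_nonempty_interior by blast
    moreover have "interior A \<inter> B \<subseteq> A \<inter> B" using interior_subset by blast
    ultimately have "A \<subseteq> A \<inter> B"
      using that by (intro subset_of_face_of[OF Int_face[OF that(1,2)]]) auto
    then show ?thesis by simp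
  qed
  assume "interior K \<inter> K' \<noteq> {}"
  then have 1: "K \<subseteq> K'" using sub K by blast
  then have "interior K' \<inter> K \<noteq> {}"
    using interior_mono[OF 1] interior_subset[of K] simplex_body(3)[OF elem[OF K(1)]] by blast
  then have "K' \<subseteq> K" using sub K by blast
  with 1 K(3) show False by simp
qed

text \<open>Both are unit normals of one hyperplane, so they agree up to sign. With equal signs,
  points just behind a common core point would lie in both interiors.\<close>

lemma outward_normal_neighbor:
  assumes K: "K \<in> \<H>" "K' \<in> \<H>" "K \<noteq> K'" and F: "F facet_of K" "F facet_of K'"
  shows "outward_normal K' F = - outward_normal K F"
    and "\<exists>x. facet_core K F x \<and> facet_core K' F x"
proof -
  let ?n = "outward_normal K F" and ?n' = "outward_normal K' F"
  note s = simplex_facet[OF elem[OF K(1)] F(1)] and s' = simplex_facet[OF elem[OF K(2)] F(2)]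
  obtain c where c: "norm ?n = 1" "affine hull F = {x. ?n \<bullet> x = c}" using s(1) by (auto simp: flat_facet_def)
  obtain c' where c': "norm ?n' = 1" "affine hull F = {x. ?n' \<bullet> x = c'}" using s'(1) by (auto simp: flat_facet_def)
  obtain x1 where x1: "facet_core K F x1" using s(2) by blast
  obtain x2 where x2: "facet_core K' F x2" using s'(2) by blast
  have xF: "x1 \<in> F" "x2 \<in> F" using x1 x2 by (auto simp: facet_core_def)
  \<comment> \<open>The midpoint of a core point for \<open>K\<close> and one for \<open>K'\<close>
    is a core point for both.\<close>
  define x where "x = x1 + (1/2) *\<^sub>R (x2 - x1)"
  have "x = x2 + (1/2) *\<^sub>R (x1 - x2)" by (simp add: x_def algebra_simps scaleR_left_distrib[symmetric])
  then have cx: "facet_core K F x" "facet_core K' F x"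
    using s(3)[OF x1 xF(2), of "1/2"] s'(3)[OF x2 xF(1), of "1/2"] by (auto simp: x_def)
  then show "\<exists>x. facet_core K F x \<and> facet_core K' F x" by blast
  obtain e where e: "e > 0" "\<And>y. y \<in> ball x e \<Longrightarrow> ?n \<bullet> (y - x) < 0 \<Longrightarrow> y \<in> interior K"
    using cx(1) unfolding facet_core_def by blast
  obtain e' where e': "e' > 0" "\<And>y. y \<in> ball x e' \<Longrightarrow> ?n' \<bullet> (y - x) < 0 \<Longrightarrow> y \<in> interior K'"
    using cx(2) unfolding facet_core_def by blast
  have xa: "?n \<bullet> x = c" "?n' \<bullet> x = c'"
    using hull_inc[of x F affine] cx c c' by (auto simp: facet_core_def)
  have nn: "?n \<bullet> ?n = 1" "?n' \<bullet> ?n' = 1" using c c' by (auto simp: dot_square_norm)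
  \<comment> \<open>\<open>?p\<close> is the part of the second normal that is tangential to the
    hyperplane of \<open>F\<close>, and has to vanish.\<close>
  let ?p = "?n' - (?n \<bullet> ?n') *\<^sub>R ?n"
  have "x + ?p \<in> affine hull F" unfolding c(2) by (simp add: inner_add_right inner_diff_right xa nn)
  then have "?n' \<bullet> ?p = 0" unfolding c'(2) by (simp add: inner_add_right xa)
  then have sq: "(?n \<bullet> ?n')\<^sup>2 = 1" by (simp add: inner_diff_right nn power2_eq_square inner_commute)
  have "?p \<bullet> ?p = 1 - (?n \<bullet> ?n')\<^sup>2"
    by (simp add: inner_diff_right inner_diff_left nn power2_eq_square inner_commute)
  then have p0: "?n' = (?n \<bullet> ?n') *\<^sub>R ?n" using sq by simp
  have "?n \<bullet> ?n' \<noteq> 1"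
  proof
    assume "?n \<bullet> ?n' = 1"
    then have eq: "?n' = ?n" using p0 by simp
    define d where "d = min e e' / 2"
    have d: "d > 0" "d < e" "d < e'" using e(1) e'(1) by (auto simp: d_def)
    let ?y = "x - d *\<^sub>R ?n"
    have "?y \<in> ball x e" "?y \<in> ball x e'" "?n \<bullet> (?y - x) < 0"
      using d c(1) nn by (auto simp: dist_norm)
    then have "?y \<in> interior K" "?y \<in> interior K'" using e e' eq by auto
    then show False using interior_disjoint[OF K] interior_subset by blast
  qed
  then have "?n \<bullet> ?n' = -1" using sq by (simp add: power2_eq_1_iff)
  then show "?n' = - ?n" using p0 by simp
qed

text \<open>Three elements at one facet would have pairwise opposite unit normals.\<close>

lemma neighbor_unique:
  assumes "K \<in> \<H>" "K' \<in> \<H>" "K'' \<in> \<H>" "K \<noteq> K'" "K \<noteq> K''"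
    and F: "F facet_of K" "F facet_of K'" "F facet_of K''"
  shows "K' = K''"
proof (rule ccontr)
  assume "K' \<noteq> K''"
  then have "outward_normal K F = - outward_normal K F"
    using outward_normal_neighbor(1)[of K K' F] outward_normal_neighbor(1)[of K K'' F]
      outward_normal_neighbor(1)[of K' K'' F] assms by simp
  then have "outward_normal K F + outward_normal K F = 0" by (metis eq_neg_iff_add_eq_0)
  then have "2 *\<^sub>R outward_normal K F = 0" by (simp only: scaleR_2)
  then show False using simplex_facet(1)[OF elem[OF assms(1)] F(1)] by (auto simp: flat_facet_def)
qed

text \<open>A point \<open>y\<close> of the facet off the frontier lies in the open set
  \<open>\<Omega>\<close>, and so does the segment from \<open>z\<close> close to \<open>y\<close>.
  Stating the point through \<open>y\<close> and \<open>t\<close> allows it to be recognized as a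
  core point of both neighbors.\<close>

lemma facet_core_in_Omega:
  assumes K: "K \<in> \<H>" and F: "F facet_of K" "\<not> F \<subseteq> frontier \<Omega>" and z: "facet_core K F z"
  shows "\<exists>y\<in>F. \<exists>t. 0 \<le> t \<and> t < 1 \<and> z + t *\<^sub>R (y - z) \<in> \<Omega>"
proof -
  obtain y where y: "y \<in> F" "y \<notin> frontier \<Omega>" using F(2) by blast
  have "y \<in> closure \<Omega>" using y simplex_facet(4)[OF elem[OF K] F(1)] elem_subset_closure[OF K] by blast
  then have yO: "y \<in> \<Omega>" using y open_Omega by (simp add: frontier_def interior_open)
  have "((\<lambda>t. z + t *\<^sub>R (y - z)) \<longlongrightarrow> z + 1 *\<^sub>R (y - z)) (at_left 1)"
    by (intro tendsto_intros)
  then have "\<forall>\<^sub>F t in at_left 1. z + t *\<^sub>R (y - z) \<in> \<Omega>"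
    using topological_tendstoD[OF _ open_Omega] yO by fastforce
  moreover have "\<forall>\<^sub>F t in at_left (1::real). t \<in> {0<..<1}" by (rule eventually_at_left_real) simp
  ultimately have "\<forall>\<^sub>F t in at_left 1. 0 \<le> t \<and> t < 1 \<and> z + t *\<^sub>R (y - z) \<in> \<Omega>"
    by eventually_elim auto
  then show ?thesis using y(1) eventually_happens' trivial_limit_at_left_real by blast
qed

text \<open>Around a core point inside \<open>\<Omega>\<close>, the points just across the facet are
  covered by the mesh but not by \<open>K\<close>; so a second element contains the core point, and
  its intersection with \<open>K\<close> is the facet.\<close>

lemma neighbor_exists:
  assumes K: "K \<in> \<H>" and F: "F facet_of K" "\<not> F \<subseteq> frontier \<Omega>"
  shows "\<exists>K'\<in>\<H>. K' \<noteq> K \<and> F facet_of K'"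
proof -
  let ?n = "outward_normal K F"
  note s = simplex_facet[OF elem[OF K] F(1)]
  obtain z where z: "facet_core K F z" using s(2) by blast
  obtain y t where "y \<in> F" "0 \<le> t" "t < 1" "z + t *\<^sub>R (y - z) \<in> \<Omega>"
    using facet_core_in_Omega[OF K F z] by blast
  then obtain x where x: "facet_core K F x" "x \<in> \<Omega>" using s(3)[OF z] by blast
  obtain e where e: "e > 0" "\<And>y. y \<in> ball x e \<Longrightarrow> ?n \<bullet> (y - x) = 0 \<Longrightarrow> y \<in> F"
    "\<And>y. ?n \<bullet> (y - x) > 0 \<Longrightarrow> y \<notin> K"
    using x(1) unfolding facet_core_def by blast
  have xF: "x \<in> F" using x by (auto simp: facet_core_def)
  obtain c where c: "norm ?n = 1" "affine hull F = {x. ?n \<bullet> x = c}" using s(1) by (auto simp: flat_facet_def)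
  have nn: "?n \<bullet> ?n = 1" using c by (auto simp: dot_square_norm)
  have xc: "?n \<bullet> x = c" using hull_inc[OF xF, of affine] c by auto
  \<comment> \<open>Otherwise a ball around \<open>x\<close> avoids all other elements, which form a
    closed set, and its points beyond the facet would be uncovered.\<close>
  have "\<exists>K'\<in>\<H>. K' \<noteq> K \<and> x \<in> K'"
  proof (rule ccontr)
    assume no: "\<not> ?thesis"
    have "closed (\<Union>(\<H> - {K}))"
      using finite_mesh elem simplex_body(1) by (intro closed_Union) (auto intro: compact_imp_closed)
    then have "open (\<Omega> - \<Union>(\<H> - {K}))" using open_Omega by (rule open_Diff[rotated])
    moreover have "x \<in> \<Omega> - \<Union>(\<H> - {K})" using x no by blast
    ultimately obtain d where d: "d > 0" "ball x d \<subseteq> \<Omega> - \<Union>(\<H> - {K})" by (meson open_contains_ball)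
    let ?y = "x + (d/2) *\<^sub>R ?n"
    have "?y \<in> ball x d" using d c by (simp add: dist_norm)
    then have "?y \<in> \<Omega>" "?y \<notin> \<Union>(\<H> - {K})" using d by blast+
    moreover have "\<Omega> \<subseteq> \<Union>\<H>" using Union_mesh closure_subset by blast
    ultimately have "?y \<in> K" by blast
    moreover have "?n \<bullet> (?y - x) > 0" using d nn by simp
    ultimately show False using e(3) by blast
  qed
  then obtain K' where K': "K' \<in> \<H>" "K' \<noteq> K" "x \<in> K'" by blast
  define T where "T = K \<inter> K'"
  have T: "T face_of K" "T face_of K'"
    using Int_face[OF K K'(1)] Int_face[OF K'(1) K] by (auto simp: T_def Int_commute)
  \<comment> \<open>A face that contains a relative interior point of \<open>F\<close> contains
    \<open>F\<close>.\<close>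
  have "x \<in> rel_interior F"
    unfolding mem_rel_interior_ball using xF e(1,2) by (auto simp: c(2) inner_diff_right xc intro!: exI[of _ e])
  then have FT: "F \<subseteq> T"
    using subset_of_face_of[OF T(1) s(4)] xF s(4) K'(3) by (auto simp: T_def)
  have TK: "T \<noteq> K"
  proof
    assume "T = K"
    then have "K \<subseteq> K'" by (auto simp: T_def)
    then show False
      using interior_disjoint[OF K K'(1)] K'(2) simplex_body(3)[OF elem[OF K]] interior_subset[of K] by blast
  qed
  have dimT: "aff_dim T < aff_dim K"
    by (rule face_of_aff_dim_lt[OF simplex_body(2)[OF elem[OF K]] T(1) TK])
  have FfT: "F face_of T"
    using face_of_subset[of F K T] F(1) FT T by (auto simp: facet_of_def face_of_imp_subset)
  \<comment> \<open>\<open>F\<close> has codimension one in \<open>K\<close>, so no dimension is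
    left for a proper face \<open>T\<close> of \<open>K\<close> that properly contains
    \<open>F\<close> as a face.\<close>
  have "F = T"
  proof (rule ccontr)
    assume "F \<noteq> T"
    then have "aff_dim F < aff_dim T"
      using face_of_aff_dim_lt[OF face_of_imp_convex[OF T(1)] FfT] by (simp add: simplex_body(2)[OF elem[OF K]])
    then show False using F(1) dimT by (simp add: facet_of_def)
  qed
  moreover have "aff_dim K = aff_dim K'"
    using simplex_body(3)[OF elem[OF K]] simplex_body(3)[OF elem[OF K'(1)]] by (simp add: aff_dim_nonempty_interior)
  ultimately have "F facet_of K'" using T(2) F(1) by (auto simp: facet_of_def)
  then show ?thesis using K' by blast
qed

end

text \<open>No measurability is assumed: Lebesgue measure being complete, functions that agree
  almost everywhere are both measurable or both not, and in the latter case both integrals are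
  0.\<close>

lemma integral_lebesgue_spike:
  fixes f g :: "'a::euclidean_space \<Rightarrow> 'b::{banach, second_countable_topology}"
  assumes "AE x in lebesgue. f x = g x"
  shows "(LINT x|lebesgue. f x) = (LINT x|lebesgue. g x)"
proof -
  have meas: "h \<in> borel_measurable lebesgue" if "k \<in> borel_measurable lebesgue" "AE x in lebesgue. k x = h x"
    for h k :: "'a \<Rightarrow> 'b"
  proof (rule measurableI)
    fix A :: "'b set" assume "A \<in> sets borel"
    then have "k -` A \<inter> space lebesgue \<in> sets lebesgue" using that(1) by (rule measurable_sets[rotated])
    moreover have "AE x in lebesgue. x \<in> k -` A \<inter> space lebesgue \<longleftrightarrow> x \<in> h -` A \<inter> space lebesgue"
      using that(2) by eventually_elim simp
    ultimately show "h -` A \<inter> space lebesgue \<in> sets lebesgue"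
      using completion.in_sets_AE by blast
  qed simp
  show ?thesis
  proof (cases "f \<in> borel_measurable lebesgue")
    case True
    then show ?thesis using meas[OF True assms] assms by (rule integral_cong_AE)
  next
    case False
    then have "g \<notin> borel_measurable lebesgue" using meas[of g f] assms by (auto simp: eq_commute)
    then have "\<not> integrable lebesgue f" "\<not> integrable lebesgue g"
      using False borel_measurable_integrable by blast+
    then show ?thesis by (simp add: not_integrable_integral_eq)
  qed
qed

lemma facet_coreE:
  assumes "facet_core K F x"
  obtains \<epsilon> where "x \<in> F" "\<epsilon> > 0"
    "\<And>y F'. y \<in> ball x \<epsilon> \<Longrightarrow> F' facet_of K \<Longrightarrow> F' \<noteq> F \<Longrightarrow> y \<notin> F'"
    "\<And>y. y \<in> ball x \<epsilon> \<Longrightarrow> outward_normal K F \<bullet> (y - x) < 0 \<Longrightarrow> y \<in> interior K"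
    "\<And>y. y \<in> ball x \<epsilon> \<Longrightarrow> outward_normal K F \<bullet> (y - x) = 0 \<Longrightarrow> y \<in> F"
    "\<And>y. outward_normal K F \<bullet> (y - x) > 0 \<Longrightarrow> y \<notin> K"
proof -
  from assms obtain \<epsilon> where 1: "x \<in> F" "\<epsilon> > 0"
    and 2: "\<forall>y\<in>ball x \<epsilon>. \<forall>F'. F' facet_of K \<longrightarrow> F' \<noteq> F \<longrightarrow> y \<notin> F'"
    and 3: "\<forall>y\<in>ball x \<epsilon>. outward_normal K F \<bullet> (y - x) < 0 \<longrightarrow> y \<in> interior K"
    and 4: "\<forall>y\<in>ball x \<epsilon>. outward_normal K F \<bullet> (y - x) = 0 \<longrightarrow> y \<in> F"
    and 5: "\<forall>y. outward_normal K F \<bullet> (y - x) > 0 \<longrightarrow> y \<notin> K"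
    unfolding facet_core_def by (elim conjE exE)
  show ?thesis
    by (rule that[OF 1 2[rule_format] 3[rule_format] 4[rule_format] 5[rule_format]])
qed

lemma divergence_simplex:
  fixes K :: "(real^'n::finite) set"
  assumes "int CARD('n) simplex K"
    and f: "\<And>x. f differentiable at x" "continuous_on UNIV (partial j f)"
  shows "(LINT x:K|lebesgue. partial j f x) =
    (\<Sum>F | F facet_of K. (outward_normal K F $ j) * facet_integral (outward_normal K F) F f)"
proof -
  obtain C g b where "barycentric K C g b" using simplex_barycentric[OF assms(1)] .
  then interpret barycentric K C g b .
  have "((\<lambda>s. f (x + s *\<^sub>R axis j 1)) has_real_derivative partial j f x) (at 0)" for x
  proof -
    have 1: "((\<lambda>s::real. x + s *\<^sub>R axis j 1) has_derivative (\<lambda>s. s *\<^sub>R axis j 1)) (at 0)"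
      by (auto intro!: derivative_eq_intros)
    have 2: "(f has_derivative frechet_derivative f (at x)) (at (x + (0::real) *\<^sub>R axis j 1))"
      using f(1) by (simp add: frechet_derivative_works)
    have "frechet_derivative f (at x) (s *\<^sub>R axis j 1) = s *\<^sub>R frechet_derivative f (at x) (axis j 1)" for s
      using f(1) by (intro linear_scale linear_frechet_derivative)
    then show ?thesis
      using has_derivative_compose[OF 1 2] by (simp add: has_field_derivative_def partial_def mult_commute_abs)
  qed
  then show ?thesis
    using divergence[of f "partial j f" "axis j 1"] f
    by (simp add: continuous_at_imp_continuous_on differentiable_imp_continuous_within inner_axis)
qed

lemma facet_integral_zero:
  assumes "flat_facet n F" "\<And>x. x \<in> F \<Longrightarrow> f x = 0"
  shows "facet_integral n F f = 0"
proof -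
  have "facet_integral n F f = facet_integral n F (\<lambda>x. 0 * f x)"
    by (rule facet_integral_cong[OF assms(1)]) (simp add: assms(2))
  then show ?thesis using facet_integral_cmult[OF assms(1), of 0 f] by simp
qed

context tent_mesh begin

text \<open>For bumps that reach only one facet of the element.\<close>

lemma divergence_one_facet:
  assumes K: "K \<in> \<H>" and F: "F facet_of K"
    and f: "\<And>x. f differentiable at x" "continuous_on UNIV (partial j f)"
    and zero: "\<And>F' x. F' facet_of K \<Longrightarrow> F' \<noteq> F \<Longrightarrow> x \<in> F' \<Longrightarrow> f x = 0"
  shows "(LINT x:K|lebesgue. partial j f x) = outward_normal K F $ j * facet_integral (outward_normal K F) F f"
proof -
  have "(LINT x:K|lebesgue. partial j f x) =
    (\<Sum>F' | F' facet_of K. outward_normal K F' $ j * facet_integral (outward_normal K F') F' f)"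
    by (rule divergence_simplex[OF elem[OF K] f])
  also have "\<dots> = (\<Sum>F' | F' facet_of K. if F' = F then outward_normal K F $ j * facet_integral (outward_normal K F) F f else 0)"
    using facet_integral_zero[OF simplex_facet(1)[OF elem[OF K]] zero] by (intro sum.cong refl) auto
  finally show ?thesis using F simplex_facet(5)[OF elem[OF K] F] by simp
qed

text \<open>A bump around a core point of \<open>F\<close> in \<open>\<Omega>\<close> sees only
  \<open>K\<close> and \<open>K'\<close>, where \<open>L\<close> is constant. The divergence theorem
  on both turns the distributional equation into the facet integral of the bump, which is positive,
  times the jump of the normal flux.\<close>

lemma flux_single_valued:
  fixes L :: "'n \<Rightarrow> real^'n \<Rightarrow> real^'l^'l::finite"
  assumes L_const: "\<And>K j. K \<in> \<H> \<Longrightarrow> L j constant_on interior K"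
    and L_div: "distributional_div_zero \<Omega> L"
    and K: "K \<in> \<H>" "K' \<in> \<H>" "K \<noteq> K'" and F: "F facet_of K" "F facet_of K'" "\<not> F \<subseteq> frontier \<Omega>"
    and y: "y \<in> interior K" "y' \<in> interior K'"
  shows "flux_matrix L (outward_normal K F) y = flux_matrix L (outward_normal K F) y'"
proof -
  let ?n = "outward_normal K F"
  note s = simplex_facet[OF elem[OF K(1)] F(1)] and s' = simplex_facet[OF elem[OF K(2)] F(2)]
  note nb = outward_normal_neighbor[OF K F(1,2)]
  obtain z where z: "facet_core K F z" "facet_core K' F z" using nb(2) by blast
  obtain x0 t where "x0 \<in> F" "0 \<le> t" "t < 1" "z + t *\<^sub>R (x0 - z) \<in> \<Omega>"
    using facet_core_in_Omega[OF K(1) F(1,3) z(1)] by blast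
  note zt = this
  define x where "x = z + t *\<^sub>R (x0 - z)"
  have x: "facet_core K F x" "facet_core K' F x" "x \<in> \<Omega>"
    using s(3)[OF z(1) zt(1-3)] s'(3)[OF z(2) zt(1-3)] zt(4) by (auto simp: x_def)
  have xF: "x \<in> F" using x by (auto simp: facet_core_def)
  obtain e1 where e1: "e1 > 0" "\<And>y F'. y \<in> ball x e1 \<Longrightarrow> F' facet_of K \<Longrightarrow> F' \<noteq> F \<Longrightarrow> y \<notin> F'"
    "\<And>y. y \<in> ball x e1 \<Longrightarrow> ?n \<bullet> (y - x) < 0 \<Longrightarrow> y \<in> interior K"
    "\<And>y. y \<in> ball x e1 \<Longrightarrow> ?n \<bullet> (y - x) = 0 \<Longrightarrow> y \<in> F"
    using facet_coreE[OF x(1)] by metis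
  obtain e2 where e2: "e2 > 0" "\<And>y F'. y \<in> ball x e2 \<Longrightarrow> F' facet_of K' \<Longrightarrow> F' \<noteq> F \<Longrightarrow> y \<notin> F'"
    "\<And>y. y \<in> ball x e2 \<Longrightarrow> - ?n \<bullet> (y - x) < 0 \<Longrightarrow> y \<in> interior K'"
    using facet_coreE[OF x(2), unfolded nb(1)] by metis
  obtain e3 where e3: "e3 > 0" "ball x e3 \<subseteq> \<Omega>" using x(3) open_Omega by (meson open_contains_ball)
  define r where "r = min e1 (min e2 e3) / 2"
  have r: "r > 0" "r < e1" "r < e2" "r < e3" using e1(1) e2(1) e3(1) by (auto simp: r_def)
  have "cball x r \<subseteq> \<Omega>" using r e3 by (auto simp: subset_iff)
  then obtain \<psi> where \<psi>: "test_function \<Omega> \<psi>" "\<psi> x > 0" "\<And>y. 0 \<le> \<psi> y" "\<And>y. y \<notin> ball x r \<Longrightarrow> \<psi> y = 0"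
    "\<And>y. \<psi> differentiable at y" "\<And>j y. y \<notin> ball x r \<Longrightarrow> partial j \<psi> y = 0" "\<And>j. continuous_on UNIV (partial j \<psi>)"
    using ex_test_function[OF r(1)] by metis
  have c\<psi>: "continuous_on UNIV \<psi>"
    by (simp add: continuous_at_imp_continuous_on differentiable_imp_continuous_within \<psi>(5))
  have ball: "w \<in> ball x e1 \<and> w \<in> ball x e2 \<and> w \<in> ball x e3" if "w \<in> ball x r" for w
    using that r by auto
  let ?I = "facet_integral ?n F \<psi>"
  have fl: "flat_facet ?n F" by (rule s(1))
  have I_K: "(LINT w:K|lebesgue. partial j \<psi> w) = ?n $ j * ?I" for j
    using e1(2) ball \<psi>(4) by (intro divergence_one_facet[OF K(1) F(1) \<psi>(5,7)]) blast
  have I_K': "(LINT w:K'|lebesgue. partial j \<psi> w) = - (?n $ j * ?I)" for j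
  proof -
    have "facet_integral (- ?n) F \<psi> = ?I"
      using fl c\<psi> by (intro facet_integral_uminus_normal bounded_borel_support_compact) (auto simp: flat_facet_def)
    moreover have "(LINT w:K'|lebesgue. partial j \<psi> w) = outward_normal K' F $ j * facet_integral (outward_normal K' F) F \<psi>"
      using e2(2) ball \<psi>(4) by (intro divergence_one_facet[OF K(2) F(2) \<psi>(5,7)]) blast
    ultimately show ?thesis by (simp add: nb(1))
  qed
  have Lc: "L j w = L j y" if "w \<in> interior K" for j w using L_const[OF K(1), of j] y(1) that by (auto simp: constant_on_def)
  have Lc': "L j w = L j y'" if "w \<in> interior K'" for j w using L_const[OF K(2), of j] y(2) that by (auto simp: constant_on_def)
  have int: "integrable lebesgue (\<lambda>w. indicator Q w * partial j \<psi> w)" if "compact Q" for Q j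
    using bounded_borel_support_compact[OF that \<psi>(7)]
    by (intro integrable_completion[THEN iffD2]) (auto intro: integrable_bounded_borel_support simp: bounded_borel_support_def)
  have "(LINT w:\<Omega>|lebesgue. partial j \<psi> w *\<^sub>R L j w) = (?n $ j * ?I) *\<^sub>R L j y - (?n $ j * ?I) *\<^sub>R L j y'" for j
  proof -
    have fr: "AE w in lebesgue. w \<notin> frontier K" "AE w in lebesgue. w \<notin> frontier K'"
      using simplex_body(6)[OF elem[OF K(1)]] simplex_body(6)[OF elem[OF K(2)]]
      by (auto simp: negligible_iff_null_sets intro: AE_not_in)
    have "(LINT w:\<Omega>|lebesgue. partial j \<psi> w *\<^sub>R L j w) =
      (LINT w|lebesgue. (indicator K w * partial j \<psi> w) *\<^sub>R L j y + (indicator K' w * partial j \<psi> w) *\<^sub>R L j y')"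
      unfolding set_lebesgue_integral_def
    proof (rule integral_lebesgue_spike, use fr in eventually_elim)
      case (elim w)
      have K_int: "w \<in> K \<longleftrightarrow> w \<in> interior K" "w \<in> K' \<longleftrightarrow> w \<in> interior K'"
        using elim interior_subset by (auto simp: frontier_def closure_closed compact_imp_closed simplex_body(1) elem K)
      have disj: "\<not> (w \<in> K \<and> w \<in> K')" using K_int interior_disjoint[OF K] by blast
      show ?case
      proof (cases "w \<in> ball x r")
        case True
        \<comment> \<open>The hyperplane of \<open>F\<close> cuts the ball into a part in
          \<open>K\<close>, a part in \<open>K'\<close>, and a part in \<open>F\<close>.\<close>
        have "w \<in> K \<or> w \<in> K'"
        proof (cases "?n \<bullet> (w - x)" "0::real" rule: linorder_cases)
          case less
          then show ?thesis using e1(3) ball[OF True] K_int by blast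
        next
          case equal
          then show ?thesis using e1(4) ball[OF True] s(4) by blast
        next
          case greater
          then show ?thesis using e2(3)[of w] ball[OF True] K_int by auto
        qed
        moreover have "w \<in> \<Omega>" using ball[OF True] e3 by blast
        ultimately show ?thesis using disj K_int Lc Lc' by (auto simp: indicator_def)
      qed (simp add: \<psi>(6))
    qed
    also have "\<dots> = (LINT w|lebesgue. indicator K w * partial j \<psi> w) *\<^sub>R L j y + (LINT w|lebesgue. indicator K' w * partial j \<psi> w) *\<^sub>R L j y'"
      using int simplex_body(1)[OF elem[OF K(1)]] simplex_body(1)[OF elem[OF K(2)]] by simp
    finally show ?thesis using I_K[of j] I_K'[of j] by (simp add: set_lebesgue_integral_def)
  qed
  then have "(\<Sum>j\<in>UNIV. (?n $ j * ?I) *\<^sub>R L j y - (?n $ j * ?I) *\<^sub>R L j y') = 0"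
    using L_div \<psi>(1) unfolding distributional_div_zero_def by (metis (no_types, lifting) sum.cong)
  then have "?I *\<^sub>R (flux_matrix L ?n y - flux_matrix L ?n y') = 0"
    by (simp add: flux_matrix_def scaleR_diff_right scaleR_sum_right sum_subtractf mult.commute)
  moreover have "?I > 0"
  proof (rule facet_integral_pos[OF fl c\<psi> \<psi>(3) xF \<psi>(2) e1(1)])
    obtain c where c: "affine hull F = {x. ?n \<bullet> x = c}" using fl by (auto simp: flat_facet_def)
    have "?n \<bullet> x = c" using hull_inc[OF xF, of affine] c by auto
    then show "ball x e1 \<inter> affine hull F \<subseteq> F" using e1(4) c by (auto simp: inner_diff_right)
  qed
  ultimately show ?thesis by simp
qed

end

section \<open>Stability in an abstract inner product space of functions\<close>

text \<open>Function types are not instances of the vector space classes, so combinations are written pointwise.\<close>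

locale fun_inner =
  fixes V :: "('a \<Rightarrow> 'b::real_vector) set" and ip :: "('a \<Rightarrow> 'b) \<Rightarrow> ('a \<Rightarrow> 'b) \<Rightarrow> real"
  assumes zero_mem: "(\<lambda>x. 0) \<in> V"
    and comb_mem: "w \<in> V \<Longrightarrow> z \<in> V \<Longrightarrow> (\<lambda>x. a *\<^sub>R w x + z x) \<in> V"
    and ip_comb: "w \<in> V \<Longrightarrow> z \<in> V \<Longrightarrow> u \<in> V \<Longrightarrow> ip (\<lambda>x. a *\<^sub>R w x + z x) u = a * ip w u + ip z u"
    and ip_sym: "w \<in> V \<Longrightarrow> z \<in> V \<Longrightarrow> ip w z = ip z w"
    and ip_pos: "w \<in> V \<Longrightarrow> w \<noteq> (\<lambda>x. 0) \<Longrightarrow> 0 < ip w w"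
begin

lemma scale_mem: "w \<in> V \<Longrightarrow> (\<lambda>x. a *\<^sub>R w x) \<in> V"
  using comb_mem[OF _ zero_mem, of w a] by simp

lemma add_mem: "w \<in> V \<Longrightarrow> z \<in> V \<Longrightarrow> (\<lambda>x. w x + z x) \<in> V"
  using comb_mem[of w z 1] by simp

lemma diff_mem: "w \<in> V \<Longrightarrow> z \<in> V \<Longrightarrow> (\<lambda>x. w x - z x) \<in> V"
  using comb_mem[of z w "-1"] by simp

lemma sum_mem: "finite I \<Longrightarrow> (\<And>i. i \<in> I \<Longrightarrow> w i \<in> V) \<Longrightarrow> (\<lambda>x. \<Sum>i\<in>I. c i *\<^sub>R w i x) \<in> V"
  by (induction I rule: finite_induct) (auto simp: zero_mem intro: comb_mem)

lemma ip_zero: "u \<in> V \<Longrightarrow> ip (\<lambda>x. 0) u = 0"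
  using ip_comb[OF zero_mem zero_mem, of u 1] by simp

lemma ip_scale: "w \<in> V \<Longrightarrow> u \<in> V \<Longrightarrow> ip (\<lambda>x. a *\<^sub>R w x) u = a * ip w u"
  using ip_comb[OF _ zero_mem, of w u a] ip_zero by simp

lemma ip_add: "w \<in> V \<Longrightarrow> z \<in> V \<Longrightarrow> u \<in> V \<Longrightarrow> ip (\<lambda>x. w x + z x) u = ip w u + ip z u"
  using ip_comb[of w z u 1] by simp

lemma ip_diff: "w \<in> V \<Longrightarrow> z \<in> V \<Longrightarrow> u \<in> V \<Longrightarrow> ip (\<lambda>x. w x - z x) u = ip w u - ip z u"
  using ip_comb[of z w u "-1"] by simp

lemma ip_sum: "finite I \<Longrightarrow> (\<And>i. i \<in> I \<Longrightarrow> w i \<in> V) \<Longrightarrow> u \<in> V \<Longrightarrow>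
    ip (\<lambda>x. \<Sum>i\<in>I. c i *\<^sub>R w i x) u = (\<Sum>i\<in>I. c i * ip (w i) u)"
  by (induction I rule: finite_induct) (auto simp: ip_zero ip_comb sum_mem)

lemma ip_scale_right: "w \<in> V \<Longrightarrow> u \<in> V \<Longrightarrow> ip u (\<lambda>x. a *\<^sub>R w x) = a * ip u w"
  by (simp add: ip_sym[of u "\<lambda>x. a *\<^sub>R w x"] ip_sym[of u w] ip_scale scale_mem)

lemma ip_add_right: "w \<in> V \<Longrightarrow> z \<in> V \<Longrightarrow> u \<in> V \<Longrightarrow> ip u (\<lambda>x. w x + z x) = ip u w + ip u z"
  by (simp add: ip_sym[of u "\<lambda>x. w x + z x"] ip_sym[of u w] ip_sym[of u z] ip_add add_mem)

lemma ip_diff_right: "w \<in> V \<Longrightarrow> z \<in> V \<Longrightarrow> u \<in> V \<Longrightarrow> ip u (\<lambda>x. w x - z x) = ip u w - ip u z"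
  by (simp add: ip_sym[of u "\<lambda>x. w x - z x"] ip_sym[of u w] ip_sym[of u z] ip_diff diff_mem)

lemma ip_nonneg: "w \<in> V \<Longrightarrow> 0 \<le> ip w w"
  using ip_pos[of w] ip_zero[OF zero_mem] by (cases "w = (\<lambda>x. 0)") auto

definition ip_norm :: "('a \<Rightarrow> 'b) \<Rightarrow> real" where "ip_norm w = sqrt (ip w w)"

lemma ip_norm_nonneg: "w \<in> V \<Longrightarrow> 0 \<le> ip_norm w" and ip_norm_sq: "w \<in> V \<Longrightarrow> (ip_norm w)\<^sup>2 = ip w w"
  using ip_nonneg by (auto simp: ip_norm_def)

lemma ip_norm_scale: "w \<in> V \<Longrightarrow> ip_norm (\<lambda>x. a *\<^sub>R w x) = \<bar>a\<bar> * ip_norm w"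
  by (simp add: ip_norm_def ip_scale ip_scale_right scale_mem real_sqrt_mult mult.assoc[symmetric])

lemma ip_Cauchy_Schwarz:
  assumes w: "w \<in> V" "z \<in> V" shows "\<bar>ip w z\<bar> \<le> ip_norm w * ip_norm z"
proof (cases "z = (\<lambda>x. 0)")
  case True
  then show ?thesis using w ip_zero ip_sym zero_mem by (simp add: ip_norm_def)
next
  case False
  then have zz: "ip z z > 0" using ip_pos w by blast
  define t where "t = ip w z / ip z z"
  let ?r = "\<lambda>x. w x - t *\<^sub>R z x"
  have m: "(\<lambda>x. t *\<^sub>R z x) \<in> V" "?r \<in> V" using w scale_mem diff_mem by auto
  have "0 \<le> ip ?r ?r" using m ip_nonneg by blast
  also have "ip ?r ?r = ip w w - 2 * t * ip w z + t * t * ip z z"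
    using w m ip_sym[of z w] by (simp add: ip_diff ip_diff_right ip_scale ip_scale_right algebra_simps)
  also have "\<dots> = ip w w - (ip w z)\<^sup>2 / ip z z"
    using zz by (simp add: t_def field_simps power2_eq_square)
  finally have "(ip w z)\<^sup>2 \<le> ip w w * ip z z" using zz by (simp add: pos_divide_le_eq)
  then have "sqrt ((ip w z)\<^sup>2) \<le> sqrt (ip w w * ip z z)" by (rule real_sqrt_le_mono)
  then show ?thesis by (simp add: ip_norm_def real_sqrt_mult)
qed

lemma ip_norm_triangle:
  assumes w: "w \<in> V" "z \<in> V" shows "ip_norm (\<lambda>x. w x + z x) \<le> ip_norm w + ip_norm z"
proof (rule power2_le_imp_le)
  have "(ip_norm (\<lambda>x. w x + z x))\<^sup>2 = (ip_norm w)\<^sup>2 + 2 * ip w z + (ip_norm z)\<^sup>2"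
    using w ip_sym[of z w] by (simp add: ip_norm_sq add_mem ip_add ip_add_right)
  also have "\<dots> \<le> (ip_norm w)\<^sup>2 + 2 * (ip_norm w * ip_norm z) + (ip_norm z)\<^sup>2"
    using ip_Cauchy_Schwarz[OF w] by linarith
  also have "\<dots> = (ip_norm w + ip_norm z)\<^sup>2" by (simp add: power2_sum)
  finally show "(ip_norm (\<lambda>x. w x + z x))\<^sup>2 \<le> (ip_norm w + ip_norm z)\<^sup>2" .
qed (use w ip_norm_nonneg in auto)

lemma ip_norm_sum:
  assumes "finite I" "\<And>i. i \<in> I \<Longrightarrow> w i \<in> V"
  shows "ip_norm (\<lambda>x. \<Sum>i\<in>I. c i *\<^sub>R w i x) \<le> (\<Sum>i\<in>I. \<bar>c i\<bar> * ip_norm (w i))"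
  using assms
proof (induction I rule: finite_induct)
  case empty
  then show ?case by (simp add: ip_norm_def ip_zero zero_mem)
next
  case (insert i I)
  have "ip_norm (\<lambda>x. c i *\<^sub>R w i x + (\<Sum>i\<in>I. c i *\<^sub>R w i x)) \<le> ip_norm (\<lambda>x. c i *\<^sub>R w i x) + ip_norm (\<lambda>x. \<Sum>i\<in>I. c i *\<^sub>R w i x)"
    using insert by (intro ip_norm_triangle scale_mem sum_mem) auto
  also have "\<dots> \<le> \<bar>c i\<bar> * ip_norm (w i) + (\<Sum>i\<in>I. \<bar>c i\<bar> * ip_norm (w i))"
    using insert by (auto simp: ip_norm_scale)
  finally show ?case using insert by simp
qed

section \<open>Orthonormal bases, Riesz representation and boundedness\<close>

definition orthonormal :: "('a \<Rightarrow> 'b) set \<Rightarrow> bool" where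
  "orthonormal E \<longleftrightarrow> finite E \<and> E \<subseteq> V \<and> (\<forall>e\<in>E. \<forall>e'\<in>E. ip e e' = (if e = e' then 1 else 0))"

text \<open>For an orthonormal \<open>E\<close> this is membership in the span of \<open>E\<close>,
  with the only possible coefficients.\<close>

definition expands :: "('a \<Rightarrow> 'b) set \<Rightarrow> ('a \<Rightarrow> 'b) \<Rightarrow> bool" where
  "expands E w \<longleftrightarrow> w = (\<lambda>x. \<Sum>e\<in>E. ip w e *\<^sub>R e x)"

lemma Gram_Schmidt:
  assumes "finite Bs" "Bs \<subseteq> V"
  shows "\<exists>E. orthonormal E \<and> (\<forall>b\<in>Bs. expands E b)"
  using assms
proof (induction Bs rule: finite_induct)
  case empty
  show ?case by (intro exI[of _ "{}"]) (auto simp: orthonormal_def)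
next
  case (insert b Bs)
  then obtain E where E: "orthonormal E" "\<And>b. b \<in> Bs \<Longrightarrow> expands E b" by auto
  have bV: "b \<in> V" and fE: "finite E" and EV: "\<And>e. e \<in> E \<Longrightarrow> e \<in> V"
    and on: "\<And>e e'. e \<in> E \<Longrightarrow> e' \<in> E \<Longrightarrow> ip e e' = (if e = e' then 1 else 0)"
    using insert.prems E(1) by (auto simp: orthonormal_def)
  define s where "s = (\<lambda>x. \<Sum>e\<in>E. ip b e *\<^sub>R e x)"
  define r where "r = (\<lambda>x. b x - s x)"
  have sV: "s \<in> V" unfolding s_def using fE EV by (rule sum_mem)
  have rV: "r \<in> V" unfolding r_def using bV sV by (rule diff_mem)
  have b_eq: "b = (\<lambda>x. r x + s x)" by (simp add: r_def)
  have re: "ip r e = 0" if e: "e \<in> E" for e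
  proof -
    have "ip s e = (\<Sum>e'\<in>E. ip b e' * ip e' e)" unfolding s_def by (rule ip_sum[OF fE EV EV[OF e]])
    also have "\<dots> = (\<Sum>e'\<in>E. if e' = e then ip b e else 0)" using on e by (intro sum.cong) auto
    finally have "ip s e = ip b e" using e fE by simp
    then show ?thesis unfolding r_def using bV sV EV[OF e] by (simp add: ip_diff)
  qed
  show ?case
  proof (cases "r = (\<lambda>x. 0)")
    case True
    then have "expands E b" unfolding expands_def using b_eq by (simp add: s_def)
    then show ?thesis using E by blast
  next
    case False
    then have rr: "ip r r > 0" using ip_pos rV by blast
    define k where "k = ip_norm r"
    have k: "k > 0" "k * k = ip r r" using rr by (simp_all add: k_def ip_norm_def)
    define e0 where "e0 = (\<lambda>x. (1 / k) *\<^sub>R r x)"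
    have e0V: "e0 \<in> V" unfolding e0_def using rV by (rule scale_mem)
    have e0e: "ip e0 e = 0" "ip e e0 = 0" if "e \<in> E" for e
      using re[OF that] ip_sym[OF e0V EV[OF that]] ip_scale[OF rV EV[OF that], of "1/k"] by (auto simp: e0_def)
    have re0: "ip r e0 = k"
      unfolding e0_def using ip_scale_right[OF rV rV, of "1/k"] k(1) k(2)[symmetric] by simp
    have e00: "ip e0 e0 = 1"
      using ip_scale[OF rV e0V, of "1/k"] re0 k by (simp add: e0_def)
    have nin: "e0 \<notin> E" using e0e(1)[of e0] e00 by auto
    have "orthonormal (insert e0 E)"
      unfolding orthonormal_def using fE EV e0V on e0e e00 nin by auto
    \<comment> \<open>Functions expanded by the old system have coefficient 0 at the new vector, so
      their expansions persist.\<close>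
    moreover have old: "ip b' e0 = 0" if "expands E b'" for b'
    proof -
      have "ip b' e0 = ip (\<lambda>x. \<Sum>e\<in>E. ip b' e *\<^sub>R e x) e0" using that by (simp add: expands_def)
      also have "\<dots> = (\<Sum>e\<in>E. ip b' e * ip e e0)" by (rule ip_sum[OF fE EV e0V])
      also have "\<dots> = 0" using e0e by (intro sum.neutral) auto
      finally show ?thesis .
    qed
    moreover have "expands (insert e0 E) b'" if "expands E b'" for b'
    proof -
      have "b' = (\<lambda>x. \<Sum>e\<in>E. ip b' e *\<^sub>R e x)" using that by (simp add: expands_def)
      also have "\<dots> = (\<lambda>x. \<Sum>e\<in>insert e0 E. ip b' e *\<^sub>R e x)"
        using fE nin old[OF that] by (auto simp: fun_eq_iff)
      finally show ?thesis unfolding expands_def .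
    qed
    moreover have "expands (insert e0 E) b"
    proof -
      have "ip s e0 = (\<Sum>e\<in>E. ip b e * ip e e0)" unfolding s_def by (rule ip_sum[OF fE EV e0V])
      then have "ip s e0 = 0" using e0e by simp
      then have be0: "ip b e0 = k" using ip_add[OF rV sV e0V] b_eq re0 by simp
      have "b x = (\<Sum>e\<in>insert e0 E. ip b e *\<^sub>R e x)" for x
        using fE nin be0 k(1) fun_cong[OF b_eq, of x] by (simp add: e0_def s_def)
      then show ?thesis unfolding expands_def by blast
    qed
    ultimately show ?thesis using E by blast
  qed
qed

text \<open>Finite dimension, by a spanning family that may be dependent.\<close>

definition spanned_by :: "'i set \<Rightarrow> ('i \<Rightarrow> 'a \<Rightarrow> 'b) \<Rightarrow> bool" where
  "spanned_by I bs \<longleftrightarrow> finite I \<and> bs ` I \<subseteq> V \<and> (\<forall>w\<in>V. \<exists>c. w = (\<lambda>x. \<Sum>i\<in>I. c i *\<^sub>R bs i x))"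

lemma ex_orthonormal_basis:
  assumes "spanned_by I bs"
  shows "\<exists>E. orthonormal E \<and> (\<forall>w\<in>V. expands E w)"
proof -
  have I: "finite I" "bs ` I \<subseteq> V" "\<And>w. w \<in> V \<Longrightarrow> \<exists>c. w = (\<lambda>x. \<Sum>i\<in>I. c i *\<^sub>R bs i x)"
    using assms by (auto simp: spanned_by_def)
  obtain E where E: "orthonormal E" "\<And>i. i \<in> I \<Longrightarrow> expands E (bs i)"
    using Gram_Schmidt[OF finite_imageI[OF I(1)] I(2)] by blast
  have fE: "finite E" and EV: "\<And>e. e \<in> E \<Longrightarrow> e \<in> V" using E(1) by (auto simp: orthonormal_def)
  have "expands E w" if w: "w \<in> V" for w
  proof -
    obtain c where c: "w = (\<lambda>x. \<Sum>i\<in>I. c i *\<^sub>R bs i x)" using I(3)[OF w] by blast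
    have ipw: "ip w e = (\<Sum>i\<in>I. c i * ip (bs i) e)" if "e \<in> E" for e
      unfolding c using I(1,2) EV[OF that] by (intro ip_sum) auto
    have "w x = (\<Sum>e\<in>E. ip w e *\<^sub>R e x)" for x
    proof -
      have "w x = (\<Sum>i\<in>I. c i *\<^sub>R bs i x)" by (simp add: c)
      also have "\<dots> = (\<Sum>i\<in>I. c i *\<^sub>R (\<Sum>e\<in>E. ip (bs i) e *\<^sub>R e x))"
      proof (intro sum.cong refl)
        fix i assume "i \<in> I"
        from fun_cong[OF E(2)[OF this, unfolded expands_def], of x]
        show "c i *\<^sub>R bs i x = c i *\<^sub>R (\<Sum>e\<in>E. ip (bs i) e *\<^sub>R e x)" by (rule arg_cong)
      qed
      also have "\<dots> = (\<Sum>i\<in>I. \<Sum>e\<in>E. (c i * ip (bs i) e) *\<^sub>R e x)" by (simp add: scaleR_sum_right)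
      also have "\<dots> = (\<Sum>e\<in>E. \<Sum>i\<in>I. (c i * ip (bs i) e) *\<^sub>R e x)" by (rule sum.swap)
      also have "\<dots> = (\<Sum>e\<in>E. ip w e *\<^sub>R e x)" by (intro sum.cong refl) (simp add: ipw scaleR_sum_left)
      finally show ?thesis .
    qed
    then show ?thesis unfolding expands_def by blast
  qed
  then show ?thesis using E(1) by blast
qed

lemma sum_linear:
  fixes phi :: "('a \<Rightarrow> 'b) \<Rightarrow> real"
  assumes l: "\<And>w z a. w \<in> V \<Longrightarrow> z \<in> V \<Longrightarrow> phi (\<lambda>x. a *\<^sub>R w x + z x) = a * phi w + phi z"
    and "finite I" "\<And>i. i \<in> I \<Longrightarrow> w i \<in> V"
  shows "phi (\<lambda>x. \<Sum>i\<in>I. c i *\<^sub>R w i x) = (\<Sum>i\<in>I. c i * phi (w i))"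
  using assms(2,3)
proof (induction I rule: finite_induct)
  case empty
  then show ?case using l[OF zero_mem zero_mem, of 1] by simp
next
  case (insert i I)
  then show ?case by (simp add: l sum_mem)
qed

text \<open>In an orthonormal basis the coefficients of \<open>u\<close> are the values
  \<open>phi e\<close>. This makes the \<open>THE\<close> in \<open>Ah\<close> meaningful.\<close>

lemma Riesz:
  fixes phi :: "('a \<Rightarrow> 'b) \<Rightarrow> real"
  assumes "spanned_by I bs"
    and l: "\<And>w z a. w \<in> V \<Longrightarrow> z \<in> V \<Longrightarrow> phi (\<lambda>x. a *\<^sub>R w x + z x) = a * phi w + phi z"
  shows "\<exists>!u. u \<in> V \<and> (\<forall>v\<in>V. ip u v = phi v)"
proof -
  obtain E where E: "orthonormal E" "\<And>w. w \<in> V \<Longrightarrow> expands E w" using ex_orthonormal_basis[OF assms(1)] by blast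
  have fE: "finite E" and EV: "\<And>e. e \<in> E \<Longrightarrow> e \<in> V" using E(1) by (auto simp: orthonormal_def)
  define u where "u = (\<lambda>x. \<Sum>e\<in>E. phi e *\<^sub>R e x)"
  have uV: "u \<in> V" unfolding u_def using fE EV by (rule sum_mem)
  have "ip u v = phi v" if v: "v \<in> V" for v
  proof -
    have "ip u v = (\<Sum>e\<in>E. phi e * ip e v)" unfolding u_def by (rule ip_sum[OF fE EV v])
    also have "\<dots> = (\<Sum>e\<in>E. ip v e * phi e)" using EV v by (intro sum.cong refl) (simp add: ip_sym)
    also have "\<dots> = phi (\<lambda>x. \<Sum>e\<in>E. ip v e *\<^sub>R e x)" by (rule sum_linear[OF l fE EV, symmetric])
    also have "\<dots> = phi v" using E(2)[OF v] by (simp add: expands_def)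
    finally show ?thesis .
  qed
  moreover have "u' = u" if u': "u' \<in> V" "\<forall>v\<in>V. ip u' v = phi v" for u'
  proof -
    have "ip (\<lambda>x. u' x - u x) (\<lambda>x. u' x - u x) = 0"
      using u' uV calculation by (simp add: ip_diff diff_mem)
    then have "(\<lambda>x. u' x - u x) = (\<lambda>x. 0)" using ip_pos[OF diff_mem[OF u'(1) uV]] by fastforce
    then show ?thesis by (auto simp: fun_eq_iff)
  qed
  ultimately show ?thesis using uV by blast
qed

text \<open>Keeps the set of quotients in \<open>induced_norm\<close> bounded above, so that its
  supremum is an upper bound.\<close>

lemma linear_operator_bounded:
  assumes "spanned_by I bs"
    and XV: "\<And>w. w \<in> V \<Longrightarrow> X w \<in> V"
    and X: "\<And>w z a. w \<in> V \<Longrightarrow> z \<in> V \<Longrightarrow> X (\<lambda>x. a *\<^sub>R w x + z x) = (\<lambda>x. a *\<^sub>R X w x + X z x)"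
  shows "\<exists>C. \<forall>w\<in>V. ip_norm (X w) \<le> C * ip_norm w"
proof -
  obtain E where E: "orthonormal E" "\<And>w. w \<in> V \<Longrightarrow> expands E w" using ex_orthonormal_basis[OF assms(1)] by blast
  have fE: "finite E" and EV: "\<And>e. e \<in> E \<Longrightarrow> e \<in> V" and e1: "\<And>e. e \<in> E \<Longrightarrow> ip_norm e = 1"
    using E(1) by (auto simp: orthonormal_def ip_norm_def)
  have Xs: "X (\<lambda>x. \<Sum>i\<in>I. c i *\<^sub>R i x) = (\<lambda>x. \<Sum>i\<in>I. c i *\<^sub>R X i x)" if "finite I" "I \<subseteq> V" for c I
    using that
  proof (induction I rule: finite_induct)
    case empty
    then show ?case using X[OF zero_mem zero_mem, of 1] by (auto simp: fun_eq_iff)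
  next
    case (insert i I)
    then have "(\<lambda>x. \<Sum>i\<in>I. c i *\<^sub>R i x) \<in> V" by (intro sum_mem) auto
    then show ?case using insert by (simp add: X)
  qed
  have "ip_norm (X w) \<le> (\<Sum>e\<in>E. ip_norm (X e)) * ip_norm w" if w: "w \<in> V" for w
  proof -
    have "X w = (\<lambda>x. \<Sum>e\<in>E. ip w e *\<^sub>R X e x)"
      using Xs[OF fE, of "ip w"] E(2)[OF w] EV by (simp add: expands_def subset_iff)
    then have "ip_norm (X w) \<le> (\<Sum>e\<in>E. \<bar>ip w e\<bar> * ip_norm (X e))" using ip_norm_sum[OF fE, of X "ip w"] XV EV by simp
    also have "\<dots> \<le> (\<Sum>e\<in>E. ip_norm w * ip_norm (X e))"
      using ip_Cauchy_Schwarz[OF w EV] e1 ip_norm_nonneg[OF XV[OF EV]] by (intro sum_mono mult_right_mono) auto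
    finally show ?thesis by (simp add: sum_distrib_left mult.commute)
  qed
  then show ?thesis by blast
qed

end

text \<open>\<open>Q w\<close> stands for \<open>(M\<^sub>1 w, w)\<close>, so that the left side is
  the squared norm with weight \<open>M(\<tau>)\<close>. Only the dissipation inequality and a bound
  \<open>\<beta>\<close> of \<open>X\<close> enter.\<close>

lemma explicit_flow_stable:
  fixes V :: "(real^'n::finite \<Rightarrow> real^'l::finite) set"
  assumes "fun_inner V ip"
    and XV: "\<And>w. w \<in> V \<Longrightarrow> X w \<in> V"
    and X: "\<And>w z a. w \<in> V \<Longrightarrow> z \<in> V \<Longrightarrow> X (\<lambda>x. a *\<^sub>R w x + z x) = (\<lambda>x. a *\<^sub>R X w x + X z x)"
    and diss: "\<And>w. w \<in> V \<Longrightarrow> 2 * ip (X w) w \<le> Q w"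
    and \<beta>: "0 \<le> \<beta>" "\<And>w. w \<in> V \<Longrightarrow> sqrt (ip (X w) (X w)) \<le> \<beta> * sqrt (ip w w)"
    and \<tau>: "0 \<le> \<tau>" "\<tau> \<le> 1" and q: "1 \<le> q" and v0: "v0 \<in> V"
  shows "ip (explicit_flow X q \<tau> v0) (explicit_flow X q \<tau> v0) - \<tau> * Q (explicit_flow X q \<tau> v0)
    \<le> (1 + 2 * \<beta> ^ (q + 1) * (\<Sum>l\<le>q. \<beta> ^ l)) * ip v0 v0"
proof -
  interpret fun_inner V ip by fact
  have \<beta>n: "ip_norm (X w) \<le> \<beta> * ip_norm w" if "w \<in> V" for w using \<beta>(2)[OF that] by (simp add: ip_norm_def)
  define v where "v l = explicit_flow X l \<tau> v0" for l
  have vS: "v (Suc l) = (\<lambda>x. v0 x + \<tau> *\<^sub>R X (v l) x)" and v_0: "v 0 = v0" for l by (simp_all add: v_def)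
  have vV: "v l \<in> V" for l
    by (induction l) (auto simp: vS v_0 v0 intro!: add_mem scale_mem XV)
  \<comment> \<open>As \<open>\<tau> \<le> 1\<close>, each stage adds at most \<open>\<beta>\<close>
    times the previous bound: a geometric sum.\<close>
  have nv: "ip_norm (v l) \<le> (\<Sum>i\<le>l. \<beta> ^ i) * ip_norm v0" for l
  proof (induction l)
    case (Suc l)
    have "ip_norm (v (Suc l)) \<le> ip_norm v0 + \<tau> * ip_norm (X (v l))"
      unfolding vS using ip_norm_triangle[OF v0 scale_mem[OF XV[OF vV]], of \<tau> l] ip_norm_scale[OF XV[OF vV], of \<tau> l] \<tau> by simp
    also have "\<tau> * ip_norm (X (v l)) \<le> 1 * ip_norm (X (v l))"
      using \<tau> ip_norm_nonneg[OF XV[OF vV]] by (intro mult_right_mono) auto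
    also have "1 * ip_norm (X (v l)) \<le> \<beta> * ip_norm (v l)" using \<beta>n[OF vV] by simp
    also have "\<beta> * ip_norm (v l) \<le> \<beta> * ((\<Sum>i\<le>l. \<beta> ^ i) * ip_norm v0)" using Suc \<beta> by (intro mult_left_mono) auto
    finally show ?case
      by (simp add: sum.atMost_Suc_shift sum_distrib_left algebra_simps del: sum.atMost_Suc)
  qed (simp add: v_0)
  \<comment> \<open>By linearity the differences of consecutive stages satisfy the recursion
    \<open>d (l + 1) = \<tau> X (d l)\<close>.\<close>
  have nd: "ip_norm (\<lambda>x. v (Suc l) x - v l x) \<le> \<beta> ^ Suc l * ip_norm v0" for l
  proof (induction l)
    case 0
    have "ip_norm (\<lambda>x. v (Suc 0) x - v 0 x) = \<tau> * ip_norm (X v0)"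
      using ip_norm_scale[OF XV[OF v0], of \<tau>] \<tau> by (simp add: vS v_0)
    also have "\<dots> \<le> 1 * ip_norm (X v0)" using \<tau> ip_norm_nonneg[OF XV[OF v0]] by (intro mult_right_mono) auto
    finally show ?case using \<beta>n[OF v0] by simp
  next
    case (Suc l)
    let ?d = "\<lambda>x. v (Suc l) x - v l x"
    have dV: "?d \<in> V" using vV diff_mem by blast
    have "X (v (Suc l)) = (\<lambda>x. 1 *\<^sub>R X ?d x + X (v l) x)"
      using X[OF dV vV, of 1 l] by simp
    then have "(\<lambda>x. v (Suc (Suc l)) x - v (Suc l) x) = (\<lambda>x. \<tau> *\<^sub>R X ?d x)"
      by (auto simp: vS[of "Suc l"] vS[of l] fun_eq_iff algebra_simps)
    then have "ip_norm (\<lambda>x. v (Suc (Suc l)) x - v (Suc l) x) = \<tau> * ip_norm (X ?d)"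
      using ip_norm_scale[OF XV[OF dV], of \<tau>] \<tau> by simp
    also have "\<dots> \<le> 1 * ip_norm (X ?d)" using \<tau> ip_norm_nonneg[OF XV[OF dV]] by (intro mult_right_mono) auto
    also have "\<dots> \<le> \<beta> * ip_norm ?d" using \<beta>n[OF dV] by simp
    also have "\<dots> \<le> \<beta> * (\<beta> ^ Suc l * ip_norm v0)" using Suc \<beta> by (intro mult_left_mono) auto
    finally show ?case by simp
  qed
  obtain m where m: "q = Suc m" using q by (cases q) auto
  let ?d = "\<lambda>x. v q x - v m x"
  have dV: "?d \<in> V" using vV diff_mem by blast
  have Xq: "X (v q) = (\<lambda>x. X ?d x + X (v m) x)" using X[OF dV vV, of 1 m] by simp
  have XV': "X (v m) \<in> V" "X (v q) \<in> V" "X ?d \<in> V" "(\<lambda>x. \<tau> *\<^sub>R X (v m) x) \<in> V"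
    using XV vV dV scale_mem by blast+
  have v0_eq: "v0 = (\<lambda>x. v q x - \<tau> *\<^sub>R X (v m) x)" using vS[of m] by (simp add: m)
  have "ip v0 v0 = ip (v q) (v q) - 2 * \<tau> * ip (X (v m)) (v q) + \<tau>\<^sup>2 * ip (X (v m)) (X (v m))"
    using vV XV' ip_sym[of "v q" "X (v m)"]
    by (subst (1 2) v0_eq) (simp add: ip_diff ip_diff_right diff_mem ip_scale ip_scale_right power2_eq_square algebra_simps)
  moreover have "0 \<le> \<tau>\<^sup>2 * ip (X (v m)) (X (v m))" using ip_nonneg XV' by simp
  moreover have "ip (X (v m)) (v q) = ip (X (v q)) (v q) - ip (X ?d) (v q)"
    using ip_add[OF XV'(3,1) vV, of q] Xq by simp
  moreover have "\<tau> * (2 * ip (X (v q)) (v q)) \<le> \<tau> * Q (v q)" using diss[OF vV] \<tau> by (intro mult_left_mono) auto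
  \<comment> \<open>The difference contributes \<open>\<beta> ^ q\<close> and the operator in front
    of it one more factor \<open>\<beta>\<close>.\<close>
  moreover have "- (\<tau> * ip (X ?d) (v q)) \<le> \<beta> ^ (q + 1) * (\<Sum>l\<le>q. \<beta> ^ l) * ip v0 v0"
  proof -
    have "- (\<tau> * ip (X ?d) (v q)) \<le> \<tau> * \<bar>ip (X ?d) (v q)\<bar>" using \<tau> by (simp add: abs_if mult_nonneg_nonpos)
    also have "\<dots> \<le> 1 * \<bar>ip (X ?d) (v q)\<bar>" using \<tau> by (intro mult_right_mono) auto
    also have "\<dots> \<le> ip_norm (X ?d) * ip_norm (v q)" using ip_Cauchy_Schwarz[OF XV'(3) vV] by simp
    also have "\<dots> \<le> (\<beta> * (\<beta> ^ Suc m * ip_norm v0)) * ((\<Sum>l\<le>q. \<beta> ^ l) * ip_norm v0)"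
    proof (intro mult_mono nv)
      have "ip_norm (X ?d) \<le> \<beta> * ip_norm ?d" by (rule \<beta>n[OF dV])
      also have "\<dots> \<le> \<beta> * (\<beta> ^ Suc m * ip_norm v0)" using nd[of m] \<beta> by (intro mult_left_mono) (auto simp: m)
      finally show "ip_norm (X ?d) \<le> \<beta> * (\<beta> ^ Suc m * ip_norm v0)" .
    qed (use \<beta> ip_norm_nonneg v0 vV in auto)
    also have "\<dots> = \<beta> ^ (q + 1) * (\<Sum>l\<le>q. \<beta> ^ l) * (ip_norm v0)\<^sup>2" by (simp add: m power2_eq_square algebra_simps)
    finally show ?thesis using ip_norm_sq[OF v0] by simp
  qed
  ultimately have "ip (v q) (v q) - \<tau> * Q (v q) \<le> (1 + 2 * \<beta> ^ (q + 1) * (\<Sum>l\<le>q. \<beta> ^ l)) * ip v0 v0"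
    by (simp add: algebra_simps)
  then show ?thesis by (simp add: v_def)
qed

section \<open>Polynomials\<close>

lemma finite_multiindices: "finite {\<alpha> :: 'n::finite \<Rightarrow> nat. (\<Sum>i\<in>UNIV. \<alpha> i) \<le> p}"
proof (rule finite_subset)
  show "finite (PiE (UNIV :: 'n set) (\<lambda>_. {..p}))" by (intro finite_PiE) auto
  have "\<alpha> i \<le> p" if "(\<Sum>i\<in>UNIV. \<alpha> i) \<le> p" for \<alpha> :: "'n \<Rightarrow> nat" and i
    using member_le_sum[of i UNIV \<alpha>] that by simp
  then show "{\<alpha> :: 'n \<Rightarrow> nat. (\<Sum>i\<in>UNIV. \<alpha> i) \<le> p} \<subseteq> PiE UNIV (\<lambda>_. {..p})" by auto
qed

lemma polynomial_degree_le_comb: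
  assumes "polynomial_degree_le p f" "polynomial_degree_le p g"
  shows "polynomial_degree_le p (\<lambda>x. a *\<^sub>R f x + g x)"
proof -
  obtain c d where "\<And>x. f x = (\<Sum>\<alpha> | (\<Sum>i\<in>UNIV. \<alpha> i) \<le> p. (\<Prod>i\<in>UNIV. (x $ i) ^ \<alpha> i) *\<^sub>R c \<alpha>)"
    "\<And>x. g x = (\<Sum>\<alpha> | (\<Sum>i\<in>UNIV. \<alpha> i) \<le> p. (\<Prod>i\<in>UNIV. (x $ i) ^ \<alpha> i) *\<^sub>R d \<alpha>)"
    using assms by (auto simp: polynomial_degree_le_def)
  then have "a *\<^sub>R f x + g x = (\<Sum>\<alpha> | (\<Sum>i\<in>UNIV. \<alpha> i) \<le> p. (\<Prod>i\<in>UNIV. (x $ i) ^ \<alpha> i) *\<^sub>R (a *\<^sub>R c \<alpha> + d \<alpha>))" for x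
    by (simp add: scaleR_sum_right sum.distrib scaleR_add_right mult.commute)
  then show ?thesis unfolding polynomial_degree_le_def by (intro exI[of _ "\<lambda>\<alpha>. a *\<^sub>R c \<alpha> + d \<alpha>"]) auto
qed

lemma polynomial_degree_le_matrix:
  assumes "polynomial_degree_le p f"
  shows "polynomial_degree_le p (\<lambda>x. A *v f x)"
proof -
  obtain c where "\<And>x. f x = (\<Sum>\<alpha> | (\<Sum>i\<in>UNIV. \<alpha> i) \<le> p. (\<Prod>i\<in>UNIV. (x $ i) ^ \<alpha> i) *\<^sub>R c \<alpha>)"
    using assms by (auto simp: polynomial_degree_le_def)
  then have "A *v f x = (\<Sum>\<alpha> | (\<Sum>i\<in>UNIV. \<alpha> i) \<le> p. (\<Prod>i\<in>UNIV. (x $ i) ^ \<alpha> i) *\<^sub>R (A *v c \<alpha>))" for x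
    by (simp add: linear_sum linear_scale)
  then show ?thesis unfolding polynomial_degree_le_def by (intro exI[of _ "\<lambda>\<alpha>. A *v c \<alpha>"]) auto
qed

lemma polynomial_degree_le_zero: "polynomial_degree_le p (\<lambda>x. 0)"
  unfolding polynomial_degree_le_def by (intro exI[of _ "\<lambda>\<alpha>. 0"]) auto

lemma real_polynomial_function_monomial:
  "real_polynomial_function (\<lambda>x::real^'n::finite. \<Prod>i\<in>UNIV. (x $ i) ^ \<alpha> i)"
  by (intro real_polynomial_function_prod real_polynomial_function_power real_polynomial_function.intros(1)
      bounded_linear_vec_nth) auto

lemma polynomial_degree_le_component:
  assumes "polynomial_degree_le p f" shows "real_polynomial_function (\<lambda>x. f x $ k)"
proof -
  obtain c where "\<And>x. f x = (\<Sum>\<alpha> | (\<Sum>i\<in>UNIV. \<alpha> i) \<le> p. (\<Prod>i\<in>UNIV. (x $ i) ^ \<alpha> i) *\<^sub>R c \<alpha>)"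
    using assms by (auto simp: polynomial_degree_le_def)
  then have eq: "(\<lambda>x. f x $ k) = (\<lambda>x. \<Sum>\<alpha> | (\<Sum>i\<in>UNIV. \<alpha> i) \<le> p. (\<Prod>i\<in>UNIV. (x $ i) ^ \<alpha> i) * (c \<alpha> $ k))"
    by simp
  show ?thesis unfolding eq
    by (intro real_polynomial_function_sum finite_multiindices real_polynomial_function.intros(4)
        real_polynomial_function.intros(2) real_polynomial_function_monomial)
qed

lemma real_polynomial_function_continuous:
  assumes "real_polynomial_function f" shows "continuous_on UNIV f"
  using real_polynomial_function_partial[OF assms]
  by (auto intro!: continuous_at_imp_continuous_on differentiable_imp_continuous_within)

lemma real_polynomial_function_differentiable:
  fixes f :: "real^'n::finite \<Rightarrow> real"
  assumes "real_polynomial_function f"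
  shows "f differentiable at x" "continuous_on UNIV f" "continuous_on UNIV (partial j f)"
    "real_polynomial_function (partial j f)"
proof -
  obtain f' where f': "real_polynomial_function f'" "\<And>x. f differentiable at x" "\<And>x. frechet_derivative f (at x) (axis j 1) = f' x"
    using real_polynomial_function_partial[OF assms] by metis
  have "partial j f = f'" using f'(3) by (auto simp: partial_def)
  then show "f differentiable at x" "continuous_on UNIV f" "continuous_on UNIV (partial j f)" "real_polynomial_function (partial j f)"
    using f' assms by (auto intro: real_polynomial_function_continuous)
qed

lemma polynomial_degree_le_continuous:
  assumes "polynomial_degree_le p f" shows "continuous_on UNIV f"
proof -
  have "continuous_on UNIV (\<lambda>x. \<chi> k. f x $ k)"
    using polynomial_degree_le_component[OF assms] by (intro continuous_on_vec_lambda real_polynomial_function_differentiable(2))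
  then show ?thesis by simp
qed

lemma partial_component:
  assumes "f differentiable at x" shows "partial j (\<lambda>x. f x $ k) x = partial j f x $ k"
proof -
  have "((\<lambda>x. f x $ k) has_derivative (\<lambda>h. frechet_derivative f (at x) h $ k)) (at x)"
    using assms by (intro bounded_linear.has_derivative[OF bounded_linear_vec_nth]) (simp add: frechet_derivative_works)
  then show ?thesis unfolding partial_def by (simp add: frechet_derivative_at[symmetric])
qed

lemma polynomial_degree_le_differentiable:
  assumes "polynomial_degree_le p f"
  shows "f differentiable at x" "continuous_on UNIV (partial j f)"
    "real_polynomial_function (\<lambda>x. partial j f x $ k)"
proof -
  show d: "f differentiable at x" for x
  proof -
    have "polynomial_function f"
      unfolding polynomial_function_iff_Basis_inner
      using polynomial_degree_le_component[OF assms] by (auto simp: Basis_vec_def inner_axis)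
    then show ?thesis by (rule differentiable_at_polynomial_function)
  qed
  have eq: "(\<lambda>x. partial j f x $ k) = partial j (\<lambda>x. f x $ k)" for k
    using d by (simp add: partial_component fun_eq_iff)
  show "real_polynomial_function (\<lambda>x. partial j f x $ k)" for k
    unfolding eq by (rule real_polynomial_function_differentiable(4)[OF polynomial_degree_le_component[OF assms]])
  then have "continuous_on UNIV (\<lambda>x. \<chi> k. partial j f x $ k)"
    by (intro continuous_on_vec_lambda real_polynomial_function_differentiable(2))
  then show "continuous_on UNIV (partial j f)" by simp
qed

section \<open>Integrals over elements\<close>

text \<open>The frontier of a convex set is a null set, so values inside decide.\<close>

lemma elem_integral_eq:
  fixes K :: "(real^'n::finite) set"
  assumes "convex K" "\<And>x. x \<in> interior K \<Longrightarrow> g x = h x"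
  shows "(LINT x:K|lebesgue. g x) = (LINT x:K|lebesgue. h x :: real)"
  unfolding set_lebesgue_integral_def
proof (rule integral_lebesgue_spike)
  have "AE x in lebesgue. x \<notin> frontier K"
    using negligible_convex_frontier[OF assms(1)] by (simp add: negligible_iff_null_sets AE_not_in)
  then show "AE x in lebesgue. indicator K x *\<^sub>R g x = indicator K x *\<^sub>R h x"
  proof eventually_elim
    case (elim x)
    show ?case
    proof (cases "x \<in> K")
      case True
      then have "x \<in> interior K" using elim closure_subset by (auto simp: frontier_def)
      then show ?thesis using assms(2) by simp
    qed simp
  qed
qed

lemma elem_integrable:
  assumes "compact K" "continuous_on UNIV h"
  shows "set_integrable lebesgue K (h :: real^'n::finite \<Rightarrow> real)"
  using bounded_borel_support_compact[OF assms]
  unfolding set_integrable_def real_scaleR_def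
  by (subst integrable_completion) (auto intro: integrable_bounded_borel_support simp: bounded_borel_support_def)

text \<open>The integrands of the DG form are controlled only inside an element; to agree there with
  a continuous function is what makes their integrals additive.\<close>

lemma elem_integral_comb:
  fixes h k :: "real^'n::finite \<Rightarrow> real"
  assumes K: "compact K" "convex K" "\<And>x. x \<in> interior K \<Longrightarrow> g x = a * h x + k x"
    and c: "\<exists>h'. continuous_on UNIV h' \<and> (\<forall>x\<in>interior K. h x = h' x)"
      "\<exists>k'. continuous_on UNIV k' \<and> (\<forall>x\<in>interior K. k x = k' x)"
  shows "(LINT x:K|lebesgue. g x) = a * (LINT x:K|lebesgue. h x) + (LINT x:K|lebesgue. k x)"
proof -
  obtain h' k' where h': "continuous_on UNIV h'" "\<And>x. x \<in> interior K \<Longrightarrow> h x = h' x"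
    and k': "continuous_on UNIV k'" "\<And>x. x \<in> interior K \<Longrightarrow> k x = k' x" using c by blast
  have "(LINT x:K|lebesgue. g x) = (LINT x:K|lebesgue. a * h' x + k' x)"
    by (rule elem_integral_eq[OF K(2)]) (simp add: K(3) h' k')
  also have "\<dots> = a * (LINT x:K|lebesgue. h' x) + (LINT x:K|lebesgue. k' x)"
    using elem_integrable[OF K(1) h'(1)] elem_integrable[OF K(1) k'(1)] by simp
  finally show ?thesis
    using elem_integral_eq[OF K(2), of h h'] elem_integral_eq[OF K(2), of k k'] h'(2) k'(2) by simp
qed

lemma elem_integral_nonneg:
  fixes K :: "(real^'n::finite) set"
  assumes "\<And>x. x \<in> K \<Longrightarrow> 0 \<le> h x"
  shows "0 \<le> (LINT x:K|lebesgue. h x :: real)"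
  unfolding set_lebesgue_integral_def using assms by (intro integral_nonneg_AE AE_I2) (auto simp: indicator_def)

lemma elem_integral_pos:
  fixes K :: "(real^'n::finite) set"
  assumes "compact K" and h: "continuous_on UNIV h" "\<And>x. x \<in> K \<Longrightarrow> 0 \<le> h x" and x: "x \<in> interior K" "0 < h x"
  shows "0 < (LINT x:K|lebesgue. h x :: real)"
proof -
  have "open {y. 0 < h y}" using h(1) by (intro open_Collect_less) auto
  then have "open ({y. 0 < h y} \<inter> interior K)" by (intro open_Int open_interior)
  moreover have "x \<in> {y. 0 < h y} \<inter> interior K" using x by simp
  ultimately obtain r where r: "r > 0" "ball x r \<subseteq> {y. 0 < h y} \<inter> interior K"
    by (rule openE)
  let ?h = "\<lambda>y. indicator K y * h y"
  have nonneg: "?h z \<ge> 0" for z using h(2) by (auto simp: indicator_def)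
  have hb: "bounded_borel_support ?h" by (rule bounded_borel_support_compact[OF assms(1) h(1)])
  have pos: "?h z > 0" if "z \<in> ball x r" for z
  proof -
    have "z \<in> interior K" "h z > 0" using that r(2) by blast+
    then have "z \<in> K" using interior_subset by blast
    then show ?thesis using \<open>h z > 0\<close> by simp
  qed
  have "(LINT x:K|lebesgue. h x) = (LINT z|lborel. ?h z)"
    using hb by (simp add: set_lebesgue_integral_def integral_completion bounded_borel_support_def)
  then show ?thesis using integral_pos_ball[OF hb nonneg r(1) pos] by simp
qed

section \<open>The maximal wave speed\<close>

lemma sum_scaleR_matrix_vector:
  fixes A :: "'j \<Rightarrow> real^'n^'m"
  shows "(\<Sum>j\<in>J. a j *\<^sub>R A j) *v e = (\<Sum>j\<in>J. a j *\<^sub>R (A j *v e))"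
  by (induction J rule: infinite_finite_induct)
     (simp_all add: matrix_vector_mult_add_rdistrib scaleR_matrix_vector_assoc[symmetric])

text \<open>A crude constant suffices, because it only shows that the set of wave speeds is
  bounded.\<close>

lemma abs_quadratic_form_le:
  fixes A :: "real^'l^'l::finite"
  shows "\<bar>e \<bullet> (A *v e)\<bar> \<le> (real CARD('l) * real CARD('l) * norm A) * (norm e)\<^sup>2"
proof -
  have "\<bar>e \<bullet> (A *v e)\<bar> = \<bar>\<Sum>i\<in>UNIV. \<Sum>j\<in>UNIV. e $ i * (A $ i $ j * e $ j)\<bar>"
    by (simp add: inner_vec_def matrix_vector_mult_def sum_distrib_left)
  also have "\<dots> \<le> (\<Sum>i\<in>UNIV. \<Sum>j\<in>UNIV. \<bar>e $ i * (A $ i $ j * e $ j)\<bar>)"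
    by (rule order_trans[OF sum_abs sum_mono[OF sum_abs]])
  also have "\<dots> \<le> (\<Sum>i\<in>(UNIV::'l set). \<Sum>j\<in>(UNIV::'l set). norm A * (norm e)\<^sup>2)"
  proof (intro sum_mono)
    fix i j
    have "\<bar>A $ i $ j\<bar> \<le> norm A"
      using component_le_norm_cart[of "A $ i" j] Finite_Cartesian_Product.norm_nth_le[of A i] by linarith
    then have "\<bar>e $ i\<bar> * (\<bar>A $ i $ j\<bar> * \<bar>e $ j\<bar>) \<le> norm e * (norm A * norm e)"
      by (intro mult_mono component_le_norm_cart) auto
    then show "\<bar>e $ i * (A $ i $ j * e $ j)\<bar> \<le> norm A * (norm e)\<^sup>2"
      by (simp add: abs_mult power2_eq_square mult.left_commute)
  qed
  also have "\<dots> = (real CARD('l) * real CARD('l) * norm A) * (norm e)\<^sup>2" by simp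
  finally show ?thesis .
qed

lemma symmetric_matrix_inner:
  "symmetric_matrix A \<Longrightarrow> w \<bullet> (A *v z) = z \<bullet> (A *v w)"
  using dot_lmul_matrix[of w A z] transpose_matrix_vector[of A w]
  by (simp add: symmetric_matrix_def inner_commute)

lemma symmetric_matrix_diff:
  "symmetric_matrix A \<Longrightarrow> symmetric_matrix C \<Longrightarrow> symmetric_matrix (A - C)"
  by (simp add: symmetric_matrix_def transpose_def vec_eq_iff)

lemma symmetric_matrix_sum:
  "(\<And>j. j \<in> J \<Longrightarrow> symmetric_matrix (A j)) \<Longrightarrow> symmetric_matrix (\<Sum>j\<in>J. a j *\<^sub>R A j)"
  by (simp add: symmetric_matrix_def transpose_def vec_eq_iff)

text \<open>At a maximizer \<open>e0\<close> of the Rayleigh quotient, with maximum \<open>m\<close>, one of \<open>m G - D\<close> and \<open>m G + D\<close> is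
  positive semidefinite and has \<open>e0\<close> in its kernel.\<close>

lemma max_generalized_eigenvalue:
  fixes D G :: "real^'l^'l::finite"
  assumes D: "symmetric_matrix D" and G: "symmetric_matrix G"
    and pos: "\<And>e. e \<noteq> 0 \<Longrightarrow> 0 < e \<bullet> (G *v e)"
  obtains lam e0 where "e0 \<noteq> 0" "D *v e0 = lam *\<^sub>R (G *v e0)"
    "\<And>e. \<bar>e \<bullet> (D *v e)\<bar> \<le> \<bar>lam\<bar> * (e \<bullet> (G *v e))"
proof -
  let ?f = "\<lambda>e. \<bar>e \<bullet> (D *v e)\<bar> / (e \<bullet> (G *v e))"
  have cont: "continuous_on (sphere 0 1) ?f"
  proof (intro continuous_intros)
    show "\<forall>x\<in>sphere 0 1. x \<bullet> (G *v x) \<noteq> 0" using pos by (metis less_irrefl norm_zero sphere_eq_empty mem_sphere_0 zero_neq_one)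
  qed
  have "axis undefined 1 \<in> sphere (0::real^'l) 1" by simp
  then obtain e0 where e0: "e0 \<in> sphere 0 1" "\<And>e. e \<in> sphere 0 1 \<Longrightarrow> ?f e \<le> ?f e0"
    using continuous_attains_sup[OF compact_sphere _ cont] by blast
  have e0n: "e0 \<noteq> 0" using e0(1) by auto
  define m where "m = ?f e0"
  have G0: "e0 \<bullet> (G *v e0) > 0" using pos[OF e0n] .
  have m: "m \<ge> 0" using G0 by (simp add: m_def)
  have bound: "\<bar>e \<bullet> (D *v e)\<bar> \<le> m * (e \<bullet> (G *v e))" for e
  proof (cases "e = 0")
    case False
    let ?u = "(1 / norm e) *\<^sub>R e"
    have "?u \<in> sphere 0 1" using False by simp
    then have "?f ?u \<le> m" using e0(2) m_def by blast
    moreover have "?u \<noteq> 0" using False by simp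
    ultimately have "\<bar>?u \<bullet> (D *v ?u)\<bar> \<le> m * (?u \<bullet> (G *v ?u))"
      using pos_divide_le_eq[OF pos] by blast
    then show ?thesis using False
      by (simp add: matrix_vector_mult_scaleR abs_mult divide_le_cancel field_simps)
  qed simp
  \<comment> \<open>With \<open>s\<close> the sign of the form \<open>D\<close> at
    \<open>e0\<close>, the form \<open>Q\<close> is nonnegative and vanishes at
    \<open>e0\<close>.\<close>
  define s where "s = (if e0 \<bullet> (D *v e0) \<ge> 0 then 1 else - 1 :: real)"
  have s: "s * s = 1" "\<bar>s\<bar> = 1" by (auto simp: s_def)
  have eq0: "m * (e0 \<bullet> (G *v e0)) = s * (e0 \<bullet> (D *v e0))" using G0 by (auto simp: m_def s_def)
  define Q where "Q x y = m * (x \<bullet> (G *v y)) - s * (x \<bullet> (D *v y))" for x y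
  have Qpos: "Q e e \<ge> 0" for e
  proof -
    have "s * (e \<bullet> (D *v e)) \<le> \<bar>e \<bullet> (D *v e)\<bar>" by (auto simp: s_def)
    then show ?thesis using bound[of e] by (simp add: Q_def)
  qed
  have Qsym: "Q x y = Q y x" for x y
    by (simp add: Q_def symmetric_matrix_inner[OF D, of x y] symmetric_matrix_inner[OF G, of x y])
  have Q0: "Q e0 e0 = 0" using eq0 by (simp add: Q_def)
  have Qe: "Q y e0 = 0" for y
  proof (rule ccontr)
    assume ne: "Q y e0 \<noteq> 0"
    \<comment> \<open>As \<open>Q e0 e0 = 0\<close>, the form is affine in \<open>t\<close> along
      this line; a nonzero slope would make it negative somewhere.\<close>
    have ex: "Q (y + t *\<^sub>R e0) (y + t *\<^sub>R e0) = Q y y + 2 * t * Q y e0" for t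
    proof -
      have "Q (y + t *\<^sub>R e0) (y + t *\<^sub>R e0) = Q y y + t * Q y e0 + t * Q e0 y + t * t * Q e0 e0"
        by (simp add: Q_def inner_add_left inner_add_right matrix_vector_right_distrib matrix_vector_mult_scaleR algebra_simps)
      then show ?thesis using Q0 Qsym[of e0 y] by simp
    qed
    define t where "t = - (Q y y + 1) / (2 * Q y e0)"
    have "2 * t * Q y e0 = - (Q y y + 1)" using ne by (simp add: t_def)
    then show False using Qpos[of "y + t *\<^sub>R e0"] ex[of t] by simp
  qed
  have "y \<bullet> (m *\<^sub>R (G *v e0) - s *\<^sub>R (D *v e0)) = 0" for y
    using Qe[of y] by (simp add: Q_def inner_diff_right)
  then have "m *\<^sub>R (G *v e0) = s *\<^sub>R (D *v e0)" by (metis inner_eq_zero_iff eq_iff_diff_eq_0)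
  then have "s *\<^sub>R (m *\<^sub>R (G *v e0)) = (s * s) *\<^sub>R (D *v e0)" by simp
  then have "D *v e0 = (s * m) *\<^sub>R (G *v e0)" using s by simp
  moreover have "\<bar>s * m\<bar> = m" using s m by (simp add: abs_mult)
  ultimately show ?thesis using that[OF e0n, of "s * m"] bound by metis
qed

text \<open>For a unit vector \<open>\<nu>\<close> the largest generalized eigenvalue at
  \<open>x\<close> controls the quadratic form and is one of the numbers under the supremum;
  homogeneity gives the other \<open>\<nu>\<close>.\<close>

lemma max_speed_bound:
  fixes L :: "'n::finite \<Rightarrow> real^'n \<Rightarrow> real^'l^'l::finite"
  assumes L_sym: "\<And>j x. x \<in> \<Omega> \<Longrightarrow> symmetric_matrix (L j x)"
    and L_bounded: "\<And>j. bounded (L j ` \<Omega>)"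
    and G_sym: "\<And>x. x \<in> \<Omega> \<Longrightarrow> symmetric_matrix (G x)"
    and \<gamma>: "\<gamma> > 0" "\<And>x e. x \<in> \<Omega> \<Longrightarrow> \<gamma> * (norm e)\<^sup>2 \<le> e \<bullet> (G x *v e)"
    and x: "x \<in> \<Omega>"
  shows "0 \<le> max_speed \<Omega> L G"
    and "\<bar>e \<bullet> (flux_matrix L \<nu> x *v e)\<bar> \<le> norm \<nu> * (max_speed \<Omega> L G * (e \<bullet> (G x *v e)))"
proof -
  define Z where "Z = {\<bar>lam\<bar> | lam. \<exists>x\<in>\<Omega>. \<exists>\<nu> e. norm \<nu> = 1 \<and> e \<noteq> 0 \<and> flux_matrix L \<nu> x *v e = lam *\<^sub>R (G x *v e)}"
  have ms: "max_speed \<Omega> L G = Sup Z" by (simp add: max_speed_def Z_def)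
  have "\<exists>b. \<forall>x\<in>\<Omega>. norm (L j x) \<le> b" for j using L_bounded[of j] by (auto simp: bounded_iff)
  then obtain b where b: "\<And>j x. x \<in> \<Omega> \<Longrightarrow> norm (L j x) \<le> b j" by metis
  define M where "M = (\<Sum>j\<in>UNIV. norm (axis j (1::real) :: real^'n) * (real CARD('l) * real CARD('l) * b j))"
  have qf: "e \<bullet> (flux_matrix L \<nu> x *v e) = (\<Sum>j\<in>UNIV. \<nu> $ j * (e \<bullet> (L j x *v e)))" for \<nu> x e
    unfolding flux_matrix_def
    by (simp add: sum_scaleR_matrix_vector inner_sum_right)
  have bnd: "\<bar>e \<bullet> (flux_matrix L \<nu> x *v e)\<bar> \<le> M * (norm e)\<^sup>2" if "x \<in> \<Omega>" "norm \<nu> = 1" for x \<nu> e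
  proof -
    have "\<bar>e \<bullet> (flux_matrix L \<nu> x *v e)\<bar> \<le> (\<Sum>j\<in>UNIV. \<bar>\<nu> $ j\<bar> * \<bar>e \<bullet> (L j x *v e)\<bar>)"
      unfolding qf by (rule order_trans[OF sum_abs]) (simp add: abs_mult)
    also have "\<dots> \<le> (\<Sum>j\<in>UNIV. 1 * ((real CARD('l) * real CARD('l) * b j) * (norm e)\<^sup>2))"
    proof (intro sum_mono mult_mono)
      fix j
      show "\<bar>\<nu> $ j\<bar> \<le> 1" using component_le_norm_cart[of \<nu> j] that by simp
      show "\<bar>e \<bullet> (L j x *v e)\<bar> \<le> (real CARD('l) * real CARD('l) * b j) * (norm e)\<^sup>2"
        using abs_quadratic_form_le[of e "L j x"] b[OF that(1), of j]
        by (elim order_trans) (intro mult_right_mono mult_left_mono, auto)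
    qed auto
    finally show ?thesis by (simp add: M_def sum_distrib_right)
  qed
  have Gp: "e \<noteq> 0 \<Longrightarrow> x \<in> \<Omega> \<Longrightarrow> 0 < e \<bullet> (G x *v e)" for x e
    using \<gamma>(2)[of x e] \<gamma>(1) by (smt (verit) mult_pos_pos zero_less_norm_iff zero_less_power)
  \<comment> \<open>Without an upper bound of \<open>Z\<close> its \<open>Sup\<close> would dominate
    nothing; the uniform positivity of \<open>G\<close> supplies one.\<close>
  have "z \<le> M / \<gamma>" if zZ: "z \<in> Z" for z
  proof -
    obtain lam y \<nu> e where z: "z = \<bar>lam\<bar>" "y \<in> \<Omega>" "norm \<nu> = 1" "e \<noteq> 0" "flux_matrix L \<nu> y *v e = lam *\<^sub>R (G y *v e)"
      using zZ unfolding Z_def by blast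
    have "\<bar>lam\<bar> * (\<gamma> * (norm e)\<^sup>2) \<le> \<bar>lam\<bar> * (e \<bullet> (G y *v e))"
      using \<gamma>(2)[OF z(2)] by (intro mult_left_mono) auto
    also have "\<dots> = \<bar>e \<bullet> (flux_matrix L \<nu> y *v e)\<bar>" using Gp[OF z(4,2)] by (simp add: z(5) abs_mult)
    also have "\<dots> \<le> M * (norm e)\<^sup>2" by (rule bnd[OF z(2,3)])
    finally have "(\<bar>lam\<bar> * \<gamma>) * (norm e)\<^sup>2 \<le> M * (norm e)\<^sup>2" by (simp add: mult.assoc)
    then have "\<bar>lam\<bar> * \<gamma> \<le> M" using z(4) by simp
    then show ?thesis using z(1) \<gamma>(1) by (simp add: pos_le_divide_eq)
  qed
  then have bdd: "bdd_above Z" by (auto simp: bdd_above_def)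
  have unit: "0 \<le> Sup Z \<and> \<bar>e \<bullet> (flux_matrix L \<nu> x *v e)\<bar> \<le> Sup Z * (e \<bullet> (G x *v e))" if "norm \<nu> = 1" for \<nu> e
  proof -
    have "symmetric_matrix (flux_matrix L \<nu> x)"
      unfolding flux_matrix_def using L_sym[OF x] by (intro symmetric_matrix_sum)
    then obtain lam e0 where l: "e0 \<noteq> 0" "flux_matrix L \<nu> x *v e0 = lam *\<^sub>R (G x *v e0)"
      "\<And>e. \<bar>e \<bullet> (flux_matrix L \<nu> x *v e)\<bar> \<le> \<bar>lam\<bar> * (e \<bullet> (G x *v e))"
      using max_generalized_eigenvalue[OF _ G_sym[OF x] Gp] x by metis
    have "\<bar>lam\<bar> \<in> Z" unfolding Z_def using l(1,2) that x by blast
    then have le: "\<bar>lam\<bar> \<le> Sup Z" using bdd by (rule cSup_upper)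
    have "0 \<le> e \<bullet> (G x *v e)" using Gp[of e x] x by (cases "e = 0") auto
    then show ?thesis using l(3)[of e] mult_right_mono[OF le, of "e \<bullet> (G x *v e)"] le by linarith
  qed
  show "0 \<le> max_speed \<Omega> L G" using unit[of "axis undefined 1"] by (simp add: ms)
  show "\<bar>e \<bullet> (flux_matrix L \<nu> x *v e)\<bar> \<le> norm \<nu> * (max_speed \<Omega> L G * (e \<bullet> (G x *v e)))"
  proof (cases "\<nu> = 0")
    case True
    then show ?thesis by (simp add: qf)
  next
    case False
    let ?u = "(1 / norm \<nu>) *\<^sub>R \<nu>"
    have "e \<bullet> (flux_matrix L \<nu> x *v e) = norm \<nu> * (e \<bullet> (flux_matrix L ?u x *v e))"
      using False by (simp add: qf sum_distrib_left)
    moreover have "\<bar>e \<bullet> (flux_matrix L ?u x *v e)\<bar> \<le> Sup Z * (e \<bullet> (G x *v e))"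
      using unit[of ?u e] False by simp
    ultimately show ?thesis by (simp add: abs_mult ms mult_left_mono)
  qed
qed

section \<open>Operators on a vertex patch\<close>

text \<open>\<open>K\<close> is the closure of its interior, so \<open>x\<close> is a limit point of
  the interior and the limit there is unique.\<close>

lemma facet_trace_eq:
  fixes K :: "(real^'n::finite) set" and f :: "real^'n \<Rightarrow> 'b::t2_space"
  assumes K: "closure (interior K) = K" and x: "x \<in> K" and f: "continuous_on UNIV f"
    and w: "\<And>y. y \<in> interior K \<Longrightarrow> w y = f y"
  shows "facet_trace K w x = f x"
  unfolding facet_trace_def
proof (rule tendsto_Lim)
  have "x islimpt interior K"
  proof (cases "x \<in> interior K")
    case True
    then show ?thesis using interior_limit_point[of x "interior K"] by simp
  next
    case False
    then show ?thesis using x K by (auto simp: closure_def)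
  qed
  then show "at x within interior K \<noteq> bot" by (simp add: trivial_limit_within)
  have "(f \<longlongrightarrow> f x) (at x within interior K)"
    using f by (meson continuous_on_def iso_tuple_UNIV_I subset_UNIV tendsto_within_subset)
  moreover have "\<forall>\<^sub>F y in at x within interior K. f y = w y"
    using w by (auto simp: eventually_at intro: exI[of _ 1])
  ultimately show "(w \<longlongrightarrow> f x) (at x within interior K)" by (rule Lim_transform_eventually)
qed

lemma affine_partial:
  fixes f :: "real^'n::finite \<Rightarrow> real"
  assumes "\<And>y. y \<in> K \<Longrightarrow> f y = a \<bullet> y + b" "x \<in> interior K"
  shows "partial j f x = a $ j"
proof -
  have "((\<lambda>y. a \<bullet> y + b) has_derivative (\<lambda>h. a \<bullet> h)) (at x)" by (auto intro!: derivative_eq_intros)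
  then have "(f has_derivative (\<lambda>h. a \<bullet> h)) (at x)"
    by (rule has_derivative_transform_within_open[OF _ open_interior assms(2)]) (use assms(1) interior_subset in force)
  then show ?thesis unfolding partial_def by (simp add: frechet_derivative_at[symmetric] inner_axis)
qed

lemma continuous_on_matrix_vector:
  fixes A :: "real^'m^'k"
  shows "continuous_on S f \<Longrightarrow> continuous_on S (\<lambda>x. A *v f x)"
  by (rule bounded_linear.continuous_on[OF matrix_vector_mul_bounded_linear])

text \<open>One mesh and one tent are fixed here; that the constants do not depend on them is
  settled only in the final theorem.\<close>

locale tent = tent_mesh \<Omega> \<H> for \<Omega> :: "(real^'n::finite) set" and \<H> +
  fixes L :: "'n \<Rightarrow> real^'n \<Rightarrow> real^'l^'l::finite" and G B S :: "real^'n \<Rightarrow> real^'l^'l"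
    and chat :: real and p :: nat and vtx :: "real^'n" and \<phi>bot \<phi>top :: "real^'n \<Rightarrow> real"
  assumes L_sym: "\<And>j x. x \<in> \<Omega> \<Longrightarrow> symmetric_matrix (L j x)"
    and L_bounded: "\<And>j. bounded (L j ` \<Omega>)"
    and L_const: "\<And>K j. K \<in> \<H> \<Longrightarrow> L j constant_on interior K"
    and L_div: "distributional_div_zero \<Omega> L"
    and G_sym: "\<And>x. x \<in> \<Omega> \<Longrightarrow> symmetric_matrix (G x)"
    and G_const: "\<And>K. K \<in> \<H> \<Longrightarrow> G constant_on interior K"
    and G_pos: "\<exists>\<gamma>>0. \<forall>x\<in>\<Omega>. \<forall>e. \<gamma> * (norm e)\<^sup>2 \<le> e \<bullet> (G x *v e)"
    and chat: "chat > max_speed \<Omega> L G"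
    and S_meas: "S \<in> borel_measurable (restrict_space borel (interior_skeleton \<Omega> \<H>))"
    and S_bounded: "bounded (S ` interior_skeleton \<Omega> \<H>)"
    and S_psd: "\<And>x. x \<in> interior_skeleton \<Omega> \<H> \<Longrightarrow> positive_semidefinite (S x + transpose (S x))"
    and B_meas: "B \<in> borel_measurable (restrict_space borel (frontier \<Omega>))"
    and B_bounded: "bounded (B ` frontier \<Omega>)"
    and B_psd: "\<And>x. x \<in> frontier \<Omega> \<Longrightarrow> positive_semidefinite (B x + transpose (B x))"
    and causal: "causal_tent chat \<H> vtx \<phi>bot \<phi>top"
begin

abbreviation P where "P \<equiv> vertex_patch \<H> vtx"
abbreviation V :: "(real^'n \<Rightarrow> real^'l) set" where "V \<equiv> Vh p P"
definition \<delta> where "\<delta> x = \<phi>top x - \<phi>bot x"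
text \<open>An arbitrary interior point, at which the constant coefficients and gradients of the
  element are read off.\<close>

definition ctr :: "(real^'n) set \<Rightarrow> real^'n" where "ctr K = (SOME x. x \<in> interior K)"
definition LK where "LK K j = L j (ctr K)"
definition GK where "GK K = G (ctr K)"
definition bot_grad where "bot_grad K = grad \<phi>bot (ctr K)"
definition top_grad where "top_grad K = grad \<phi>top (ctr K)"
text \<open>The affine function on the whole space that agrees with \<open>\<delta>\<close> on
  \<open>K\<close>; it makes integrands continuous everywhere.\<close>

definition \<delta>_ext where "\<delta>_ext K x = (top_grad K - bot_grad K) \<bullet> (x - ctr K) + \<delta> (ctr K)"
definition rep where "rep K w = (SOME f. polynomial_degree_le p f \<and> (\<forall>x\<in>interior K. w x = f x))"
definition M0_mat where "M0_mat K = GK K - (\<Sum>j\<in>UNIV. (bot_grad K $ j) *\<^sub>R LK K j)"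
definition M1_mat where "M1_mat K = (\<Sum>j\<in>UNIV. ((top_grad K - bot_grad K) $ j) *\<^sub>R LK K j)"

lemma P_mesh: "K \<in> P \<Longrightarrow> K \<in> \<H>" by (simp add: vertex_patch_def)
lemma P_simplex: "K \<in> P \<Longrightarrow> int CARD('n) simplex K" using P_mesh elem by blast
lemma finite_P: "finite P" using finite_mesh by (simp add: vertex_patch_def)
lemmas P_body = simplex_body[OF P_simplex]
lemma ctr_interior: "K \<in> P \<Longrightarrow> ctr K \<in> interior K"
  using P_body(3) unfolding ctr_def by (metis ex_in_conv someI)
lemma interior_Omega: "K \<in> P \<Longrightarrow> x \<in> interior K \<Longrightarrow> x \<in> \<Omega>"
  using P_mesh interior_elem by blast
lemma P_disjoint: "K \<in> P \<Longrightarrow> K' \<in> P \<Longrightarrow> x \<in> interior K \<Longrightarrow> x \<in> interior K' \<Longrightarrow> K = K'"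
  using interior_disjoint P_mesh interior_subset by blast

lemma L_eq: "K \<in> P \<Longrightarrow> x \<in> interior K \<Longrightarrow> L j x = LK K j"
  using L_const[OF P_mesh, of K j] ctr_interior[of K] by (auto simp: constant_on_def LK_def)
lemma G_eq: "K \<in> P \<Longrightarrow> x \<in> interior K \<Longrightarrow> G x = GK K"
  using G_const[OF P_mesh, of K] ctr_interior[of K] by (auto simp: constant_on_def GK_def)
lemma LK_sym: "K \<in> P \<Longrightarrow> symmetric_matrix (LK K j)"
  unfolding LK_def using L_sym interior_Omega ctr_interior by blast

lemma tent_affine:
  assumes K: "K \<in> P" and \<phi>: "\<phi> \<in> {\<phi>bot, \<phi>top}"
  shows "x \<in> interior K \<Longrightarrow> partial j \<phi> x = grad \<phi> (ctr K) $ j"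
    and "x \<in> K \<Longrightarrow> \<phi> x = grad \<phi> (ctr K) \<bullet> (x - ctr K) + \<phi> (ctr K)"
proof -
  have "affine_function_on K \<phi>" using causal K \<phi> by (auto simp: causal_tent_def Let_def)
  then obtain a b where ab: "\<And>x. x \<in> K \<Longrightarrow> \<phi> x = a \<bullet> x + b" by (auto simp: affine_function_on_def)
  have g: "grad \<phi> (ctr K) = a"
    using affine_partial[OF ab ctr_interior[OF K]] by (simp add: grad_def vec_eq_iff)
  show "partial j \<phi> x = grad \<phi> (ctr K) $ j" if "x \<in> interior K" using affine_partial[OF ab that] g by simp
  show "\<phi> x = grad \<phi> (ctr K) \<bullet> (x - ctr K) + \<phi> (ctr K)" if "x \<in> K"
  proof -
    have "ctr K \<in> K" using ctr_interior[OF K] interior_subset by blast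
    then show ?thesis using ab[OF that] ab[of "ctr K"] g by (simp add: inner_diff_right)
  qed
qed

lemma \<delta>_ext: "K \<in> P \<Longrightarrow> x \<in> K \<Longrightarrow> \<delta> x = \<delta>_ext K x"
  using tent_affine(2)[of K \<phi>bot x] tent_affine(2)[of K \<phi>top x]
  by (simp add: \<delta>_def \<delta>_ext_def bot_grad_def top_grad_def inner_diff_left)

lemma \<delta>_nonneg: "K \<in> P \<Longrightarrow> x \<in> K \<Longrightarrow> 0 \<le> \<delta> x"
  using causal by (auto simp: causal_tent_def Let_def \<delta>_def)

lemma partial_bot: "K \<in> P \<Longrightarrow> x \<in> interior K \<Longrightarrow> partial j \<phi>bot x = bot_grad K $ j"
  using tent_affine(1)[of K \<phi>bot x j] by (simp add: bot_grad_def)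

lemma partial_\<delta>: 
  assumes "K \<in> P" "x \<in> interior K" shows "partial j (\<lambda>x. \<phi>top x - \<phi>bot x) x = (top_grad K - bot_grad K) $ j"
proof (rule affine_partial[OF _ assms(2)])
  show "\<phi>top y - \<phi>bot y = (top_grad K - bot_grad K) \<bullet> y + (\<delta> (ctr K) - (top_grad K - bot_grad K) \<bullet> ctr K)" if "y \<in> K" for y
    using \<delta>_ext[OF assms(1) that] by (simp add: \<delta>_ext_def \<delta>_def inner_diff_right)
qed

text \<open>\<open>rep K w\<close> is determined on \<open>K\<close> by continuity; its values elsewhere are not used.\<close>

lemma rep:
  assumes "w \<in> V" "K \<in> P"
  shows "polynomial_degree_le p (rep K w)" "x \<in> interior K \<Longrightarrow> w x = rep K w x"
proof -
  have "\<exists>f. polynomial_degree_le p f \<and> (\<forall>x\<in>interior K. w x = f x)" using assms by (auto simp: Vh_def)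
  from someI_ex[OF this] show "polynomial_degree_le p (rep K w)" "x \<in> interior K \<Longrightarrow> w x = rep K w x"
    by (auto simp: rep_def)
qed

lemma V_zero: "w \<in> V \<Longrightarrow> (\<And>K. K \<in> P \<Longrightarrow> x \<notin> interior K) \<Longrightarrow> w x = 0"
  by (auto simp: Vh_def)

lemma rep_cont: "w \<in> V \<Longrightarrow> K \<in> P \<Longrightarrow> continuous_on UNIV (rep K w)"
  using rep(1) polynomial_degree_le_continuous by blast

lemma rep_unique:
  assumes "w \<in> V" "K \<in> P" "continuous_on UNIV f" "\<And>x. x \<in> interior K \<Longrightarrow> w x = f x" "x \<in> K"
  shows "rep K w x = f x"
proof -
  have "rep K w x = f x" if "x \<in> closure (interior K)"
  proof (rule continuous_constant_on_closure[where f="\<lambda>x. rep K w x - f x" and a=0, simplified, OF _ _ that])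
    show "continuous_on (closure (interior K)) (\<lambda>x. rep K w x - f x)"
      using rep_cont[OF assms(1,2)] assms(3) by (intro continuous_intros) (auto intro: continuous_on_subset)
    show "rep K w x = f x" if "x \<in> interior K" for x using assms(4)[OF that] rep(2)[OF assms(1,2) that] by simp
  qed
  then show ?thesis using P_body(5)[OF assms(2)] assms(5) by simp
qed

lemma V_comb:
  assumes "w \<in> V" "z \<in> V" shows "(\<lambda>x. a *\<^sub>R w x + z x) \<in> V"
proof -
  have "\<exists>f. polynomial_degree_le p f \<and> (\<forall>x\<in>interior K. a *\<^sub>R w x + z x = f x)" if "K \<in> P" for K
    using rep[OF assms(1) that] rep[OF assms(2) that]
    by (intro exI[of _ "\<lambda>x. a *\<^sub>R rep K w x + rep K z x"]) (auto intro: polynomial_degree_le_comb)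
  then show ?thesis using assms by (auto simp: Vh_def)
qed

lemma rep_comb:
  assumes "w \<in> V" "z \<in> V" "K \<in> P" "x \<in> K"
  shows "rep K (\<lambda>x. a *\<^sub>R w x + z x) x = a *\<^sub>R rep K w x + rep K z x"
  by (rule rep_unique[OF V_comb[OF assms(1,2)] assms(3) _ _ assms(4)])
     (use rep[OF assms(1,3)] rep[OF assms(2,3)] rep_cont[OF assms(1,3)] rep_cont[OF assms(2,3)] in
       \<open>auto intro!: continuous_intros\<close>)

lemma V_piecewise:
  assumes "w \<in> V" "\<And>K x. K \<in> P \<Longrightarrow> x \<in> interior K \<Longrightarrow> T x = A K *v w x"
    "\<And>x. (\<And>K. K \<in> P \<Longrightarrow> x \<notin> interior K) \<Longrightarrow> T x = 0"
  shows "T \<in> V"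
proof -
  have "\<exists>f. polynomial_degree_le p f \<and> (\<forall>x\<in>interior K. T x = f x)" if "K \<in> P" for K
    using rep[OF assms(1) that] assms(2)[OF that]
    by (intro exI[of _ "\<lambda>x. A K *v rep K w x"]) (auto intro: polynomial_degree_le_matrix)
  then show ?thesis using assms(3) by (auto simp: Vh_def)
qed

lemma trace_rep: "w \<in> V \<Longrightarrow> K \<in> P \<Longrightarrow> x \<in> K \<Longrightarrow> facet_trace K w x = rep K w x"
  using facet_trace_eq[OF P_body(5), of K x "rep K w" w] rep rep_cont by blast

lemma trace_flux:
  assumes "K \<in> P" "x \<in> K" shows "facet_trace K (flux_matrix L \<nu>) x = (\<Sum>j\<in>UNIV. (\<nu> $ j) *\<^sub>R LK K j)"
  using facet_trace_eq[OF P_body(5)[OF assms(1)] assms(2), of "\<lambda>_. \<Sum>j\<in>UNIV. (\<nu> $ j) *\<^sub>R LK K j" "flux_matrix L \<nu>"]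
    L_eq[OF assms(1)] by (simp add: flux_matrix_def)

text \<open>Frontiers are null sets and interiors are disjoint, so almost every point lies in
  exactly one element of the patch or in none.\<close>

lemma patch_integral:
  fixes h :: "(real^'n) set \<Rightarrow> real^'n \<Rightarrow> real"
  assumes h: "\<And>K. K \<in> P \<Longrightarrow> continuous_on UNIV (h K)"
    and f: "\<And>K x. K \<in> P \<Longrightarrow> x \<in> interior K \<Longrightarrow> f x = h K x"
    and f0: "\<And>x. (\<And>K. K \<in> P \<Longrightarrow> x \<notin> interior K) \<Longrightarrow> f x = 0"
  shows "(LINT x:\<Union>P|lebesgue. f x) = (\<Sum>K\<in>P. LINT x:K|lebesgue. h K x)"
proof -
  have fr: "AE x in lebesgue. x \<notin> frontier K" if "K \<in> P" for K
    using P_body(6)[OF that] by (simp add: negligible_iff_null_sets AE_not_in)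
  then have "AE x in lebesgue. \<forall>K\<in>P. x \<notin> frontier K" using finite_P by (intro AE_finite_allI)
  then have "(LINT x:\<Union>P|lebesgue. f x) = (LINT x|lebesgue. (\<Sum>K\<in>P. indicator K x *\<^sub>R h K x))"
    unfolding set_lebesgue_integral_def
  proof (intro integral_lebesgue_spike, eventually_elim)
    case (elim x)
    have int: "x \<in> interior K" if "K \<in> P" "x \<in> K" for K
      using elim that closure_subset by (auto simp: frontier_def)
    show ?case
    proof (cases "\<exists>K\<in>P. x \<in> interior K")
      case True
      then obtain K where K: "K \<in> P" "x \<in> interior K" by blast
      have "(\<Sum>K'\<in>P. indicator K' x *\<^sub>R h K' x) = (\<Sum>K'\<in>P. if K' = K then f x else 0)"
      proof (rule sum.cong[OF refl])
        fix K' assume K': "K' \<in> P"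
        show "indicator K' x *\<^sub>R h K' x = (if K' = K then f x else 0)"
        proof (cases "K' = K")
          case True
          have "x \<in> K" using K(2) interior_subset by blast
          then show ?thesis using True f[OF K] by simp
        next
          case False
          then have "x \<notin> K'" using int[OF K'] P_disjoint[OF K' K(1) _ K(2)] by blast
          then show ?thesis using False by simp
        qed
      qed
      moreover have "x \<in> \<Union>P" using K interior_subset by blast
      ultimately show ?thesis using K(1) finite_P by simp
    next
      case False
      then have "f x = 0" using f0 by blast
      moreover have "(\<Sum>K\<in>P. indicator K x *\<^sub>R h K x) = 0"
      proof (rule sum.neutral, rule ballI)
        fix K assume "K \<in> P"
        then have "x \<notin> K" using False int by blast
        then show "indicator K x *\<^sub>R h K x = 0" by simp
      qed
      ultimately show ?thesis by simp
    qed
  qed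
  also have "\<dots> = (\<Sum>K\<in>P. LINT x:K|lebesgue. h K x)"
    unfolding set_lebesgue_integral_def
    using elem_integrable[OF P_body(1) h] by (intro Bochner_Integration.integral_sum) (auto simp: set_integrable_def)
  finally show ?thesis .
qed

lemma patch_inner_eq:
  assumes "w \<in> V" "z \<in> V" "\<And>K x. K \<in> P \<Longrightarrow> x \<in> interior K \<Longrightarrow> u x = A K *v w x"
  shows "patch_inner P u z = (\<Sum>K\<in>P. LINT x:K|lebesgue. (A K *v rep K w x) \<bullet> rep K z x)"
  unfolding patch_inner_def
proof (rule patch_integral)
  show "continuous_on UNIV (\<lambda>x. (A K *v rep K w x) \<bullet> rep K z x)" if "K \<in> P" for K
    using rep_cont assms that by (intro continuous_intros continuous_on_matrix_vector) auto
  show "u x \<bullet> z x = (A K *v rep K w x) \<bullet> rep K z x" if "K \<in> P" "x \<in> interior K" for K x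
    using assms(3)[OF that] rep(2)[OF assms(1) that] rep(2)[OF assms(2) that] by simp
  show "u x \<bullet> z x = 0" if "\<And>K. K \<in> P \<Longrightarrow> x \<notin> interior K" for x using V_zero[OF assms(2) that] by simp
qed

lemma zero_V: "(\<lambda>x. 0) \<in> V"
  using polynomial_degree_le_zero[of p] by (auto simp: Vh_def)

text \<open>Covers both inner products in use, with \<open>A K\<close> the identity or
  \<open>M0_mat K\<close>. For definiteness, a nonzero \<open>w\<close> is nonzero at a point inside
  an element, where the continuous integrand is positive.\<close>

lemma fun_inner_piecewise:
  assumes T: "\<And>K x w. w \<in> V \<Longrightarrow> K \<in> P \<Longrightarrow> x \<in> interior K \<Longrightarrow> T w x = A K *v w x"
    and sym: "\<And>K. K \<in> P \<Longrightarrow> symmetric_matrix (A K)"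
    and pos: "\<And>K e. K \<in> P \<Longrightarrow> e \<noteq> 0 \<Longrightarrow> 0 < e \<bullet> (A K *v e)"
  shows "fun_inner V (\<lambda>w z. patch_inner P (T w) z)"
proof
  have eq: "patch_inner P (T w) z = (\<Sum>K\<in>P. LINT x:K|lebesgue. (A K *v rep K w x) \<bullet> rep K z x)"
    if "w \<in> V" "z \<in> V" for w z
    using patch_inner_eq[OF that T[OF that(1)]] .
  have cont: "continuous_on UNIV (\<lambda>x. (A K *v rep K w x) \<bullet> rep K z x)" if "w \<in> V" "z \<in> V" "K \<in> P" for w z K
    using rep_cont that by (intro continuous_intros continuous_on_matrix_vector) auto
  show "(\<lambda>x. 0) \<in> V" by (rule zero_V)
  show "(\<lambda>x. a *\<^sub>R w x + z x) \<in> V" if "w \<in> V" "z \<in> V" for w z a using that by (rule V_comb)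
  show "patch_inner P (T (\<lambda>x. a *\<^sub>R w x + z x)) u = a * patch_inner P (T w) u + patch_inner P (T z) u"
    if w: "w \<in> V" "z \<in> V" "u \<in> V" for w z u a
  proof -
    have "(LINT x:K|lebesgue. (A K *v rep K (\<lambda>x. a *\<^sub>R w x + z x) x) \<bullet> rep K u x) =
      a * (LINT x:K|lebesgue. (A K *v rep K w x) \<bullet> rep K u x) + (LINT x:K|lebesgue. (A K *v rep K z x) \<bullet> rep K u x)"
      if K: "K \<in> P" for K
    proof (rule elem_integral_comb[OF P_body(1,2)[OF K]])
      fix x assume "x \<in> interior K"
      then have "x \<in> K" using interior_subset by blast
      from rep_comb[OF w(1,2) K this]
      show "(A K *v rep K (\<lambda>x. a *\<^sub>R w x + z x) x) \<bullet> rep K u x = a * ((A K *v rep K w x) \<bullet> rep K u x) + (A K *v rep K z x) \<bullet> rep K u x"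
        by (simp add: matrix_vector_right_distrib matrix_vector_mult_scaleR inner_add_left)
    qed (use cont w K in blast)+
    then show ?thesis
      using w by (simp add: eq V_comb sum.distrib sum_distrib_left)
  qed
  show "patch_inner P (T w) z = patch_inner P (T z) w" if w: "w \<in> V" "z \<in> V" for w z
    using w sym by (simp add: eq symmetric_matrix_inner inner_commute cong: sum.cong)
  show "0 < patch_inner P (T w) w" if w: "w \<in> V" "w \<noteq> (\<lambda>x. 0)" for w
  proof -
    obtain x where x: "w x \<noteq> 0" using w(2) by (auto simp: fun_eq_iff)
    then obtain K where K: "K \<in> P" "x \<in> interior K" using V_zero[OF w(1)] by blast
    have nn: "0 \<le> (A K *v e) \<bullet> e" if "K \<in> P" for K e
      using pos[OF that, of e] by (cases "e = 0") (auto simp: inner_commute)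
    have "0 < (LINT x:K|lebesgue. (A K *v rep K w x) \<bullet> rep K w x)"
      using pos[OF K(1), of "rep K w x"] rep(2)[OF w(1) K] x
      by (intro elem_integral_pos[OF P_body(1)[OF K(1)] cont[OF w(1) w(1) K(1)] nn[OF K(1)] K(2)]) (auto simp: inner_commute)
    moreover have "0 \<le> (LINT x:K'|lebesgue. (A K' *v rep K' w x) \<bullet> rep K' w x)" if "K' \<in> P" for K'
      using nn[OF that] by (intro elem_integral_nonneg)
    ultimately show ?thesis
      unfolding eq[OF w(1) w(1)] using K(1) finite_P by (intro sum_pos2[where i=K]) auto
  qed
qed

text \<open>The family consists of monomials times unit vectors, each cut off to the interior of one
  element.\<close>

lemma Vh_spanned:
  assumes "fun_inner V ip"
  obtains I :: "((real^'n) set \<times> ('n \<Rightarrow> nat) \<times> 'l) set" and bs where "fun_inner.spanned_by V I bs"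
proof -
  let ?M = "{\<alpha> :: 'n \<Rightarrow> nat. (\<Sum>i\<in>UNIV. \<alpha> i) \<le> p}"
  have fM: "finite ?M" by (rule finite_multiindices)
  define I :: "((real^'n) set \<times> ('n \<Rightarrow> nat) \<times> 'l) set" where "I = P \<times> ?M \<times> UNIV"
  define mon where "mon \<alpha> x = (\<Prod>i\<in>UNIV. (x $ i) ^ \<alpha> i)" for \<alpha> and x :: "real^'n"
  define bs :: "((real^'n) set \<times> ('n \<Rightarrow> nat) \<times> 'l) \<Rightarrow> real^'n \<Rightarrow> real^'l" where "bs = (\<lambda>(K, \<alpha>, l) x. if x \<in> interior K then mon \<alpha> x *\<^sub>R axis l 1 else 0)"
  have "bs (K, \<alpha>, l) \<in> V" if "K \<in> P" "\<alpha> \<in> ?M" for K \<alpha> l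
  proof -
    have "polynomial_degree_le p (\<lambda>x. mon \<alpha> x *\<^sub>R axis l 1 :: real^'l)"
      unfolding polynomial_degree_le_def
    proof (intro exI[of _ "\<lambda>\<beta>. if \<beta> = \<alpha> then axis l 1 else 0"] allI)
      fix x
      have "(\<Sum>\<beta>\<in>?M. mon \<beta> x *\<^sub>R (if \<beta> = \<alpha> then axis l 1 else 0)) =
        (\<Sum>\<beta>\<in>?M. if \<beta> = \<alpha> then mon \<alpha> x *\<^sub>R (axis l 1 :: real^'l) else 0)"
        by (intro sum.cong) auto
      then show "mon \<alpha> x *\<^sub>R (axis l 1 :: real^'l) = (\<Sum>\<beta>\<in>?M. (\<Prod>i\<in>UNIV. (x $ i) ^ \<beta> i) *\<^sub>R (if \<beta> = \<alpha> then axis l 1 else 0))"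
        using that(2) fM by (simp add: mon_def)
    qed
    then have "\<exists>f. polynomial_degree_le p f \<and> (\<forall>x\<in>interior K'. bs (K, \<alpha>, l) x = f x)" if "K' \<in> P" for K'
    proof (cases "K' = K")
      case False
      then have "\<forall>x\<in>interior K'. bs (K, \<alpha>, l) x = 0" using P_disjoint[OF that \<open>K \<in> P\<close>] by (auto simp: bs_def)
      then show ?thesis using polynomial_degree_le_zero by (intro exI[of _ "\<lambda>x. 0"]) auto
    qed (auto simp: bs_def)
    moreover have "bs (K, \<alpha>, l) x = 0" if "\<And>K. K \<in> P \<Longrightarrow> x \<notin> interior K" for x
      using that \<open>K \<in> P\<close> by (simp add: bs_def)
    ultimately show ?thesis by (auto simp: Vh_def)
  qed
  then have 1: "bs ` I \<subseteq> V" by (auto simp: I_def)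
  have 2: "\<exists>c. w = (\<lambda>x. \<Sum>i\<in>I. c i *\<^sub>R bs i x)" if w: "w \<in> V" for w
  proof -
    have "\<forall>K\<in>P. \<exists>c. \<forall>x. rep K w x = (\<Sum>\<alpha>\<in>?M. mon \<alpha> x *\<^sub>R c \<alpha>)"
      using rep(1)[OF w] by (simp add: polynomial_degree_le_def mon_def)
    from bchoice[OF this] obtain c where
      c: "\<And>K x. K \<in> P \<Longrightarrow> rep K w x = (\<Sum>\<alpha>\<in>?M. mon \<alpha> x *\<^sub>R c K \<alpha>)"
      by blast
    define d where "d = (\<lambda>(K, \<alpha>, l). c K \<alpha> $ l)"
    have "w x = (\<Sum>i\<in>I. d i *\<^sub>R bs i x)" for x
    proof -
      have "(\<Sum>i\<in>I. d i *\<^sub>R bs i x) = (\<Sum>K\<in>P. \<Sum>\<alpha>\<in>?M. \<Sum>l\<in>UNIV. d (K, \<alpha>, l) *\<^sub>R bs (K, \<alpha>, l) x)"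
        unfolding I_def by (simp add: sum.cartesian_product case_prod_beta')
      also have "\<dots> = (\<Sum>K\<in>P. if x \<in> interior K then rep K w x else 0)"
      proof (rule sum.cong[OF refl])
        fix K assume K: "K \<in> P"
        have "(\<Sum>l\<in>UNIV. d (K, \<alpha>, l) *\<^sub>R (mon \<alpha> x *\<^sub>R axis l 1)) = mon \<alpha> x *\<^sub>R c K \<alpha>" for \<alpha>
          by (simp add: vec_eq_iff axis_def d_def if_distrib[of "\<lambda>y. _ * y"] sum.delta cong: if_cong)
        then show "(\<Sum>\<alpha>\<in>?M. \<Sum>l\<in>UNIV. d (K, \<alpha>, l) *\<^sub>R bs (K, \<alpha>, l) x) = (if x \<in> interior K then rep K w x else 0)"
          by (simp add: bs_def c[OF K])
      qed
      also have "\<dots> = w x"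
      proof (cases "\<exists>K\<in>P. x \<in> interior K")
        case True
        then obtain K where K: "K \<in> P" "x \<in> interior K" by blast
        have "(\<Sum>K'\<in>P. if x \<in> interior K' then rep K' w x else 0) = (\<Sum>K'\<in>P. if K' = K then w x else 0)"
        proof (rule sum.cong[OF refl])
          fix K' assume "K' \<in> P"
          then have "x \<in> interior K' \<longleftrightarrow> K' = K" using P_disjoint[OF _ K(1) _ K(2)] K by blast
          then show "(if x \<in> interior K' then rep K' w x else 0) = (if K' = K then w x else 0)"
            using rep(2)[OF w K] by simp
        qed
        then show ?thesis using K(1) finite_P by simp
      next
        case False
        then show ?thesis using V_zero[OF w, of x] by auto
      qed
      finally show ?thesis ..
    qed
    then show ?thesis by blast
  qed
  have "finite I" unfolding I_def using finite_P fM by (intro finite_cartesian_product) auto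
  with 1 2 have "fun_inner.spanned_by V I bs" unfolding fun_inner.spanned_by_def[OF assms] by blast
  then show ?thesis by (rule that)
qed

lemma M0_mat_sym: "K \<in> P \<Longrightarrow> symmetric_matrix (M0_mat K)"
  unfolding M0_mat_def GK_def using G_sym[OF interior_Omega[OF _ ctr_interior]] LK_sym
  by (intro symmetric_matrix_diff symmetric_matrix_sum) auto

text \<open>Causality makes the flux in the direction of the bottom gradient at most
  \<open>max_speed / chat < 1\<close> times the form of \<open>G\<close>.\<close>

lemma M0_mat_pos:
  assumes K: "K \<in> P" and e: "e \<noteq> 0" shows "0 < e \<bullet> (M0_mat K *v e)"
proof -
  let ?c = "max_speed \<Omega> L G"
  obtain \<gamma> where \<gamma>: "\<gamma> > 0" "\<And>x e. x \<in> \<Omega> \<Longrightarrow> \<gamma> * (norm e)\<^sup>2 \<le> e \<bullet> (G x *v e)" using G_pos by blast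
  have x: "ctr K \<in> \<Omega>" using interior_Omega ctr_interior K by blast
  note ms = max_speed_bound[where \<Omega>=\<Omega> and L=L and G=G, OF L_sym L_bounded G_sym \<gamma> x]
  have g: "norm (bot_grad K) \<le> 1 / chat"
    using causal K ctr_interior[OF K] by (auto simp: causal_tent_def Let_def bot_grad_def)
  have Ge: "0 < e \<bullet> (G (ctr K) *v e)" using \<gamma>(1) \<gamma>(2)[OF x, of e] e by (smt (verit) mult_pos_pos zero_less_norm_iff zero_less_power)
  have "\<bar>e \<bullet> (flux_matrix L (bot_grad K) (ctr K) *v e)\<bar> \<le> norm (bot_grad K) * (?c * (e \<bullet> (G (ctr K) *v e)))"
    by (rule ms(2))
  also have "\<dots> \<le> 1 / chat * (?c * (e \<bullet> (G (ctr K) *v e)))"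
    using g ms(1) Ge by (intro mult_right_mono) auto
  also have "\<dots> = (?c / chat) * (e \<bullet> (G (ctr K) *v e))" by simp
  also have "\<dots> < 1 * (e \<bullet> (G (ctr K) *v e))"
    using chat ms(1) Ge by (intro mult_strict_right_mono) auto
  finally have "e \<bullet> (flux_matrix L (bot_grad K) (ctr K) *v e) < e \<bullet> (G (ctr K) *v e)" by simp
  then show ?thesis
    by (simp add: M0_mat_def GK_def LK_def flux_matrix_def matrix_vector_mult_diff_rdistrib inner_diff_right)
qed

lemma M0op_eq: "K \<in> P \<Longrightarrow> x \<in> interior K \<Longrightarrow> M0op L G \<phi>bot w x = M0_mat K *v w x"
  by (simp add: M0op_def M0_mat_def G_eq L_eq partial_bot matrix_vector_mult_diff_rdistrib sum_scaleR_matrix_vector)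

lemma M1op_eq: "K \<in> P \<Longrightarrow> x \<in> interior K \<Longrightarrow> M1op L (\<lambda>x. \<phi>top x - \<phi>bot x) w x = M1_mat K *v w x"
  unfolding M1op_def M1_mat_def sum_scaleR_matrix_vector by (simp only: L_eq partial_\<delta>)

lemma M0op_V: "w \<in> V \<Longrightarrow> M0op L G \<phi>bot w \<in> V"
  by (rule V_piecewise[where A=M0_mat]) (auto simp: M0op_eq, simp add: M0op_def V_zero)

lemma M1op_V: "w \<in> V \<Longrightarrow> M1op L (\<lambda>x. \<phi>top x - \<phi>bot x) w \<in> V"
  by (rule V_piecewise[where A=M1_mat]) (auto simp: M1op_eq, simp add: M1op_def V_zero)

text \<open>Definite matrices are invertible, and applying the inverse on each element preserves
  piecewise polynomials.\<close>

lemma M0op_surj: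
  assumes u: "u \<in> V" shows "\<exists>w\<in>V. M0op L G \<phi>bot w = u"
proof -
  have "\<exists>A'. M0_mat K ** A' = mat 1" if "K \<in> P" for K
  proof -
    have "\<forall>e. M0_mat K *v e = 0 \<longrightarrow> e = 0" using M0_mat_pos[OF that] by (metis inner_zero_right less_irrefl)
    then show ?thesis using matrix_left_invertible_ker matrix_left_right_inverse by metis
  qed
  then obtain A' where A': "\<And>K. K \<in> P \<Longrightarrow> M0_mat K ** A' K = mat 1" by metis
  define w where "w x = (if \<exists>K\<in>P. x \<in> interior K then A' (THE K. K \<in> P \<and> x \<in> interior K) *v u x else 0)" for x
  have wK: "w x = A' K *v u x" if "K \<in> P" "x \<in> interior K" for K x
  proof -
    have "(THE K. K \<in> P \<and> x \<in> interior K) = K"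
      by (rule the_equality) (use that P_disjoint in blast)+
    then show ?thesis using that by (auto simp: w_def)
  qed
  have wV: "w \<in> V" by (rule V_piecewise[OF u wK]) (auto simp: w_def)
  have "M0op L G \<phi>bot w x = u x" for x
  proof (cases "\<exists>K\<in>P. x \<in> interior K")
    case True
    then obtain K where "K \<in> P" "x \<in> interior K" by blast
    then show ?thesis using A' by (simp add: M0op_eq wK matrix_vector_mul_assoc)
  next
    case False
    then show ?thesis using V_zero[OF u, of x] by (auto simp: M0op_def w_def)
  qed
  then show ?thesis using wV by blast
qed

lemma M0op_inj: assumes "w \<in> V" "z \<in> V" "M0op L G \<phi>bot w = M0op L G \<phi>bot z" shows "w = z"
proof
  fix x
  show "w x = z x"
  proof (cases "\<exists>K\<in>P. x \<in> interior K")
    case True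
    then obtain K where K: "K \<in> P" "x \<in> interior K" by blast
    then have "M0_mat K *v (w x - z x) = 0"
      using fun_cong[OF assms(3), of x] by (simp add: M0op_eq matrix_vector_mult_diff_distrib)
    then show ?thesis using M0_mat_pos[OF K(1), of "w x - z x"] by fastforce
  next
    case False
    then show ?thesis using V_zero[OF assms(1), of x] V_zero[OF assms(2), of x] by auto
  qed
qed

lemma M0op_comb: "M0op L G \<phi>bot (\<lambda>x. a *\<^sub>R w x + z x) = (\<lambda>x. a *\<^sub>R M0op L G \<phi>bot w x + M0op L G \<phi>bot z x)"
  by (simp add: M0op_def fun_eq_iff matrix_vector_right_distrib matrix_vector_mult_scaleR
      sum.distrib scaleR_add_right scaleR_sum_right scaleR_diff_right mult.commute)

lemma M1op_comb: "M1op L d (\<lambda>x. a *\<^sub>R w x + z x) = (\<lambda>x. a *\<^sub>R M1op L d w x + M1op L d z x)"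
  by (simp add: M1op_def fun_eq_iff matrix_vector_right_distrib matrix_vector_mult_scaleR
      sum.distrib scaleR_add_right scaleR_sum_right mult.commute)

lemma fun_inner_M0: "fun_inner V (\<lambda>w z. patch_inner P (M0op L G \<phi>bot w) z)"
  by (rule fun_inner_piecewise[where A=M0_mat]) (auto simp: M0op_eq M0_mat_sym M0_mat_pos)

lemma fun_inner_L2: "fun_inner V (patch_inner P)"
proof -
  have "fun_inner V (\<lambda>w z. patch_inner P (id w) z)"
    by (rule fun_inner_piecewise[where A="\<lambda>_. mat 1"]) (auto simp: symmetric_matrix_def transpose_mat)
  then show ?thesis by simp
qed

end

section \<open>The DG form\<close>

lemma bounded_borel_facet_mult:
  assumes "bounded_borel_support (\<lambda>x. indicator F x * f x)" "bounded_borel_support (\<lambda>x. indicator F x * g x)"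
  shows "bounded_borel_support (\<lambda>x. indicator F x * (f x * g x))"
proof -
  obtain B R where f: "(\<lambda>x. indicator F x * f x) \<in> borel_measurable borel" "0 \<le> B" "\<And>x. \<bar>indicator F x * f x\<bar> \<le> B"
    "\<And>x. indicator F x * f x \<noteq> 0 \<Longrightarrow> norm x \<le> R"
    using bounded_borel_supportE[OF assms(1)] by metis
  obtain B' where g: "(\<lambda>x. indicator F x * g x) \<in> borel_measurable borel" "0 \<le> B'" "\<And>x. \<bar>indicator F x * g x\<bar> \<le> B'"
    using bounded_borel_supportE[OF assms(2)] by metis
  have eq: "indicator F x * (f x * g x) = (indicator F x * f x) * (indicator F x * g x)" for x
    by (simp add: indicator_def)
  show ?thesis
  proof (rule bounded_borel_supportI[where B="B * B'" and R=R])
    show "(\<lambda>x. indicator F x * (f x * g x)) \<in> borel_measurable borel"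
      unfolding eq using f(1) g(1) by (rule borel_measurable_times)
    show "\<bar>indicator F x * (f x * g x)\<bar> \<le> B * B'" for x
      unfolding eq abs_mult[of "indicator F x * f x"] using f g by (intro mult_mono) auto
    show "norm x \<le> R" if "indicator F x * (f x * g x) \<noteq> 0" for x using that f(4)[of x] by auto
  qed
qed

lemma bounded_borel_facet_add:
  "bounded_borel_support (\<lambda>x. indicator F x * f x) \<Longrightarrow> bounded_borel_support (\<lambda>x. indicator F x * g x) \<Longrightarrow>
    bounded_borel_support (\<lambda>x. indicator F x * (f x + g x))"
  using bounded_borel_support_add[of "\<lambda>x. indicator F x * f x" "\<lambda>x. indicator F x * g x"] by (simp add: distrib_left)

lemma bounded_borel_facet_cmult:
  "bounded_borel_support (\<lambda>x. indicator F x * f x) \<Longrightarrow> bounded_borel_support (\<lambda>x. indicator F x * (a * f x))"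
  using bounded_borel_support_cmult[of "\<lambda>x. indicator F x * f x" a] by (simp add: mult.left_commute)

lemma bounded_borel_facet_sum:
  "(\<And>i. i \<in> I \<Longrightarrow> bounded_borel_support (\<lambda>x. indicator F x * f i x)) \<Longrightarrow>
    bounded_borel_support (\<lambda>x. indicator F x * (\<Sum>i\<in>I. f i x))"
  using bounded_borel_support_sum[of I "\<lambda>i x. indicator F x * f i x"] by (simp add: sum_distrib_left)

lemma bounded_borel_facet_borel:
  assumes "compact F" "f \<in> borel_measurable borel" "\<And>x. \<bar>f x\<bar> \<le> B"
  shows "bounded_borel_support (\<lambda>x. indicator F x * f x)"
proof -
  obtain R where R: "\<And>x. x \<in> F \<Longrightarrow> norm x \<le> R"
    using compact_imp_bounded[OF assms(1)] by (auto simp: bounded_iff)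
  have [measurable]: "f \<in> borel_measurable borel" "F \<in> sets borel"
    using assms(1,2) by (auto intro: borel_closed compact_imp_closed)
  have B: "0 \<le> B" using assms(3)[of undefined] by linarith
  show ?thesis
  proof (rule bounded_borel_supportI[where B=B and R=R])
    show "\<bar>indicator F x * f x\<bar> \<le> B" for x using assms(3)[of x] B by (auto simp: indicator_def)
    show "norm x \<le> R" if "indicator F x * f x \<noteq> 0" for x using that R by (auto simp: indicator_def split: if_splits)
  qed measurable
qed

text \<open>\<open>M\<close> will be \<open>B\<close> or \<open>S\<close>, which are merely bounded
  and measurable, whereas the traces are continuous.\<close>

lemma bounded_borel_facet_bilinear:
  fixes M :: "real^'n::finite \<Rightarrow> real^'l^'m::finite" and u :: "real^'n \<Rightarrow> real^'l::finite"
  assumes F: "compact F" and M: "M \<in> borel_measurable borel" "\<And>x. norm (M x) \<le> C"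
    and u: "continuous_on UNIV u" "continuous_on UNIV v"
  shows "bounded_borel_support (\<lambda>x. indicator F x * ((M x *v u x) \<bullet> v x))"
proof -
  have eq: "(M x *v u x) \<bullet> v x = (\<Sum>i\<in>UNIV. \<Sum>j\<in>UNIV. M x $ i $ j * (u x $ j * v x $ i))" for x
    by (simp add: inner_vec_def matrix_vector_mult_def sum_distrib_right mult.assoc)
  show ?thesis unfolding eq
  proof (intro bounded_borel_facet_sum bounded_borel_facet_mult)
    fix i j
    show "bounded_borel_support (\<lambda>x. indicator F x * (u x $ j))" "bounded_borel_support (\<lambda>x. indicator F x * (v x $ i))"
      using F u by (auto intro!: bounded_borel_support_compact continuous_intros)
    show "bounded_borel_support (\<lambda>x. indicator F x * (M x $ i $ j))"
    proof (rule bounded_borel_facet_borel[OF F])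
      have "(\<lambda>A::real^'l^'m. A $ i $ j) \<in> borel_measurable borel"
        by (intro borel_measurable_continuous_onI continuous_intros)
      then show "(\<lambda>x. M x $ i $ j) \<in> borel_measurable borel" using M(1) by (rule measurable_compose_rev)
      show "\<bar>M x $ i $ j\<bar> \<le> C" for x
        using component_le_norm_cart[of "M x $ i" j] Finite_Cartesian_Product.norm_nth_le[of "M x" i] M(2)[of x] by linarith
    qed
  qed
qed

lemma bounded_borel_support_cong:
  assumes "bounded_borel_support f" "\<And>x. f x = g x" shows "bounded_borel_support g"
  using assms by (metis ext)

context tent begin

lemma \<delta>_fun: "(\<lambda>x. \<phi>top x - \<phi>bot x) = \<delta>" by (simp add: \<delta>_def fun_eq_iff)

text \<open>\<open>neighbor_elem K F\<close> is \<open>K\<close> itself where there is no neighbor in the patch. There either \<open>\<delta>\<close>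
  vanishes or the facet lies in the boundary of \<open>\<Omega>\<close>, so \<open>flux_density\<close> is the integrand of the DG form
  although \<open>numerical_flux\<close> then reads the trace of an unspecified element.\<close>

definition neighbor_elem where
  "neighbor_elem K F = (if \<exists>K'\<in>P. K' \<noteq> K \<and> F facet_of K' then neighbor P K F else K)"

definition normal_flux where "normal_flux K F = (\<Sum>j\<in>UNIV. (outward_normal K F $ j) *\<^sub>R LK K j)"

definition flux_density where
  "flux_density K F w z x = \<delta> x * ((if x \<in> frontier \<Omega> then (1/2) *\<^sub>R ((normal_flux K F + B x) *v rep K w x)
     else normal_flux K F *v ((1/2) *\<^sub>R (rep K w x + rep (neighbor_elem K F) w x)) + S x *v (rep K w x - rep (neighbor_elem K F) w x)) \<bullet> rep K z x)"

lemma facet_subset: "K \<in> P \<Longrightarrow> F facet_of K \<Longrightarrow> F \<subseteq> K"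
  by (simp add: facet_of_imp_subset)

lemma flat: "K \<in> P \<Longrightarrow> F facet_of K \<Longrightarrow> flat_facet (outward_normal K F) F"
  using simplex_facet(1) P_simplex by blast

lemma finite_facets: "K \<in> P \<Longrightarrow> finite {F. F facet_of K}"
  using simplex_facet(5)[OF P_simplex] by (cases "{F. F facet_of K} = {}") auto

lemma compact_facet: "K \<in> P \<Longrightarrow> F facet_of K \<Longrightarrow> compact F"
  using flat by (auto simp: flat_facet_def)

text \<open>\<open>F\<close> is opposite to \<open>vtx\<close>, so at all its vertices bottom and
  top agree; the zero set of the affine \<open>\<delta>_ext K\<close> is convex and contains their
  hull.\<close>

lemma \<delta>_zero:
  assumes K: "K \<in> P" and F: "F facet_of K" "vtx \<notin> F" and x: "x \<in> F"
  shows "\<delta> x = 0"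
proof -
  obtain C g b where "barycentric K C g b" using simplex_barycentric[OF P_simplex[OF K]] .
  then interpret barycentric K C g b .
  obtain u where u: "u \<in> C" "F = fct u" using facets F(1) by blast
  have "vtx \<in> C" using K vertices by (simp add: vertex_patch_def)
  then have "vtx = u" using F(2) u by (auto simp: fct_def intro: hull_inc)
  have "\<delta>_ext K w = 0" if "w \<in> C - {u}" for w
  proof -
    have "w \<in> mesh_vertices P - {vtx}" using that K vertices \<open>vtx = u\<close> by (auto simp: mesh_vertices_def)
    then have "\<delta> w = 0" using causal by (auto simp: causal_tent_def Let_def \<delta>_def)
    then show ?thesis using \<delta>_ext[OF K vertex_in_K] that by simp
  qed
  then have "C - {u} \<subseteq> {y. \<delta>_ext K y = 0}" by auto
  moreover have "convex {y. \<delta>_ext K y = 0}"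
  proof -
    have "{y. \<delta>_ext K y = 0} = {y. (top_grad K - bot_grad K) \<bullet> y = (top_grad K - bot_grad K) \<bullet> ctr K - \<delta> (ctr K)}"
      by (auto simp: \<delta>_ext_def inner_diff_right)
    then show ?thesis by (simp add: convex_hyperplane)
  qed
  ultimately have "fct u \<subseteq> {y. \<delta>_ext K y = 0}" unfolding fct_def by (rule hull_minimal)
  then have "\<delta>_ext K x = 0" using x u(2) by blast
  moreover have "x \<in> K" using x facet_subset[OF K F(1)] by blast
  ultimately show ?thesis using \<delta>_ext[OF K] by simp
qed

lemma neighbor_elem_eq:
  assumes K: "K \<in> P" "K' \<in> P" "K' \<noteq> K" and F: "F facet_of K" "F facet_of K'"
  shows "neighbor P K F = K'" "neighbor_elem K F = K'"
proof -
  show "neighbor P K F = K'"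
    unfolding neighbor_def
  proof (rule the_equality)
    show "K'' = K'" if "K'' \<in> P \<and> K'' \<noteq> K \<and> F facet_of K''" for K''
      using neighbor_unique[of K K'' K' F] that K F P_mesh by blast
  qed (use K F in auto)
  then show "neighbor_elem K F = K'" using K F by (auto simp: neighbor_elem_def)
qed

lemma neighbor_elem_facet:
  assumes "K \<in> P" "F facet_of K" shows "neighbor_elem K F \<in> P" "F facet_of neighbor_elem K F"
proof -
  consider K' where "K' \<in> P" "K' \<noteq> K" "F facet_of K'" | "neighbor_elem K F = K"
    by (cases "\<exists>K'\<in>P. K' \<noteq> K \<and> F facet_of K'") (blast, simp add: neighbor_elem_def)
  then have "neighbor_elem K F \<in> P \<and> F facet_of neighbor_elem K F"
    using neighbor_elem_eq(2)[OF assms(1) _ _ assms(2)] assms by cases auto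
  then show "neighbor_elem K F \<in> P" "F facet_of neighbor_elem K F" by auto
qed

text \<open>An extreme point of a face is one of the element, so a neighbor across a facet through
  \<open>vtx\<close> belongs to the patch again.\<close>

lemma vtx_neighbor:
  assumes K: "K \<in> P" and F: "F facet_of K" "\<not> F \<subseteq> frontier \<Omega>" "vtx \<in> F"
  shows "\<exists>K'\<in>P. K' \<noteq> K \<and> F facet_of K'"
proof -
  obtain K' where K': "K' \<in> \<H>" "K' \<noteq> K" "F facet_of K'"
    using neighbor_exists[OF P_mesh[OF K] F(1,2)] by blast
  have "vtx extreme_point_of F"
    using K F(1,3) by (auto simp: vertex_patch_def facet_of_def extreme_point_of_face)
  then have "vtx extreme_point_of K'" using K'(3) by (auto simp: facet_of_def extreme_point_of_face)
  then show ?thesis using K' by (auto simp: vertex_patch_def)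
qed

lemma numerical_flux_density:
  assumes w: "w \<in> V" "z \<in> V" and K: "K \<in> P" and F: "F facet_of K" and x: "x \<in> F"
  shows "(\<delta> x *\<^sub>R numerical_flux \<Omega> L S B P w K F x) \<bullet> facet_trace K z x = flux_density K F w z x"
proof -
  have xK: "x \<in> K" using x facet_subset[OF K F] by blast
  note tr = trace_rep[OF w(1) K xK] trace_rep[OF w(2) K xK] trace_flux[OF K xK]
  consider "\<delta> x = 0" | "x \<in> frontier \<Omega>" | "x \<notin> frontier \<Omega>" "vtx \<in> F" using \<delta>_zero[OF K F _ x] by blast
  then show ?thesis
  proof cases
    case 3
    then obtain K' where K': "K' \<in> P" "K' \<noteq> K" "F facet_of K'" using vtx_neighbor[OF K F] x by blast
    have nbK: "neighbor P K F = neighbor_elem K F" "neighbor_elem K F \<in> P" using neighbor_elem_eq[OF K K'(1,2) F K'(3)] K' by auto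
    have "x \<in> neighbor_elem K F" using facet_subset[OF neighbor_elem_facet[OF K F]] x by blast
    then show ?thesis using 3 trace_rep[OF w(1) nbK(2)]
      by (simp add: numerical_flux_def Let_def flux_density_def tr nbK(1) normal_flux_def)
  qed (auto simp: numerical_flux_def Let_def flux_density_def tr normal_flux_def)
qed

definition facet_term where "facet_term K F w z = facet_integral (outward_normal K F) F (flux_density K F w z)"

lemma borel_skeleton: "interior_skeleton \<Omega> \<H> \<in> sets borel"
  unfolding interior_skeleton_def using finite_mesh
  by (intro sets.Diff sets.finite_UN) (auto intro: borel_closed)

lemma facet_skeleton:
  assumes "K \<in> P" "F facet_of K" "x \<in> F" "x \<notin> frontier \<Omega>" shows "x \<in> interior_skeleton \<Omega> \<H>"
proof -
  have FK: "F face_of K" "F \<noteq> K" using assms(2) by (auto simp: facet_of_def)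
  then have "F \<subseteq> rel_frontier K" by (rule face_of_subset_rel_frontier)
  also have "rel_frontier K = frontier K"
    using P_body(3)[OF assms(1)] by (rule rel_frontier_nonempty_interior)
  finally show ?thesis using assms P_mesh by (auto simp: interior_skeleton_def)
qed

text \<open>\<open>B\<close> and \<open>S\<close> are measurable and bounded only on the frontier
  and on the skeleton; their extensions by 0 are so on the whole space.\<close>

lemma flux_density_bounded_borel:
  assumes w: "w \<in> V" "z \<in> V" and K: "K \<in> P" and F: "F facet_of K"
  shows "bounded_borel_support (\<lambda>x. indicator F x * flux_density K F w z x)"
proof -
  let ?B = "\<lambda>x. indicator (frontier \<Omega>) x *\<^sub>R B x" and ?S = "\<lambda>x. indicator (interior_skeleton \<Omega> \<H>) x *\<^sub>R S x"
  note nbK = neighbor_elem_facet[OF K F]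
  have cF: "compact F" by (rule compact_facet[OF K F])
  have c: "continuous_on UNIV (rep K w)" "continuous_on UNIV (rep K z)" "continuous_on UNIV (rep (neighbor_elem K F) w)"
    using rep_cont w K nbK(1) by auto
  have fr: "frontier \<Omega> \<in> sets borel" by (intro borel_closed) simp
  have B: "?B \<in> borel_measurable borel" using B_meas fr by (simp add: borel_measurable_restrict_space_iff)
  have S: "?S \<in> borel_measurable borel" using S_meas borel_skeleton by (simp add: borel_measurable_restrict_space_iff)
  obtain bB where bB: "\<And>x. x \<in> frontier \<Omega> \<Longrightarrow> norm (B x) \<le> bB" using B_bounded by (auto simp: bounded_iff)
  obtain bS where bS: "\<And>x. x \<in> interior_skeleton \<Omega> \<H> \<Longrightarrow> norm (S x) \<le> bS" using S_bounded by (auto simp: bounded_iff)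
  have B': "norm (?B x) \<le> \<bar>bB\<bar>" for x using bB[of x] by (auto simp: indicator_def)
  have S': "norm (?S x) \<le> \<bar>bS\<bar>" for x using bS[of x] by (auto simp: indicator_def)
  let ?i = "\<lambda>x. indicator (frontier \<Omega>) x :: real"
  have i: "bounded_borel_support (\<lambda>x. indicator F x * ?i x)"
    using fr by (intro bounded_borel_facet_borel[OF cF, where B=1] borel_measurable_indicator) (auto simp: indicator_def)
  have i': "bounded_borel_support (\<lambda>x. indicator F x * (1 + (-1) * ?i x))"
    by (intro bounded_borel_facet_add bounded_borel_facet_cmult i bounded_borel_support_compact cF) auto
  \<comment> \<open>Both branches of the flux in one formula: the indicator and its complement
    select the terms with \<open>normal_flux\<close>, while the extended \<open>B\<close> and
    \<open>S\<close> vanish by themselves in the wrong branch.\<close>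
  let ?g = "\<lambda>x. \<delta>_ext K x * (?i x * (1/2 * ((normal_flux K F *v rep K w x) \<bullet> rep K z x)) + 1/2 * ((?B x *v rep K w x) \<bullet> rep K z x)
     + ((1 + (-1) * ?i x) * ((normal_flux K F *v ((1/2) *\<^sub>R (rep K w x + rep (neighbor_elem K F) w x))) \<bullet> rep K z x)
     + (?S x *v (rep K w x - rep (neighbor_elem K F) w x)) \<bullet> rep K z x))"
  have "bounded_borel_support (\<lambda>x. indicator F x * ?g x)"
    apply (intro bounded_borel_facet_mult[of F "\<delta>_ext K"] bounded_borel_facet_add)
    subgoal unfolding \<delta>_ext_def by (intro bounded_borel_support_compact cF continuous_intros)
    subgoal using i by (rule bounded_borel_facet_mult) (intro bounded_borel_support_compact cF continuous_intros continuous_on_matrix_vector c)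
    subgoal by (intro bounded_borel_facet_cmult bounded_borel_facet_bilinear[OF cF B B'] c)
    subgoal using i' by (rule bounded_borel_facet_mult) (intro bounded_borel_support_compact cF continuous_intros continuous_on_matrix_vector c)
    subgoal by (intro bounded_borel_facet_bilinear[OF cF S S'] continuous_intros c)
    done
  then show ?thesis
  proof (rule bounded_borel_support_cong)
    fix x
    show "indicator F x * ?g x = indicator F x * flux_density K F w z x"
    proof (cases "x \<in> F")
      case True
      have d: "\<delta> x = \<delta>_ext K x" using \<delta>_ext[OF K] True facet_subset[OF K F] by blast
      show ?thesis
      proof (cases "x \<in> frontier \<Omega>")
        case True
        then have "x \<notin> interior_skeleton \<Omega> \<H>" by (simp add: interior_skeleton_def)
        then show ?thesis using True
          by (simp add: flux_density_def d matrix_vector_mult_add_rdistrib inner_add_left scaleR_add_right)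
      next
        case False
        then show ?thesis using facet_skeleton[OF K F \<open>x \<in> F\<close>]
          by (simp add: flux_density_def d inner_add_left)
      qed
    qed simp
  qed
qed

lemma flux_density_comb_left:
  assumes w: "w \<in> V" "w' \<in> V" and K: "K \<in> P" and F: "F facet_of K" and x: "x \<in> F"
  shows "flux_density K F (\<lambda>x. a *\<^sub>R w x + w' x) z x = a * flux_density K F w z x + flux_density K F w' z x"
proof -
  have xK: "x \<in> K" "x \<in> neighbor_elem K F" using x facet_subset[OF K F] facet_subset[OF neighbor_elem_facet[OF K F]] by blast+
  show ?thesis
    unfolding flux_density_def rep_comb[OF w K xK(1)] rep_comb[OF w neighbor_elem_facet(1)[OF K F] xK(2)]
    by (simp add: matrix_vector_right_distrib matrix_vector_mult_diff_distrib matrix_vector_mult_add_rdistrib matrix_vector_mult_scaleR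
      inner_add_left inner_diff_left algebra_simps)
qed

lemma flux_density_comb_right:
  assumes z: "z \<in> V" "z' \<in> V" and K: "K \<in> P" and F: "F facet_of K" and x: "x \<in> F"
  shows "flux_density K F w (\<lambda>x. a *\<^sub>R z x + z' x) x = a * flux_density K F w z x + flux_density K F w z' x"
proof -
  have xK: "x \<in> K" using x facet_subset[OF K F] by blast
  show ?thesis
    unfolding flux_density_def rep_comb[OF z K xK] by (simp add: inner_add_right algebra_simps)
qed

lemma facet_term_comb_left:
  assumes w: "w \<in> V" "w' \<in> V" "z \<in> V" and K: "K \<in> P" and F: "F facet_of K"
  shows "facet_term K F (\<lambda>x. a *\<^sub>R w x + w' x) z = a * facet_term K F w z + facet_term K F w' z"
proof -
  note fl = flat[OF K F]
  have "facet_term K F (\<lambda>x. a *\<^sub>R w x + w' x) z = facet_integral (outward_normal K F) F (\<lambda>x. a * flux_density K F w z x + flux_density K F w' z x)"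
    unfolding facet_term_def using flux_density_comb_left[OF w(1,2) K F] by (intro facet_integral_cong[OF fl])
  also have "\<dots> = a * facet_term K F w z + facet_term K F w' z"
    unfolding facet_term_def facet_integral_cmult[OF fl, symmetric]
    by (intro facet_integral_add[OF fl] bounded_borel_facet_cmult flux_density_bounded_borel w K F)
  finally show ?thesis .
qed

lemma facet_term_comb_right:
  assumes w: "z \<in> V" "z' \<in> V" "w \<in> V" and K: "K \<in> P" and F: "F facet_of K"
  shows "facet_term K F w (\<lambda>x. a *\<^sub>R z x + z' x) = a * facet_term K F w z + facet_term K F w z'"
proof -
  note fl = flat[OF K F]
  have "facet_term K F w (\<lambda>x. a *\<^sub>R z x + z' x) = facet_integral (outward_normal K F) F (\<lambda>x. a * flux_density K F w z x + flux_density K F w z' x)"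
    unfolding facet_term_def using flux_density_comb_right[OF w(1,2) K F] by (intro facet_integral_cong[OF fl])
  also have "\<dots> = a * facet_term K F w z + facet_term K F w z'"
    unfolding facet_term_def facet_integral_cmult[OF fl, symmetric]
    by (intro facet_integral_add[OF fl] bounded_borel_facet_cmult flux_density_bounded_borel w K F)
  finally show ?thesis .
qed

section \<open>Volume terms and bilinearity of the DG form\<close>

definition volume_term where "volume_term K j w z = (LINT x:K|lebesgue. (\<delta> x *\<^sub>R (L j x *v w x)) \<bullet> partial j z x)"

lemma V_partial:
  assumes "w \<in> V" "K \<in> P" "x \<in> interior K"
  shows "w differentiable at x" "partial j w x = partial j (rep K w) x"
proof -
  have d: "(rep K w has_derivative frechet_derivative (rep K w) (at x)) (at x)"
    using polynomial_degree_le_differentiable(1)[OF rep(1)[OF assms(1,2)]] by (simp add: frechet_derivative_works)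
  have d': "(w has_derivative frechet_derivative (rep K w) (at x)) (at x)"
    by (rule has_derivative_transform_within_open[OF d open_interior assms(3)]) (simp add: rep(2)[OF assms(1,2)])
  then show "w differentiable at x" by (rule differentiableI)
  show "partial j w x = partial j (rep K w) x"
    unfolding partial_def using frechet_derivative_at[OF d'] by simp
qed

lemma volume_term_integrand:
  assumes w: "w \<in> V" "z \<in> V" and K: "K \<in> P"
  shows "continuous_on UNIV (\<lambda>x. \<delta>_ext K x * ((LK K j *v rep K w x) \<bullet> partial j (rep K z) x))"
    and "x \<in> interior K \<Longrightarrow> (\<delta> x *\<^sub>R (L j x *v w x)) \<bullet> partial j z x = \<delta>_ext K x * ((LK K j *v rep K w x) \<bullet> partial j (rep K z) x)"
proof -
  show "continuous_on UNIV (\<lambda>x. \<delta>_ext K x * ((LK K j *v rep K w x) \<bullet> partial j (rep K z) x))"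
    unfolding \<delta>_ext_def
    using rep_cont[OF w(1) K] polynomial_degree_le_differentiable(2)[OF rep(1)[OF w(2) K]]
    by (intro continuous_intros continuous_on_matrix_vector)
  assume x: "x \<in> interior K"
  then have "x \<in> K" using interior_subset by blast
  then show "(\<delta> x *\<^sub>R (L j x *v w x)) \<bullet> partial j z x = \<delta>_ext K x * ((LK K j *v rep K w x) \<bullet> partial j (rep K z) x)"
    using \<delta>_ext[OF K] rep(2)[OF w(1) K x] V_partial(2)[OF w(2) K x] L_eq[OF K x] by simp
qed

lemma volume_term_comb_left:
  assumes w: "w \<in> V" "w' \<in> V" "z \<in> V" and K: "K \<in> P"
  shows "volume_term K j (\<lambda>x. a *\<^sub>R w x + w' x) z = a * volume_term K j w z + volume_term K j w' z"
  unfolding volume_term_def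
proof (rule elem_integral_comb[OF P_body(1,2)[OF K]])
  show "(\<delta> x *\<^sub>R (L j x *v (a *\<^sub>R w x + w' x))) \<bullet> partial j z x =
    a * ((\<delta> x *\<^sub>R (L j x *v w x)) \<bullet> partial j z x) + (\<delta> x *\<^sub>R (L j x *v w' x)) \<bullet> partial j z x" for x
    by (simp add: matrix_vector_right_distrib matrix_vector_mult_scaleR inner_add_left algebra_simps)
qed (use volume_term_integrand[OF w(1,3) K] volume_term_integrand[OF w(2,3) K] in blast)+

lemma volume_term_comb_right:
  assumes w: "z \<in> V" "z' \<in> V" "w \<in> V" and K: "K \<in> P"
  shows "volume_term K j w (\<lambda>x. a *\<^sub>R z x + z' x) = a * volume_term K j w z + volume_term K j w z'"
  unfolding volume_term_def
proof (rule elem_integral_comb[OF P_body(1,2)[OF K]])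
  fix x assume x: "x \<in> interior K"
  have "((\<lambda>x. a *\<^sub>R z x + z' x) has_derivative (\<lambda>h. a *\<^sub>R frechet_derivative z (at x) h + frechet_derivative z' (at x) h)) (at x)"
    using V_partial(1)[OF w(1) K x] V_partial(1)[OF w(2) K x]
    by (intro has_derivative_add has_derivative_scaleR_right) (simp_all add: frechet_derivative_works)
  then have "partial j (\<lambda>x. a *\<^sub>R z x + z' x) x = a *\<^sub>R partial j z x + partial j z' x"
    unfolding partial_def by (simp add: frechet_derivative_at[symmetric])
  then show "(\<delta> x *\<^sub>R (L j x *v w x)) \<bullet> partial j (\<lambda>x. a *\<^sub>R z x + z' x) x =
    a * ((\<delta> x *\<^sub>R (L j x *v w x)) \<bullet> partial j z x) + (\<delta> x *\<^sub>R (L j x *v w x)) \<bullet> partial j z' x"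
    by (simp add: inner_add_right algebra_simps)
qed (use volume_term_integrand[OF w(3,1) K] volume_term_integrand[OF w(3,2) K] in blast)+

abbreviation dg where "dg \<equiv> dg_form \<Omega> L S B P \<delta>"

lemma dg_eq:
  assumes "w \<in> V" "z \<in> V"
  shows "dg w z = (\<Sum>K\<in>P. (\<Sum>j\<in>UNIV. volume_term K j w z) - (\<Sum>F | F facet_of K. facet_term K F w z))"
  unfolding dg_form_def volume_term_def facet_term_def
  using numerical_flux_density[OF assms] flat
  by (intro sum.cong refl arg_cong2[where f="(-)"] facet_integral_cong) auto

lemma dg_comb_left:
  assumes "w \<in> V" "w' \<in> V" "z \<in> V"
  shows "dg (\<lambda>x. a *\<^sub>R w x + w' x) z = a * dg w z + dg w' z"
proof -
  have "(\<Sum>F | F facet_of K. facet_term K F (\<lambda>x. a *\<^sub>R w x + w' x) z) = a * (\<Sum>F | F facet_of K. facet_term K F w z) + (\<Sum>F | F facet_of K. facet_term K F w' z)"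
    if "K \<in> P" for K
    unfolding sum_distrib_left sum.distrib[symmetric]
    using that assms by (intro sum.cong refl) (simp add: facet_term_comb_left)
  then show ?thesis using assms
    by (simp add: dg_eq V_comb volume_term_comb_left cong: sum.cong)
       (simp add: sum.distrib sum_distrib_left[symmetric] sum_subtractf right_diff_distrib)
qed

lemma dg_comb_right:
  assumes "z \<in> V" "z' \<in> V" "w \<in> V"
  shows "dg w (\<lambda>x. a *\<^sub>R z x + z' x) = a * dg w z + dg w z'"
proof -
  have "(\<Sum>F | F facet_of K. facet_term K F w (\<lambda>x. a *\<^sub>R z x + z' x)) = a * (\<Sum>F | F facet_of K. facet_term K F w z) + (\<Sum>F | F facet_of K. facet_term K F w z')"
    if "K \<in> P" for K
    unfolding sum_distrib_left sum.distrib[symmetric]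
    using that assms by (intro sum.cong refl) (simp add: facet_term_comb_right)
  then show ?thesis using assms
    by (simp add: dg_eq V_comb volume_term_comb_right cong: sum.cong)
       (simp add: sum.distrib sum_distrib_left[symmetric] sum_subtractf right_diff_distrib)
qed

section \<open>The operators on \<open>V\<close> are well defined and linear\<close>

abbreviation A where "A \<equiv> Ah p \<Omega> L S B P \<delta>"
abbreviation M1 where "M1 \<equiv> M1op L \<delta>"
abbreviation M0 where "M0 \<equiv> M0op L G \<phi>bot"
abbreviation X where "X \<equiv> Xh p \<Omega> L G S B P \<phi>bot \<delta>"

lemma A_unique: "w \<in> V \<Longrightarrow> \<exists>!u. u \<in> V \<and> (\<forall>v\<in>V. patch_inner P u v = dg w v)"
proof -
  assume w: "w \<in> V"
  obtain I :: "((real^'n) set \<times> ('n \<Rightarrow> nat) \<times> 'l) set" and bs where "fun_inner.spanned_by V I bs"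
    using Vh_spanned[OF fun_inner_L2] .
  then show ?thesis using dg_comb_right w by (intro fun_inner.Riesz[OF fun_inner_L2]) auto
qed

lemma A_mem: "w \<in> V \<Longrightarrow> A w \<in> V"
  and A_inner: "w \<in> V \<Longrightarrow> v \<in> V \<Longrightarrow> patch_inner P (A w) v = dg w v"
  using theI'[OF A_unique] by (auto simp: Ah_def)

lemma A_eqI: "w \<in> V \<Longrightarrow> u \<in> V \<Longrightarrow> (\<And>v. v \<in> V \<Longrightarrow> patch_inner P u v = dg w v) \<Longrightarrow> A w = u"
  unfolding Ah_def by (rule the1_equality[OF A_unique]) auto

lemma A_comb:
  assumes "w \<in> V" "z \<in> V" shows "A (\<lambda>x. a *\<^sub>R w x + z x) = (\<lambda>x. a *\<^sub>R A w x + A z x)"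
proof -
  interpret fun_inner V "patch_inner P" by (rule fun_inner_L2)
  have "patch_inner P (\<lambda>x. a *\<^sub>R A w x + A z x) v = dg (\<lambda>x. a *\<^sub>R w x + z x) v" if "v \<in> V" for v
    using assms that by (simp add: ip_comb A_mem A_inner dg_comb_left)
  then show ?thesis
    using V_comb[OF assms, of a] V_comb[OF A_mem[OF assms(1)] A_mem[OF assms(2)], of a] by (intro A_eqI)
qed

text \<open>Surjectivity of \<open>M0\<close> onto \<open>V\<close> places the right side in its
  image, where \<open>inv_into\<close> is a right inverse.\<close>

lemma X_mem: "w \<in> V \<Longrightarrow> X w \<in> V" and M0_X: "w \<in> V \<Longrightarrow> M0 (X w) = (\<lambda>x. A w x + M1 w x)"
proof -
  assume w: "w \<in> V"
  have "(\<lambda>x. A w x + M1 w x) \<in> V"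
    using V_comb[OF A_mem[OF w] M1op_V[OF w], of 1] by (simp add: \<delta>_fun)
  from M0op_surj[OF this] obtain y where "y \<in> V" "M0 y = (\<lambda>x. A w x + M1 w x)" ..
  then have "(\<lambda>x. A w x + M1 w x) \<in> M0 ` V" by (intro image_eqI[of _ M0 y]) simp_all
  then show "X w \<in> V" "M0 (X w) = (\<lambda>x. A w x + M1 w x)"
    unfolding Xh_def by (rule inv_into_into, rule f_inv_into_f)
qed

lemma X_comb:
  assumes "w \<in> V" "z \<in> V" shows "X (\<lambda>x. a *\<^sub>R w x + z x) = (\<lambda>x. a *\<^sub>R X w x + X z x)"
proof (rule M0op_inj)
  show "X (\<lambda>x. a *\<^sub>R w x + z x) \<in> V" "(\<lambda>x. a *\<^sub>R X w x + X z x) \<in> V"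
    using assms by (intro X_mem V_comb; simp)+
  show "M0 (X (\<lambda>x. a *\<^sub>R w x + z x)) = M0 (\<lambda>x. a *\<^sub>R X w x + X z x)"
    unfolding M0op_comb M0_X[OF V_comb[OF assms]] M0_X[OF assms(1)] M0_X[OF assms(2)] A_comb[OF assms] M1op_comb
    by (simp add: fun_eq_iff scaleR_add_right)
qed

end

section \<open>Dissipation\<close>

context tent begin

text \<open>The boundary terms that an integration by parts leaves at the facet \<open>F\<close> of \<open>K\<close>.\<close>

definition boundary_density where
  "boundary_density K F w x = \<delta> x * ((normal_flux K F *v rep K w x) \<bullet> rep K w x) - 2 * flux_density K F w w x"

lemma normal_flux_sym: "K \<in> P \<Longrightarrow> symmetric_matrix (normal_flux K F)"
  unfolding normal_flux_def by (intro symmetric_matrix_sum LK_sym)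

lemma boundary_density_cont_part:
  assumes "w \<in> V" "K \<in> P" "F facet_of K"
  shows "bounded_borel_support (\<lambda>x. indicator F x * (\<delta> x * ((normal_flux K F *v rep K w x) \<bullet> rep K w x)))"
proof -
  have "bounded_borel_support (\<lambda>x. indicator F x * (\<delta>_ext K x * ((normal_flux K F *v rep K w x) \<bullet> rep K w x)))"
    unfolding \<delta>_ext_def
    by (intro bounded_borel_support_compact compact_facet[OF assms(2,3)] continuous_intros continuous_on_matrix_vector rep_cont assms)
  then show ?thesis
    using \<delta>_ext[OF assms(2)] facet_subset[OF assms(2,3)]
    by (elim bounded_borel_support_cong) (auto simp: indicator_def)
qed

lemma boundary_density_bounded_borel:
  assumes "w \<in> V" "K \<in> P" "F facet_of K"
  shows "bounded_borel_support (\<lambda>x. indicator F x * boundary_density K F w x)"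
  using bounded_borel_facet_add[OF boundary_density_cont_part[OF assms] bounded_borel_facet_cmult[OF flux_density_bounded_borel[OF assms(1) assms], of "-2"]]
  by (simp add: boundary_density_def)

text \<open>The divergence theorem for the functions \<open>\<delta> (L j w) \<bullet> w\<close>,
  summed over \<open>j\<close>. Derivatives of \<open>w\<close> give twice the volume terms, and the
  constant derivative of \<open>\<delta>\<close> gives the matrix \<open>M1_mat K\<close>.\<close>

lemma elem_integration_by_parts:
  assumes w: "w \<in> V" and K: "K \<in> P"
  shows "2 * (\<Sum>j\<in>UNIV. volume_term K j w w) + (LINT x:K|lebesgue. (M1_mat K *v rep K w x) \<bullet> rep K w x) =
    (\<Sum>F | F facet_of K. facet_integral (outward_normal K F) F (\<lambda>x. \<delta> x * ((normal_flux K F *v rep K w x) \<bullet> rep K w x)))"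
proof -
  let ?r = "rep K w" and ?g = "top_grad K - bot_grad K"
  note r = rep(1)[OF w K]
  define f where "f j x = \<delta>_ext K x * ((LK K j *v ?r x) \<bullet> ?r x)" for j x
  have rc: "continuous_on UNIV ?r" by (rule rep_cont[OF w K])
  have df: "(f j has_derivative (\<lambda>h. \<delta>_ext K x * (2 * ((LK K j *v ?r x) \<bullet> frechet_derivative ?r (at x) h)) + (?g \<bullet> h) * ((LK K j *v ?r x) \<bullet> ?r x))) (at x)" for j x
  proof -
    have d1: "(\<delta>_ext K has_derivative (\<lambda>h. ?g \<bullet> h)) (at x)"
      unfolding \<delta>_ext_def[abs_def] by (auto intro!: derivative_eq_intros)
    have d2: "(?r has_derivative frechet_derivative ?r (at x)) (at x)"
      using polynomial_degree_le_differentiable(1)[OF r] by (simp add: frechet_derivative_works)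
    have d3: "((\<lambda>x. LK K j *v ?r x) has_derivative (\<lambda>h. LK K j *v frechet_derivative ?r (at x) h)) (at x)"
      by (rule bounded_linear.has_derivative[OF matrix_vector_mul_bounded_linear d2])
    \<comment> \<open>Symmetry of the matrix merges the two terms of the product rule into the
      factor 2.\<close>
    have d4: "((\<lambda>x. (LK K j *v ?r x) \<bullet> ?r x) has_derivative (\<lambda>h. 2 * ((LK K j *v ?r x) \<bullet> frechet_derivative ?r (at x) h))) (at x)"
      using has_derivative_inner[OF d3 d2]
      by (simp add: symmetric_matrix_inner[OF LK_sym[OF K], of "?r x"] inner_commute)
    show ?thesis unfolding f_def[abs_def] by (rule has_derivative_mult[OF d1 d4])
  qed
  have pf: "partial j (f j) x = 2 * (\<delta>_ext K x * ((LK K j *v ?r x) \<bullet> partial j ?r x)) + ?g $ j * ((LK K j *v ?r x) \<bullet> ?r x)" for j x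
    unfolding partial_def frechet_derivative_at[OF df, symmetric] by (simp add: inner_axis)
  have c1: "continuous_on UNIV (\<lambda>x. \<delta>_ext K x * ((LK K j *v ?r x) \<bullet> partial j ?r x))" for j
    by (rule volume_term_integrand(1)[OF w w K])
  have c2: "continuous_on UNIV (\<lambda>x. ?g $ j * ((LK K j *v ?r x) \<bullet> ?r x))" for j
    by (intro continuous_intros continuous_on_matrix_vector rc)
  have "(LINT x:K|lebesgue. partial j (f j) x) = (\<Sum>F | F facet_of K. (outward_normal K F $ j) * facet_integral (outward_normal K F) F (f j))" for j
  proof (rule divergence_simplex[OF P_simplex[OF K]])
    show "f j differentiable at x" for x using df by (rule differentiableI)
    show "continuous_on UNIV (partial j (f j))"
      unfolding pf using continuous_on_add[OF continuous_on_mult_left[OF c1, of 2] c2] by simp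
  qed
  moreover have "(LINT x:K|lebesgue. partial j (f j) x) = 2 * volume_term K j w w + (LINT x:K|lebesgue. ?g $ j * ((LK K j *v ?r x) \<bullet> ?r x))" for j
    unfolding volume_term_def
  proof (rule elem_integral_comb[OF P_body(1,2)[OF K]])
    show "partial j (f j) x = 2 * ((\<delta> x *\<^sub>R (L j x *v w x)) \<bullet> partial j w x) + ?g $ j * ((LK K j *v ?r x) \<bullet> ?r x)" if "x \<in> interior K" for x
      unfolding pf volume_term_integrand(2)[OF w w K that] ..
  qed (use volume_term_integrand[OF w w K] c2 in blast)+
  ultimately have "(\<Sum>j\<in>UNIV. 2 * volume_term K j w w + (LINT x:K|lebesgue. ?g $ j * ((LK K j *v ?r x) \<bullet> ?r x))) =
    (\<Sum>j\<in>UNIV. \<Sum>F | F facet_of K. (outward_normal K F $ j) * facet_integral (outward_normal K F) F (f j))" by simp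
  also have "\<dots> = (\<Sum>F | F facet_of K. \<Sum>j\<in>UNIV. (outward_normal K F $ j) * facet_integral (outward_normal K F) F (f j))"
    by (rule sum.swap)
  also have "\<dots> = (\<Sum>F | F facet_of K. facet_integral (outward_normal K F) F (\<lambda>x. \<delta> x * ((normal_flux K F *v rep K w x) \<bullet> rep K w x)))"
  proof (rule sum.cong[OF refl])
    fix F assume "F \<in> {F. F facet_of K}"
    then have F: "F facet_of K" by simp
    note fl = flat[OF K F]
    let ?n = "outward_normal K F"
    have fb: "bounded_borel_support (\<lambda>x. indicator F x * f j x)" for j
      unfolding f_def \<delta>_ext_def
      by (intro bounded_borel_support_compact compact_facet[OF K F] continuous_intros continuous_on_matrix_vector rc)
    have s: "(\<Sum>j\<in>J. (?n $ j) * facet_integral ?n F (f j)) = facet_integral ?n F (\<lambda>x. \<Sum>j\<in>J. (?n $ j) * f j x)" if "finite J" for J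
      using that
    proof (induction J rule: finite_induct)
      case empty
      then show ?case using facet_integral_zero[OF fl, of "\<lambda>x. 0"] by simp
    next
      case (insert j J)
      have "facet_integral ?n F (\<lambda>x. (?n $ j) * f j x + (\<Sum>j\<in>J. (?n $ j) * f j x)) =
        facet_integral ?n F (\<lambda>x. (?n $ j) * f j x) + facet_integral ?n F (\<lambda>x. \<Sum>j\<in>J. (?n $ j) * f j x)"
        by (intro facet_integral_add[OF fl] bounded_borel_facet_cmult bounded_borel_facet_sum fb)
      then show ?case using insert by (simp add: facet_integral_cmult[OF fl])
    qed
    have "(\<Sum>j\<in>UNIV. (?n $ j) * facet_integral ?n F (f j)) = facet_integral ?n F (\<lambda>x. \<Sum>j\<in>UNIV. (?n $ j) * f j x)"
      by (rule s) simp
    also have "\<dots> = facet_integral ?n F (\<lambda>x. \<delta> x * ((normal_flux K F *v ?r x) \<bullet> ?r x))"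
    proof (rule facet_integral_cong[OF fl])
      fix x assume "x \<in> F"
      then have "\<delta> x = \<delta>_ext K x" using \<delta>_ext[OF K] facet_subset[OF K F] by blast
      then show "(\<Sum>j\<in>UNIV. (?n $ j) * f j x) = \<delta> x * ((normal_flux K F *v ?r x) \<bullet> ?r x)"
        by (simp add: f_def normal_flux_def sum_scaleR_matrix_vector inner_sum_left sum_distrib_left mult.left_commute)
    qed
    finally show "(\<Sum>j\<in>UNIV. (?n $ j) * facet_integral ?n F (f j)) = facet_integral ?n F (\<lambda>x. \<delta> x * ((normal_flux K F *v ?r x) \<bullet> ?r x))" .
  qed
  finally have 1: "(\<Sum>j\<in>UNIV. 2 * volume_term K j w w + (LINT x:K|lebesgue. ?g $ j * ((LK K j *v ?r x) \<bullet> ?r x))) =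
    (\<Sum>F | F facet_of K. facet_integral (outward_normal K F) F (\<lambda>x. \<delta> x * ((normal_flux K F *v ?r x) \<bullet> ?r x)))" .
  have "(LINT x:K|lebesgue. (M1_mat K *v ?r x) \<bullet> ?r x) = (LINT x:K|lebesgue. \<Sum>j\<in>UNIV. ?g $ j * ((LK K j *v ?r x) \<bullet> ?r x))"
    by (simp add: M1_mat_def sum_scaleR_matrix_vector inner_sum_left)
  also have "\<dots> = (\<Sum>j\<in>UNIV. LINT x:K|lebesgue. ?g $ j * ((LK K j *v ?r x) \<bullet> ?r x))"
    using elem_integrable[OF P_body(1)[OF K] c2]
    unfolding set_lebesgue_integral_def set_integrable_def scaleR_sum_right by (rule Bochner_Integration.integral_sum)
  finally show ?thesis using 1 by (simp add: sum.distrib sum_distrib_left)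
qed

text \<open>The volume terms of the form and \<open>M1\<close> are exactly what integration by parts
  moves to the boundary, so only facet integrals remain.\<close>

lemma energy_eq:
  assumes w: "w \<in> V"
  shows "2 * dg w w + patch_inner P (M1 w) w = (\<Sum>K\<in>P. \<Sum>F | F facet_of K. facet_integral (outward_normal K F) F (boundary_density K F w))"
proof -
  have "patch_inner P (M1 w) w = (\<Sum>K\<in>P. LINT x:K|lebesgue. (M1_mat K *v rep K w x) \<bullet> rep K w x)"
    using patch_inner_eq[OF w w, of "M1 w" M1_mat] M1op_eq[of _ _ w] by (simp add: \<delta>_fun)
  then have "2 * dg w w + patch_inner P (M1 w) w = (\<Sum>K\<in>P. (2 * (\<Sum>j\<in>UNIV. volume_term K j w w) +
      (LINT x:K|lebesgue. (M1_mat K *v rep K w x) \<bullet> rep K w x)) - (\<Sum>F | F facet_of K. 2 * facet_term K F w w))"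
    by (simp add: dg_eq[OF w w] sum_distrib_left[symmetric] sum.distrib sum_subtractf right_diff_distrib)
  also have "\<dots> = (\<Sum>K\<in>P. \<Sum>F | F facet_of K. facet_integral (outward_normal K F) F (boundary_density K F w))"
  proof (rule sum.cong[OF refl])
    fix K assume K: "K \<in> P"
    show "(2 * (\<Sum>j\<in>UNIV. volume_term K j w w) + (LINT x:K|lebesgue. (M1_mat K *v rep K w x) \<bullet> rep K w x)) - (\<Sum>F | F facet_of K. 2 * facet_term K F w w) =
      (\<Sum>F | F facet_of K. facet_integral (outward_normal K F) F (boundary_density K F w))"
      unfolding elem_integration_by_parts[OF w K] sum_subtractf[symmetric]
    proof (rule sum.cong[OF refl])
      fix F assume "F \<in> {F. F facet_of K}"
      then have F: "F facet_of K" by simp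
      note fl = flat[OF K F]
      have "facet_integral (outward_normal K F) F (\<lambda>x. \<delta> x * ((normal_flux K F *v rep K w x) \<bullet> rep K w x) + (-2) * flux_density K F w w x) =
        facet_integral (outward_normal K F) F (\<lambda>x. \<delta> x * ((normal_flux K F *v rep K w x) \<bullet> rep K w x)) + (-2) * facet_term K F w w"
        unfolding facet_term_def facet_integral_cmult[OF fl, symmetric]
        by (intro facet_integral_add[OF fl] boundary_density_cont_part bounded_borel_facet_cmult flux_density_bounded_borel w K F)
      then show "facet_integral (outward_normal K F) F (\<lambda>x. \<delta> x * ((normal_flux K F *v rep K w x) \<bullet> rep K w x)) - 2 * facet_term K F w w =
        facet_integral (outward_normal K F) F (boundary_density K F w)"
        by (simp add: boundary_density_def[abs_def])
    qed
  qed
  finally show ?thesis .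
qed

text \<open>A matrix and its transpose have the same quadratic form, so the symmetrized one has
  twice the form of \<open>D\<close>.\<close>

lemma psd_quadratic: "positive_semidefinite (D + transpose D) \<Longrightarrow> 0 \<le> (D *v e) \<bullet> e"
  using dot_lmul_matrix[of e D e]
  by (auto simp: positive_semidefinite_def matrix_vector_mult_add_rdistrib inner_add_right
      transpose_matrix_vector inner_commute[of e] dest!: spec[of _ e])

text \<open>The factor 1/2 in the boundary flux cancels the normal flux left by integration by
  parts; minus the form of \<open>B\<close> remains.\<close>

lemma boundary_density_frontier:
  assumes K: "K \<in> P" and x: "x \<in> K" "x \<in> frontier \<Omega>"
  shows "boundary_density K F w x \<le> 0"
proof -
  have "boundary_density K F w x = - (\<delta> x * ((B x *v rep K w x) \<bullet> rep K w x))"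
    using x by (simp add: boundary_density_def flux_density_def matrix_vector_mult_add_rdistrib inner_add_left algebra_simps)
  moreover have "0 \<le> \<delta> x * ((B x *v rep K w x) \<bullet> rep K w x)"
    using \<delta>_nonneg[OF K x(1)] psd_quadratic[OF B_psd[OF x(2)]] by (intro mult_nonneg_nonneg)
  ultimately show ?thesis by simp
qed

text \<open>The normal flux is the same matrix seen from both sides, up to the sign of the normal,
  so its symmetric part in the two traces cancels. What remains is \<open>- 2 * \<delta> x\<close>
  times the form of \<open>S\<close> at the jump.\<close>

lemma boundary_density_pair:
  assumes K: "K \<in> P" "K' \<in> P" "K' \<noteq> K" and F: "F facet_of K" "F facet_of K'" and x: "x \<in> F"
  shows "boundary_density K F w x + boundary_density K' F w x \<le> 0"
proof (cases "x \<in> frontier \<Omega>")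
  case True
  then show ?thesis using boundary_density_frontier[OF K(1) _ True, of F w] boundary_density_frontier[OF K(2) _ True, of F w] x F facet_subset K by fastforce
next
  case False
  let ?r = "rep K w x" and ?r' = "rep K' w x"
  have nbs: "neighbor_elem K F = K'" "neighbor_elem K' F = K" using neighbor_elem_eq K F by auto
  have D': "normal_flux K' F = - normal_flux K F"
  proof -
    have n: "outward_normal K' F = - outward_normal K F"
      using outward_normal_neighbor(1)[OF P_mesh[OF K(1)] P_mesh[OF K(2)] _ F] K(3) by auto
    have "flux_matrix L (outward_normal K F) (ctr K) = flux_matrix L (outward_normal K F) (ctr K')"
      using x False K(3) by (intro flux_single_valued[OF L_const L_div P_mesh[OF K(1)] P_mesh[OF K(2)] _ F _ ctr_interior[OF K(1)] ctr_interior[OF K(2)]]) auto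
    then show ?thesis by (simp add: normal_flux_def n LK_def flux_matrix_def sum_negf)
  qed
  have "x \<in> interior_skeleton \<Omega> \<H>" using facet_skeleton[OF K(1) F(1) x False] .
  then have "0 \<le> (S x *v (?r - ?r')) \<bullet> (?r - ?r')" using psd_quadratic S_psd by blast
  then have psd: "0 \<le> \<delta> x * ((S x *v (?r - ?r')) \<bullet> (?r - ?r'))"
    using \<delta>_nonneg[OF K(1)] x facet_subset[OF K(1) F(1)] by (intro mult_nonneg_nonneg) auto
  have neg: "(- normal_flux K F) *v e = - (normal_flux K F *v e)" for e
    using matrix_vector_mult_diff_rdistrib[of 0 "normal_flux K F" e] by simp
  have "boundary_density K F w x + boundary_density K' F w x = - 2 * (\<delta> x * ((S x *v (?r - ?r')) \<bullet> (?r - ?r')))"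
    using False symmetric_matrix_inner[OF normal_flux_sym[OF K(1), of F], of ?r ?r']
    by (simp add: boundary_density_def flux_density_def nbs D' neg inner_commute[of ?r] inner_commute[of ?r'] matrix_vector_mult_diff_distrib matrix_vector_right_distrib
      matrix_vector_mult_scaleR inner_add_left inner_diff_left inner_diff_right algebra_simps)
  then show ?thesis using psd by simp
qed

text \<open>Summing over pairs of an element and a facet, the exchange \<open>\<sigma>\<close> is an
  involution; twice the sum therefore consists of the paired terms, each of which is
  nonpositive.\<close>

lemma energy:
  assumes w: "w \<in> V"
  shows "2 * dg w w + patch_inner P (M1 w) w \<le> 0"
proof -
  define \<Theta> where "\<Theta> = (\<lambda>(K, F). facet_integral (outward_normal K F) F (boundary_density K F w))"
  define Z where "Z = (SIGMA K:P. {F. F facet_of K})"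
  \<comment> \<open>\<open>\<sigma>\<close> exchanges the two elements at a facet\<close>
  define \<sigma> where "\<sigma> = (\<lambda>(K, F). (neighbor_elem K F, F))"
  have fZ: "finite Z" unfolding Z_def using finite_P finite_facets by (intro finite_SigmaI)
  have \<sigma>Z: "\<sigma> z \<in> Z" if "z \<in> Z" for z using that neighbor_elem_facet by (auto simp: Z_def \<sigma>_def)
  have \<sigma>\<sigma>: "\<sigma> (\<sigma> z) = z" if zZ: "z \<in> Z" for z
  proof -
    obtain K F where z: "z = (K, F)" "K \<in> P" "F facet_of K" using zZ by (auto simp: Z_def)
    show ?thesis
    proof (cases "neighbor_elem K F = K")
      case False
      then have "neighbor_elem (neighbor_elem K F) F = K" using neighbor_elem_eq(2)[of "neighbor_elem K F" K F] neighbor_elem_facet[OF z(2,3)] z by auto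
      then show ?thesis by (simp add: z \<sigma>_def)
    qed (simp add: z \<sigma>_def)
  qed
  have pair: "\<Theta> z + \<Theta> (\<sigma> z) \<le> 0" if zZ: "z \<in> Z" for z
  proof -
    obtain K F where z: "z = (K, F)" "K \<in> P" "F facet_of K" using zZ by (auto simp: Z_def)
    note fl = flat[OF z(2,3)]
    show ?thesis
    proof (cases "neighbor_elem K F = K")
      case True
      \<comment> \<open>A facet with no partner in the patch misses \<open>vtx\<close>, so that
        \<open>\<delta>\<close> vanishes on it, or lies in the frontier of
        \<open>\<Omega>\<close>.\<close>
      have no: "\<not> (\<exists>K'\<in>P. K' \<noteq> K \<and> F facet_of K')" using neighbor_elem_eq(2)[OF z(2) _ _ z(3)] True by metis
      have "boundary_density K F w x \<le> 0" if x: "x \<in> F" for x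
      proof -
        consider "vtx \<notin> F" | "F \<subseteq> frontier \<Omega>" using vtx_neighbor[OF z(2,3)] no by blast
        then show ?thesis
        proof cases
          case 1
          then show ?thesis using \<delta>_zero[OF z(2,3) 1 x] by (simp add: boundary_density_def flux_density_def)
        next
          case 2
          then show ?thesis using boundary_density_frontier[OF z(2)] x facet_subset[OF z(2,3)] by blast
        qed
      qed
      then have "\<Theta> z \<le> 0" using facet_integral_nonpos[OF fl] by (simp add: \<Theta>_def z)
      then show ?thesis using True by (simp add: \<sigma>_def z)
    next
      case False
      define K' where "K' = neighbor_elem K F"
      have K': "K' \<in> P" "F facet_of K'" "K' \<noteq> K" using neighbor_elem_facet[OF z(2,3)] False by (auto simp: K'_def)
      have n: "outward_normal K' F = - outward_normal K F"
        using outward_normal_neighbor(1)[OF P_mesh[OF z(2)] P_mesh[OF K'(1)] _ z(3) K'(2)] K'(3) by auto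
      \<comment> \<open>The two integrals are brought to the same normal, so that the densities can
        be added pointwise.\<close>
      have "\<Theta> (\<sigma> z) = facet_integral (outward_normal K F) F (boundary_density K' F w)"
        using facet_integral_uminus_normal[OF fl boundary_density_bounded_borel[OF w K'(1,2)]] by (simp add: \<Theta>_def \<sigma>_def z n K'_def[symmetric])
      then have "\<Theta> z + \<Theta> (\<sigma> z) = facet_integral (outward_normal K F) F (\<lambda>x. boundary_density K F w x + boundary_density K' F w x)"
        using facet_integral_add[OF fl boundary_density_bounded_borel[OF w z(2,3)] boundary_density_bounded_borel[OF w K'(1,2)]] by (simp add: \<Theta>_def z)
      also have "\<dots> \<le> 0" using boundary_density_pair[OF z(2) K'(1,3) z(3) K'(2)] by (intro facet_integral_nonpos[OF fl])
      finally show ?thesis .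
    qed
  qed
  have "(\<Sum>z\<in>Z. \<Theta> z) = (\<Sum>z\<in>Z. \<Theta> (\<sigma> z))"
    by (rule sum.reindex_bij_witness[where i=\<sigma> and j=\<sigma>]) (auto simp: \<sigma>\<sigma> \<sigma>Z)
  then have "2 * (\<Sum>z\<in>Z. \<Theta> z) = (\<Sum>z\<in>Z. \<Theta> z + \<Theta> (\<sigma> z))" by (simp add: sum.distrib)
  also have "\<dots> \<le> 0" using pair by (rule sum_nonpos)
  finally have "(\<Sum>z\<in>Z. \<Theta> z) \<le> 0" by simp
  moreover have "(\<Sum>z\<in>Z. \<Theta> z) = 2 * dg w w + patch_inner P (M1 w) w"
    unfolding energy_eq[OF w] Z_def \<Theta>_def using finite_P finite_facets by (intro sum.Sigma[symmetric]) auto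
  ultimately show ?thesis by simp
qed

abbreviation ip0 where "ip0 w z \<equiv> patch_inner P (M0 w) z"

text \<open>\<open>M0 (X w) = A w + M1 w\<close> produces two copies of the form of
  \<open>M1\<close> on the left; the energy estimate absorbs one of them.\<close>

lemma X_dissipative:
  assumes w: "w \<in> V" shows "2 * ip0 (X w) w \<le> patch_inner P (M1 w) w"
proof -
  interpret fun_inner V "patch_inner P" by (rule fun_inner_L2)
  have "ip0 (X w) w = dg w w + patch_inner P (M1 w) w"
    unfolding M0_X[OF w] using w M1op_V[OF w] by (simp add: ip_add A_mem A_inner \<delta>_fun)
  then show ?thesis using energy[OF w] by simp
qed

lemma Mnorm_0: "Mnorm L G P \<phi>bot \<delta> 0 w = sqrt (ip0 w w)"
  by (simp add: Mnorm_def Mop_def[abs_def])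

lemma Mnorm_square:
  assumes "w \<in> V"
  shows "patch_inner P (Mop L G \<phi>bot \<delta> \<tau> w) w = ip0 w w - \<tau> * patch_inner P (M1 w) w"
proof -
  interpret fun_inner V "patch_inner P" by (rule fun_inner_L2)
  have "Mop L G \<phi>bot \<delta> \<tau> w = (\<lambda>x. (- \<tau>) *\<^sub>R M1 w x + M0 w x)" by (simp add: Mop_def fun_eq_iff)
  then show ?thesis using assms M1op_V[OF assms] M0op_V[OF assms] by (simp only: \<delta>_fun ip_comb)
qed

text \<open>In finite dimension the quotients are bounded, so the supremum bounds each of them. The
  function 0, where the quotient is \<open>0 / 0 = 0\<close>, is treated apart.\<close>

lemma induced_norm_bound:
  assumes w: "w \<in> V"
  shows "sqrt (ip0 (X w) (X w)) \<le> induced_norm V (Mnorm L G P \<phi>bot \<delta> 0) X * sqrt (ip0 w w)"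
    and "0 \<le> induced_norm V (Mnorm L G P \<phi>bot \<delta> 0) X"
proof -
  interpret fun_inner V ip0 by (rule fun_inner_M0)
  obtain I :: "((real^'n) set \<times> ('n \<Rightarrow> nat) \<times> 'l) set" and bs where "spanned_by I bs"
    using Vh_spanned[OF fun_inner_M0] .
  from linear_operator_bounded[where X=X, OF this X_mem X_comb] obtain C where C: "\<And>w. w \<in> V \<Longrightarrow> ip_norm (X w) \<le> C * ip_norm w" by blast
  have nmM: "Mnorm L G P \<phi>bot \<delta> 0 w = ip_norm w" for w by (simp add: Mnorm_0 ip_norm_def)
  have pos: "ip_norm w > 0" if "w \<in> V" "w \<noteq> (\<lambda>x. 0)" for w using ip_pos[OF that] by (simp add: ip_norm_def)
  have nm0: "ip_norm (\<lambda>x. 0) = 0" using ip_zero[OF zero_mem] by (simp add: ip_norm_def)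
  have "ip_norm (X w) / ip_norm w \<le> \<bar>C\<bar>" if "w \<in> V" for w
  proof (cases "w = (\<lambda>x. 0)")
    case False
    have "ip_norm (X w) \<le> \<bar>C\<bar> * ip_norm w"
      using C[OF that] mult_right_mono[OF abs_ge_self ip_norm_nonneg[OF that], of C] by linarith
    then show ?thesis using pos[OF that False] by (simp add: pos_divide_le_eq)
  qed (simp add: nm0)
  then have bdd: "bdd_above ((\<lambda>w. ip_norm (X w) / ip_norm w) ` V)" by (auto simp: bdd_above_def)
  have le: "ip_norm (X w) / ip_norm w \<le> induced_norm V (Mnorm L G P \<phi>bot \<delta> 0) X" if "w \<in> V" for w
    unfolding induced_norm_def nmM using that bdd by (rule cSUP_upper)
  show "0 \<le> induced_norm V (Mnorm L G P \<phi>bot \<delta> 0) X" using le[OF zero_mem] by (simp add: nm0)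
  show "sqrt (ip0 (X w) (X w)) \<le> induced_norm V (Mnorm L G P \<phi>bot \<delta> 0) X * sqrt (ip0 w w)"
  proof (cases "w = (\<lambda>x. 0)")
    case True
    then have "ip_norm (X w) \<le> 0" using C[OF w] nm0 by simp
    then show ?thesis using True nm0 by (simp add: ip_norm_def)
  next
    case False
    then show ?thesis using le[OF w] pos[OF w False] by (simp add: pos_divide_le_eq ip_norm_def)
  qed
qed

lemma explicit_flow_mem: "v0 \<in> V \<Longrightarrow> explicit_flow X q \<tau> v0 \<in> V"
proof (induction q)
  case (Suc q)
  then show ?case using V_comb[OF X_mem[OF Suc.IH[OF Suc.prems]] Suc.prems, of \<tau>] by (simp add: add.commute)
qed simp

text \<open>The abstract estimate with the form of \<open>M1\<close> as \<open>Q\<close>; its left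
  side is then the squared norm for \<open>M(\<tau>)\<close>.\<close>

lemma tent_stability:
  assumes \<beta>: "induced_norm V (Mnorm L G P \<phi>bot \<delta> 0) X \<le> \<beta>"
    and \<tau>: "0 \<le> \<tau>" "\<tau> \<le> 1" and q: "1 \<le> q" and v0: "v0 \<in> V"
  shows "Mnorm L G P \<phi>bot \<delta> \<tau> (explicit_flow X q \<tau> v0)
    \<le> (1 + \<beta> ^ (q + 1) * (\<Sum>l\<le>q. \<beta> ^ l)) * Mnorm L G P \<phi>bot \<delta> 0 v0"
proof -
  interpret fun_inner V ip0 by (rule fun_inner_M0)
  let ?v = "explicit_flow X q \<tau> v0" and ?c = "\<beta> ^ (q + 1) * (\<Sum>l\<le>q. \<beta> ^ l)"
  have \<beta>0: "0 \<le> \<beta>" using induced_norm_bound(2)[OF v0] \<beta> by linarith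
  have "sqrt (ip0 (X w) (X w)) \<le> \<beta> * sqrt (ip0 w w)" if "w \<in> V" for w
    using induced_norm_bound(1)[OF that] mult_right_mono[OF \<beta>, of "sqrt (ip0 w w)"] ip_nonneg[OF that] by simp
  then have "ip0 ?v ?v - \<tau> * patch_inner P (M1 ?v) ?v \<le> (1 + 2 * \<beta> ^ (q + 1) * (\<Sum>l\<le>q. \<beta> ^ l)) * ip0 v0 v0"
    using X_mem X_comb X_dissipative \<beta>0 \<tau> q v0
    by (intro explicit_flow_stable[OF fun_inner_M0, where Q="\<lambda>w. patch_inner P (M1 w) w"]) auto
  \<comment> \<open>Completing the square halves the constant 2 and makes the root explicit.\<close>
  also have "\<dots> \<le> (1 + ?c)\<^sup>2 * ip0 v0 v0"
    using ip_nonneg[OF v0] by (intro mult_right_mono) (simp_all add: power2_sum)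
  finally have "patch_inner P (Mop L G \<phi>bot \<delta> \<tau> ?v) ?v \<le> (1 + ?c)\<^sup>2 * ip0 v0 v0"
    by (simp add: Mnorm_square[OF explicit_flow_mem[OF v0]])
  then have "sqrt (patch_inner P (Mop L G \<phi>bot \<delta> \<tau> ?v) ?v) \<le> sqrt ((1 + ?c)\<^sup>2 * ip0 v0 v0)"
    by (rule real_sqrt_le_mono)
  also have "\<dots> = (1 + ?c) * sqrt (ip0 v0 v0)"
    using \<beta>0 by (simp add: real_sqrt_mult sum_nonneg)
  finally show ?thesis by (simp add: Mnorm_0 Mnorm_def[of _ _ _ _ _ \<tau>])
qed

end

text \<open>With \<open>\<beta> = C * h powr (1 / (q + 1))\<close> the factor
  \<open>\<beta> ^ (q + 1)\<close> is \<open>C ^ (q + 1) * h\<close>, and the geometric sum in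
  \<open>\<beta>\<close> is bounded uniformly over all meshes and tents.\<close>

theorem lemma4p11:
  fixes \<Omega> :: "(real^'n::finite) set"
    and L :: "'n \<Rightarrow> real^'n \<Rightarrow> real^'l^'l::finite"
    and G :: "real^'n \<Rightarrow> real^'l^'l"
    and B :: "real^'n \<Rightarrow> real^'l^'l"
    and \<M> :: "(real^'n) set set set"
    and S :: "(real^'n) set set \<Rightarrow> real^'n \<Rightarrow> real^'l^'l"
    and chat \<sigma> :: real and p q :: nat
  assumes "open \<Omega>" and "bounded \<Omega>"
    and mesh: "\<And>\<H>. \<H> \<in> \<M> \<Longrightarrow> conforming_mesh \<Omega> \<H>"
    and regular: "\<And>\<H>. \<H> \<in> \<M> \<Longrightarrow> shape_regular \<sigma> \<H>"
    and L_sym: "\<And>j x. x \<in> \<Omega> \<Longrightarrow> symmetric_matrix (L j x)"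
    and L_bounded: "\<And>j. bounded (L j ` \<Omega>)"
    and L_const: "\<And>\<H> K j. \<H> \<in> \<M> \<Longrightarrow> K \<in> \<H> \<Longrightarrow> L j constant_on interior K"
    and L_div: "distributional_div_zero \<Omega> L"
    and G_sym: "\<And>x. x \<in> \<Omega> \<Longrightarrow> symmetric_matrix (G x)"
    and G_bounded: "bounded (G ` \<Omega>)"
    and G_const: "\<And>\<H> K. \<H> \<in> \<M> \<Longrightarrow> K \<in> \<H> \<Longrightarrow> G constant_on interior K"
    and G_pos: "\<exists>\<gamma>>0. \<forall>x\<in>\<Omega>. \<forall>e. \<gamma> * (norm e)\<^sup>2 \<le> e \<bullet> (G x *v e)"
    and chat: "chat > max_speed \<Omega> L G"
    and S_meas: "\<And>\<H>. \<H> \<in> \<M> \<Longrightarrow> S \<H> \<in> borel_measurable (restrict_space borel (interior_skeleton \<Omega> \<H>))"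
    and S_bounded: "bounded (\<Union>\<H>\<in>\<M>. S \<H> ` interior_skeleton \<Omega> \<H>)"
    and S_psd: "\<And>\<H> x. \<H> \<in> \<M> \<Longrightarrow> x \<in> interior_skeleton \<Omega> \<H> \<Longrightarrow>
                  positive_semidefinite (S \<H> x + transpose (S \<H> x))"
    and B_meas: "B \<in> borel_measurable (restrict_space borel (frontier \<Omega>))"
    and B_bounded: "bounded (B ` frontier \<Omega>)"
    and B_psd: "\<And>x. x \<in> frontier \<Omega> \<Longrightarrow> positive_semidefinite (B x + transpose (B x))"
    and q: "q \<ge> 1"
  shows "\<forall>C>0. \<exists>cq>0. \<forall>\<H>\<in>\<M>. \<forall>v \<phi>bot \<phi>top. causal_tent chat \<H> v \<phi>bot \<phi>top \<longrightarrow>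
    (let P = vertex_patch \<H> v;
         h = patch_diameter P;
         \<delta> = (\<lambda>x. \<phi>top x - \<phi>bot x);
         V = Vh p P;
         X = Xh p \<Omega> L G (S \<H>) B P \<phi>bot \<delta>;
         nrm = Mnorm L G P \<phi>bot \<delta>
     in induced_norm V (nrm 0) X \<le> C * h powr (1 / (real q + 1)) \<longrightarrow>
        (\<forall>\<tau>. 0 \<le> \<tau> \<and> \<tau> \<le> 1 \<longrightarrow>
          (\<forall>v0\<in>V. nrm \<tau> (explicit_flow X q \<tau> v0) \<le> (1 + cq * h) * nrm 0 v0)))"
proof (intro allI impI)
  fix C :: real assume C: "C > 0"
  \<comment> \<open>\<open>\<rho>\<close> bounds every admissible \<open>\<beta>\<close>, because
    all elements lie in \<open>closure \<Omega>\<close>.\<close>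
  define \<rho> where "\<rho> = C * diameter (closure \<Omega>) powr (1 / (real q + 1))"
  define cq where "cq = C ^ (q + 1) * (\<Sum>l\<le>q. \<rho> ^ l)"
  have bO: "bounded (closure \<Omega>)" using \<open>bounded \<Omega>\<close> by (rule bounded_closure)
  have \<rho>0: "0 \<le> \<rho>" using C by (simp add: \<rho>_def)
  \<comment> \<open>The term with index 0 is 1, which keeps \<open>cq\<close> positive even for
    \<open>\<rho> = 0\<close>.\<close>
  have "(\<Sum>l\<le>q. \<rho> ^ l) \<ge> \<rho> ^ 0" using \<rho>0 by (intro member_le_sum) auto
  then have cq: "cq > 0" using C by (simp add: cq_def)
  have main: "Mnorm L G (vertex_patch \<H> v) \<phi>bot \<delta> \<tau>
      (explicit_flow (Xh p \<Omega> L G (S \<H>) B (vertex_patch \<H> v) \<phi>bot \<delta>) q \<tau> v0)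
      \<le> (1 + cq * patch_diameter (vertex_patch \<H> v)) * Mnorm L G (vertex_patch \<H> v) \<phi>bot \<delta> 0 v0"
    if \<H>: "\<H> \<in> \<M>" and T: "causal_tent chat \<H> v \<phi>bot \<phi>top" and \<delta>: "\<delta> = (\<lambda>x. \<phi>top x - \<phi>bot x)"
      and X: "induced_norm (Vh p (vertex_patch \<H> v)) (Mnorm L G (vertex_patch \<H> v) \<phi>bot \<delta> 0)
        (Xh p \<Omega> L G (S \<H>) B (vertex_patch \<H> v) \<phi>bot \<delta>)
        \<le> C * patch_diameter (vertex_patch \<H> v) powr (1 / (real q + 1))"
      and \<tau>: "0 \<le> \<tau>" "\<tau> \<le> 1" and v0: "v0 \<in> Vh p (vertex_patch \<H> v)"
    for \<H> v \<phi>bot \<phi>top \<delta> \<tau> v0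
  proof -
    interpret tent \<Omega> \<H> L G B "S \<H>" chat p v \<phi>bot \<phi>top
    proof
      show "bounded (S \<H> ` interior_skeleton \<Omega> \<H>)" by (rule bounded_subset[OF S_bounded]) (use \<H> in auto)
    qed (use assms \<H> T in auto)
    have \<delta>': "tent.\<delta> \<phi>bot \<phi>top = \<delta>" by (simp add: \<delta> \<delta>_fun)
    let ?h = "patch_diameter P" and ?e = "1 / (real q + 1)"
    have "v \<in> mesh_vertices \<H>" using T by (auto simp: causal_tent_def Let_def)
    then have P: "P \<noteq> {}" by (auto simp: mesh_vertices_def vertex_patch_def)
    then have "?h \<in> diameter ` P"
      unfolding patch_diameter_def using finite_P by (intro Max_in) auto
    then obtain K where K: "K \<in> P" "?h = diameter K" by blast
    have h: "0 \<le> ?h" "?h \<le> diameter (closure \<Omega>)"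
      using K diameter_ge_0[OF compact_imp_bounded[OF P_body(1)[OF K(1)]]]
        diameter_subset[OF elem_subset_closure[OF P_mesh[OF K(1)]] bO] by auto
    define \<beta> where "\<beta> = C * ?h powr ?e"
    have \<beta>: "0 \<le> \<beta>" "\<beta> \<le> \<rho>"
      unfolding \<beta>_def \<rho>_def using C h by (auto intro!: mult_left_mono powr_mono2)
    \<comment> \<open>For \<open>?h = 0\<close> both sides are 0, since \<open>powr\<close> has the
      value 0 at base 0.\<close>
    have "(?h powr ?e) ^ (q + 1) = ?h"
    proof (cases "?h = 0")
      case False
      then have "(?h powr ?e) ^ (q + 1) = (?h powr ?e) powr real (q + 1)"
        using h by (intro powr_realpow[symmetric]) simp
      also have "\<dots> = ?h powr (?e * real (q + 1))" by (rule powr_powr)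
      also have "?e * real (q + 1) = 1" by simp
      finally show ?thesis using h by simp
    qed simp
    then have "\<beta> ^ (q + 1) = C ^ (q + 1) * ?h" unfolding \<beta>_def power_mult_distrib by simp
    then have "\<beta> ^ (q + 1) * (\<Sum>l\<le>q. \<beta> ^ l) \<le> C ^ (q + 1) * ?h * (\<Sum>l\<le>q. \<rho> ^ l)"
      using \<beta> C h by (auto intro!: mult_left_mono sum_mono power_mono)
    then have le: "\<beta> ^ (q + 1) * (\<Sum>l\<le>q. \<beta> ^ l) \<le> cq * ?h" by (simp add: cq_def mult_ac)
    have "Mnorm L G P \<phi>bot \<delta> \<tau> (explicit_flow (Xh p \<Omega> L G (S \<H>) B P \<phi>bot \<delta>) q \<tau> v0)
      \<le> (1 + \<beta> ^ (q + 1) * (\<Sum>l\<le>q. \<beta> ^ l)) * Mnorm L G P \<phi>bot \<delta> 0 v0"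
      using tent_stability[OF _ \<tau> q v0, of \<beta>] X unfolding \<delta>' \<beta>_def by simp
    also have "\<dots> \<le> (1 + cq * ?h) * Mnorm L G P \<phi>bot \<delta> 0 v0"
    proof (rule mult_right_mono)
      show "0 \<le> Mnorm L G P \<phi>bot \<delta> 0 v0"
        using fun_inner.ip_nonneg[OF fun_inner_M0 v0] by (simp add: Mnorm_0[unfolded \<delta>'])
    qed (use le in simp)
    finally show ?thesis .
  qed
  show "\<exists>cq>0. \<forall>\<H>\<in>\<M>. \<forall>v \<phi>bot \<phi>top. causal_tent chat \<H> v \<phi>bot \<phi>top \<longrightarrow>
    (let P = vertex_patch \<H> v; h = patch_diameter P; \<delta> = (\<lambda>x. \<phi>top x - \<phi>bot x); V = Vh p P;
         X = Xh p \<Omega> L G (S \<H>) B P \<phi>bot \<delta>; nrm = Mnorm L G P \<phi>bot \<delta>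
     in induced_norm V (nrm 0) X \<le> C * h powr (1 / (real q + 1)) \<longrightarrow>
        (\<forall>\<tau>. 0 \<le> \<tau> \<and> \<tau> \<le> 1 \<longrightarrow>
          (\<forall>v0\<in>V. nrm \<tau> (explicit_flow X q \<tau> v0) \<le> (1 + cq * h) * nrm 0 v0)))"
    unfolding Let_def using cq main[OF _ _ refl] by (intro exI[of _ cq]) blast
qed

end
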